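(* For the group $G_2$, \[\frac{1}{|G_2|}\sum_{\sigma\in G_2}\frac{1}{\det(I-t\sigma)}=\sum_{n\equiv0\pmod8}\left(\dim\mathfrak{J}^{(2)}_n\right)t^n=\frac{N(t)}{(1-t^8)^2(1-t^{24})^4(1-t^{40})^2},\] where $N(t)=t^{184}+8t^{176}+49t^{168}+325t^{160}+1240t^{152}+3421t^{144}+7987t^{136}+15287t^{128}+24892t^{120}+35648t^{112}+45097t^{104}+50365t^{96}+50365t^{88}+45097t^{80}+35648t^{72}+24892t^{64}+15287t^{56}+7987t^{48}+3421t^{40}+1240t^{32}+325t^{24}+49t^{16}+8t^8+1$; this expands as $1+10t^8+68t^{16}+455t^{24}+2114t^{32}+7392t^{40}+\cdots$.
   Context: A binary linear code $C\subseteq\mathbb{F}_2^n$ is Type II if $C=C^\perp$ and all codeword weights are divisible by $4$. For $u_1,u_2\in C$, $a\in\mathbb{F}_2^2$, $X\subseteq[n]$, let $n_{a,X}(u_1,u_2)$ be the number of $i\in X$ with $(u_{1i},u_{2i})=a$. For $T\subseteq[n]$ the genus-$2$ Jacobi polynomial is $J^{(2)}_{C,T}=\sum_{u_1,u_2\in C}\prod_{a\in\mathbb{F}_2^2}y_a^{n_{a,T}(u_1,u_2)}x_a^{n_{a,[n]\setminus T}(u_1,u_2)}$. $\mathfrak{J}^{(2)}$ is the $\mathbb{C}$-algebra generated by all $J^{(2)}_{C,T}$ with $C$ a Type II code and $T$ a subset of its coordinates; $\mathfrak{J}^{(2)}_n$ is its degree-$n$ homogeneous part. Matrices act on polynomials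 in the $8$ variables arranged as $v=((x_a)_{a},(y_a)_{a})$, $a\in\mathbb{F}_2^2$ in lexicographic order, by $(\tau f)(v)=f(\tau v)$. $G_2\subseteq\mathrm{GL}(8,\mathbb{C})$ is generated by: $\mathrm{diag}(T_2,T_2)$ with $T_2=\left(\frac{1+i}{2}\right)^2((-1)^{a\cdot b})_{a,b\in\mathbb{F}_2^2}$; $\mathrm{diag}(E_2,E_2)$ with $E_2=\mathrm{diag}(1,i,1,i)$; $\mathrm{diag}(M(\sigma),M(\sigma))$ for every affine map $\sigma(a)=Ma+w$ ($M\in\mathrm{GL}(2,\mathbb{F}_2)$, $w\in\mathbb{F}_2^2$), where $M(\sigma)$ is the $(0,1)$-matrix with nonzero entries exactly at $(a,\sigma(a))$; and the scalar $\eta_8=(1+i)/\sqrt2$. *)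

theory Defs
  imports
    "HOL-Analysis.Analysis"
    "HOL-Algebra.Generated_Groups"
    "HOL-Library.Z2"
    "HOL-Library.Poly_Mapping"
    "HOL-Computational_Algebra.Formal_Power_Series"
begin

instance bit :: finite
proof
  have "(UNIV :: bit set) = {0, 1}"
    using bit.exhaust by auto
  then show "finite (UNIV :: bit set)"
    by (metis finite.emptyI finite.insertI)
qed


section \<open>Type II codes\<close>

text \<open>The length is a natural number ranging over all values, so a word of length \<open>n\<close> is a
  function on \<open>nat\<close> vanishing outside the coordinate set \<open>[n] = {1..n}\<close>.\<close>

definition words :: "nat \<Rightarrow> (nat \<Rightarrow> bit) set" where
  "words n = {u. \<forall>i. i \<notin> {1..n} \<longrightarrow> u i = 0}"

definition binary_linear_code :: "nat \<Rightarrow> (nat \<Rightarrow> bit) set \<Rightarrow> bool" where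
  "binary_linear_code n C \<longleftrightarrow>
     C \<subseteq> words n \<and>
     (\<lambda>i. 0) \<in> C \<and>
     (\<forall>u\<in>C. \<forall>v\<in>C. (\<lambda>i. u i + v i) \<in> C) \<and>
     (\<forall>c. \<forall>u\<in>C. (\<lambda>i. c * u i) \<in> C)"

definition dual_code :: "nat \<Rightarrow> (nat \<Rightarrow> bit) set \<Rightarrow> (nat \<Rightarrow> bit) set" where
  "dual_code n C = {v \<in> words n. \<forall>u\<in>C. (\<Sum>i=1..n. u i * v i) = 0}"

definition weight :: "nat \<Rightarrow> (nat \<Rightarrow> bit) \<Rightarrow> nat" where
  "weight n u = card {i \<in> {1..n}. u i \<noteq> 0}"

definition type_II :: "nat \<Rightarrow> (nat \<Rightarrow> bit) set \<Rightarrow> bool" where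
  "type_II n C \<longleftrightarrow>
     binary_linear_code n C \<and> C = dual_code n C \<and> (\<forall>u\<in>C. 4 dvd weight n u)"


section \<open>Jacobi polynomials of genus 2\<close>

text \<open>The variables are indexed by two copies of \<open>\<bbbF>\<^sub>2\<^sup>2\<close>: \<open>Inl a\<close> stands for \<open>x\<^sub>a\<close> and
  \<open>Inr a\<close> for \<open>y\<^sub>a\<close>. A polynomial maps monomials (exponent functions) to coefficients.\<close>

type_synonym var = "(bit ^ 2) + (bit ^ 2)"

type_synonym cpoly = "(var \<Rightarrow>\<^sub>0 nat) \<Rightarrow>\<^sub>0 complex"

definition const_poly :: "complex \<Rightarrow> cpoly" where
  "const_poly c = Poly_Mapping.single 0 c"

definition var_poly :: "var \<Rightarrow> cpoly" where
  "var_poly z = Poly_Mapping.single (Poly_Mapping.single z 1) 1"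

definition scale_poly :: "complex \<Rightarrow> cpoly \<Rightarrow> cpoly" where
  "scale_poly c f = const_poly c * f"

global_interpretation cpoly: vector_space scale_poly
  defines cpoly_dim = cpoly.dim
  by unfold_locales
    (simp_all add: scale_poly_def const_poly_def algebra_simps single_add mult_single
      flip: mult.assoc)

definition homogeneous :: "nat \<Rightarrow> cpoly \<Rightarrow> bool" where
  "homogeneous n f \<longleftrightarrow>
     (\<forall>m \<in> Poly_Mapping.keys f. (\<Sum>z\<in>UNIV. Poly_Mapping.lookup m z) = n)"

definition pair_count :: "bit ^ 2 \<Rightarrow> nat set \<Rightarrow> (nat \<Rightarrow> bit) \<Rightarrow> (nat \<Rightarrow> bit) \<Rightarrow> nat" where
  "pair_count a X u1 u2 = card {i \<in> X. u1 i = a $ 1 \<and> u2 i = a $ 2}"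

definition jacobi_poly :: "nat \<Rightarrow> (nat \<Rightarrow> bit) set \<Rightarrow> nat set \<Rightarrow> cpoly" where
  "jacobi_poly n C T =
     (\<Sum>(u1, u2) \<in> C \<times> C. \<Prod>a\<in>UNIV.
        var_poly (Inr a) ^ pair_count a T u1 u2 *
        var_poly (Inl a) ^ pair_count a ({1..n} - T) u1 u2)"

inductive_set generated_algebra :: "cpoly set \<Rightarrow> cpoly set" for S where
  const: "const_poly c \<in> generated_algebra S"
| incl: "f \<in> S \<Longrightarrow> f \<in> generated_algebra S"
| add: "f \<in> generated_algebra S \<Longrightarrow> g \<in> generated_algebra S \<Longrightarrow> f + g \<in> generated_algebra S"
| mult: "f \<in> generated_algebra S \<Longrightarrow> g \<in> generated_algebra S \<Longrightarrow> f * g \<in> generated_algebra S"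

definition jacobi_algebra :: "cpoly set" where
  "jacobi_algebra = generated_algebra {jacobi_poly n C T | n C T. type_II n C \<and> T \<subseteq> {1..n}}"

definition jacobi_algebra_part :: "nat \<Rightarrow> cpoly set" where
  "jacobi_algebra_part n = {f \<in> jacobi_algebra. homogeneous n f}"


section \<open>The group \<open>G\<^sub>2\<close>\<close>

text \<open>The scalar \<open>\<eta>\<^sub>8\<close> is \<open>mat eta8\<close>. Matrices have rows and columns indexed by \<open>\<bbbF>\<^sub>2\<^sup>2\<close>, respectively by the eight variables.\<close>

type_synonym cmat4 = "complex ^ (bit ^ 2) ^ (bit ^ 2)"

type_synonym cmat8 = "complex ^ var ^ var"

definition diag2 :: "cmat4 \<Rightarrow> cmat8" where
  "diag2 A = (\<chi> r c. case (r, c) of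
       (Inl a, Inl b) \<Rightarrow> A $ a $ b
     | (Inr a, Inr b) \<Rightarrow> A $ a $ b
     | _ \<Rightarrow> 0)"

definition T2 :: cmat4 where
  "T2 = (\<chi> a b. ((1 + \<i>) / 2)^2 * (if (\<Sum>k\<in>UNIV. a $ k * b $ k) = 0 then 1 else -1))"

text \<open>In the lexicographic order \<open>00, 01, 10, 11\<close> the diagonal is \<open>1, i, 1, i\<close>.\<close>

definition E2 :: cmat4 where
  "E2 = (\<chi> a b. if a = b then (if a $ 2 = 1 then \<i> else 1) else 0)"

definition affine_matrix :: "(bit ^ 2 \<Rightarrow> bit ^ 2) \<Rightarrow> cmat4" where
  "affine_matrix \<sigma> = (\<chi> a b. if b = \<sigma> a then 1 else 0)"

definition affine_maps :: "(bit ^ 2 \<Rightarrow> bit ^ 2) set" where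
  "affine_maps = {\<lambda>a. M *v a + w | (M :: bit ^ 2 ^ 2) w. invertible M}"

definition eta8 :: complex where
  "eta8 = (1 + \<i>) / complex_of_real (sqrt 2)"

definition GL8 :: "cmat8 monoid" where
  "GL8 = \<lparr>carrier = {A. invertible A}, monoid.mult = (**), one = mat 1\<rparr>"

definition G2 :: "cmat8 set" where
  "G2 = generate GL8
     ({diag2 T2, diag2 E2, mat eta8} \<union> {diag2 (affine_matrix \<sigma>) | \<sigma>. \<sigma> \<in> affine_maps})"


section \<open>Generating functions\<close>

definition id_minus_t :: "cmat8 \<Rightarrow> (complex fps) ^ var ^ var" where
  "id_minus_t \<sigma> = mat 1 - (\<chi> r c. fps_X * fps_const (\<sigma> $ r $ c))"

definition molien_series :: "cmat8 set \<Rightarrow> complex fps" where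
  "molien_series G = fps_const (1 / of_nat (card G)) * (\<Sum>\<sigma>\<in>G. 1 / det (id_minus_t \<sigma>))"

definition jacobi_dim_series :: "complex fps" where
  "jacobi_dim_series =
     Abs_fps (\<lambda>n. if n mod 8 = 0 then of_nat (cpoly_dim (jacobi_algebra_part n)) else 0)"

end

theory Submission
  imports Defs "HOL-Combinatorics.Permutations"
begin

text \<open>Molien's theorem expresses the left-hand side as the generating function of the dimensions of
  the invariants of \<open>G\<^sub>2\<close>: the trace of a diagonalisable \<open>\<sigma>\<close> on the forms of degree \<open>n\<close> is a
  coefficient of \<open>1 / det(1 - t\<sigma>)\<close>, and the averaging projection has trace equal to its rank.

  The invariants of degree \<open>n\<close> are spanned by Jacobi polynomials. A monomial of degree \<open>n\<close> is given
  by a pair of words, and \<open>\<Lambda>(D)\<close> denotes the sum of the averages of the monomials of all pairs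
  from a doubly even code \<open>D\<close>. The group contains the Hadamard transform of the second bit;
  applied to \<open>\<Lambda>(D)\<close> it gives
  \<open>(1 - c |D| + c |A| / 3) \<Lambda>(D) = (c / 3) \<Sum>\<^bsub>v \<in> A\<^esub> \<Lambda>(D + \<langle>v\<rangle>)\<close> with \<open>c = 2\<^bsup>-n/2\<^esup>\<close>, where \<open>A\<close> is the set of
  doubly even words in the dual code of \<open>D\<close> outside \<open>D\<close>. For \<open>D\<close> properly contained in its dual we have
  \<open>c |D| < 1\<close>, so downward induction on \<open>D\<close> reduces everything to self-dual codes, for which \<open>\<Lambda>\<close> is a
  Jacobi polynomial.

  The group has order \<open>92160\<close>: it consists of diagonal copies of \<open>\<eta>\<^sub>8\<^sup>k D P R\<^sub>j\<close> with \<open>D\<close> diagonal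
  over \<open>\<mu>\<^sub>4\<close> of determinant \<open>\<plusminus>1\<close>, \<open>P\<close> a permutation matrix and \<open>R\<^sub>j\<close> one of \<open>15\<close> coset
  representatives. Only degrees divisible by \<open>8\<close> contribute, so the sum over the group depends on
  characteristic polynomials up to \<open>\<mu>\<^sub>4\<close>, of which there are \<open>17\<close>.\<close>

section \<open>Linear substitutions in polynomials\<close>

text \<open>\<open>G2\<close> is the complex Clifford group of genus 2: modulo its 8 scalars it is
  an extension of Sp(4,2) by F_2^4, whence the order 8 * 16 * 720. The 15 representatives R_j are
  the bases belonging to the 15 Lagrangian subspaces of F_2^4; their 60 rows span 60 different
  lines, so a single row of an element already reveals its coset.

  The two sets of variables do not complicate the reduction to codes, since every group element acts
  on both in the same way: a monomial is a product over coordinates, T records which of them carry a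
  y, and T stays fixed while the pair of words varies.

  What shapes the last third is that the sum over the group must be evaluated inside the logic. The
  characteristic polynomial of D P R_j depends on D only through the principal minors of P R_j, so
  these are computed once for all D. Rational functions are avoided as well: over a common
  denominator in t^8 the whole summation becomes one identity between polynomials with Gaussian
  integer coefficients.\<close>

abbreviation coef :: "cpoly \<Rightarrow> (var \<Rightarrow>\<^sub>0 nat) \<Rightarrow> complex" where
  "coef \<equiv> Poly_Mapping.lookup"

abbreviation expo :: "(var \<Rightarrow>\<^sub>0 nat) \<Rightarrow> var \<Rightarrow> nat" where
  "expo \<equiv> Poly_Mapping.lookup"

definition mdeg :: "(var \<Rightarrow>\<^sub>0 nat) \<Rightarrow> nat" where
  "mdeg m = (\<Sum>z\<in>UNIV. expo m z)"

definition pmono :: "(var \<Rightarrow>\<^sub>0 nat) \<Rightarrow> cpoly" where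
  "pmono m = Poly_Mapping.single m 1"

definition lin_form :: "cmat8 \<Rightarrow> var \<Rightarrow> cpoly" where
  "lin_form A z = (\<Sum>w\<in>UNIV. const_poly (A $ z $ w) * var_poly w)"

definition pmono_act :: "cmat8 \<Rightarrow> (var \<Rightarrow>\<^sub>0 nat) \<Rightarrow> cpoly" where
  "pmono_act A m = (\<Prod>z\<in>UNIV. lin_form A z ^ expo m z)"

text \<open>This is f(Av), where v is the column of variables: the variable z is replaced by the
  linear form in row z of A.\<close>

definition act :: "cmat8 \<Rightarrow> cpoly \<Rightarrow> cpoly" where
  "act A f = (\<Sum>m\<in>Poly_Mapping.keys f. const_poly (coef f m) * pmono_act A m)"

lemma const_poly_0 [simp]: "const_poly 0 = 0"
  by (simp add: const_poly_def)

lemma const_poly_1 [simp]: "const_poly 1 = 1"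
  by (simp add: const_poly_def)

lemma const_poly_add: "const_poly (a + b) = const_poly a + const_poly b"
  by (simp add: const_poly_def single_add)

lemma const_poly_mult: "const_poly (a * b) = const_poly a * const_poly b"
  by (simp add: const_poly_def mult_single)

lemma const_poly_sum: "const_poly (sum f S) = (\<Sum>x\<in>S. const_poly (f x))"
  by (induction S rule: infinite_finite_induct) (simp_all add: const_poly_add)

lemma const_poly_prod: "const_poly (prod f S) = (\<Prod>x\<in>S. const_poly (f x))"
  by (induction S rule: infinite_finite_induct) (simp_all add: const_poly_mult)

lemma const_poly_power: "const_poly (a ^ n) = const_poly a ^ n"
  by (induction n) (simp_all add: const_poly_mult)

lemma const_poly_of_nat: "const_poly (of_nat n) = of_nat n"
  by (induction n) (simp_all add: const_poly_add)

lemma pmono_0 [simp]: "pmono 0 = 1"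
  by (simp add: pmono_def)

lemma pmono_add: "pmono (m + m') = pmono m * pmono m'"
  by (simp add: pmono_def mult_single)

lemma coef_const_mult [simp]: "coef (const_poly c * f) m = c * coef f m"
proof -
  have "const_poly c * f = Poly_Mapping.map ((*) c) f"
    by (simp add: mult_map_scale_conv_mult const_poly_def)
  then show ?thesis
    by (simp add: Poly_Mapping.map.rep_eq when_def)
qed

lemma coef_scale [simp]: "coef (scale_poly c f) m = c * coef f m"
  by (simp add: scale_poly_def)

lemma coef_pmono: "coef (pmono m) m' = (if m = m' then 1 else 0)"
  by (simp add: pmono_def lookup_single when_def)

lemma poly_sum_monoms_superset:
  assumes "finite S" "Poly_Mapping.keys f \<subseteq> S"
  shows "f = (\<Sum>m\<in>S. const_poly (coef f m) * pmono m)"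
proof (rule poly_mapping_eqI)
  fix k
  have "coef (\<Sum>m\<in>S. const_poly (coef f m) * pmono m) k
      = (\<Sum>m\<in>S. if m = k then coef f m else 0)"
    by (simp add: lookup_sum coef_pmono if_distrib cong: if_cong)
  also have "\<dots> = coef f k"
    using assms by (auto simp: in_keys_iff)
  finally show "coef f k = coef (\<Sum>m\<in>S. const_poly (coef f m) * pmono m) k" ..
qed

lemma poly_sum_monoms: "f = (\<Sum>m\<in>Poly_Mapping.keys f. const_poly (coef f m) * pmono m)"
  by (rule poly_sum_monoms_superset) auto

lemma pmono_eq_prod: "pmono m = (\<Prod>z\<in>UNIV. var_poly z ^ expo m z)"
proof -
  have pow: "var_poly z ^ k = pmono (Poly_Mapping.single z k)" for z k
    by (induction k)
      (simp_all add: var_poly_def pmono_def mult_single flip: single_add)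
  have "pmono (\<Sum>z\<in>S. g z) = (\<Prod>z\<in>S. pmono (g z))" if "finite S" for S and g :: "var \<Rightarrow> _"
    using that by induction (simp_all add: pmono_add)
  from this[of UNIV "\<lambda>z. Poly_Mapping.single z (expo m z)"]
  have "(\<Prod>z\<in>UNIV. var_poly z ^ expo m z) = pmono (\<Sum>z\<in>UNIV. Poly_Mapping.single z (expo m z))"
    by (simp add: pow)
  also have "(\<Sum>z\<in>UNIV. Poly_Mapping.single z (expo m z)) = m"
    by (rule poly_mapping_eqI) (simp add: lookup_sum lookup_single when_def)
  finally show ?thesis by simp
qed

lemma act_superset:
  assumes "finite S" "Poly_Mapping.keys f \<subseteq> S"
  shows "act A f = (\<Sum>m\<in>S. const_poly (coef f m) * pmono_act A m)"
  unfolding act_def using assms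
  by (intro sum.mono_neutral_left) (auto simp: in_keys_iff)

lemma act_add: "act A (f + g) = act A f + act A g"
proof -
  define S where "S = Poly_Mapping.keys f \<union> Poly_Mapping.keys g"
  have S: "finite S" "Poly_Mapping.keys f \<subseteq> S" "Poly_Mapping.keys g \<subseteq> S"
    "Poly_Mapping.keys (f + g) \<subseteq> S"
    using Poly_Mapping.keys_add[of f g] by (auto simp: S_def)
  show ?thesis
    by (simp add: act_superset[OF S(1)] S lookup_add const_poly_add distrib_right sum.distrib)
qed

lemma act_0 [simp]: "act A 0 = 0"
  by (simp add: act_def)

lemma act_sum: "act A (sum f S) = (\<Sum>x\<in>S. act A (f x))"
  by (induction S rule: infinite_finite_induct) (simp_all add: act_add)

lemma act_const_mult: "act A (const_poly c * f) = const_poly c * act A f"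
proof -
  have "Poly_Mapping.keys (const_poly c * f) \<subseteq> Poly_Mapping.keys f"
    by (auto simp: in_keys_iff)
  then have "act A (const_poly c * f)
      = (\<Sum>m\<in>Poly_Mapping.keys f. const_poly (c * coef f m) * pmono_act A m)"
    by (subst act_superset) auto
  then show ?thesis
    unfolding act_def by (simp only: sum_distrib_left const_poly_mult mult.assoc)
qed

lemma act_pmono: "act A (pmono m) = pmono_act A m"
  by (simp add: act_def pmono_def)

lemma pmono_act_add: "pmono_act A (m + m') = pmono_act A m * pmono_act A m'"
  by (simp add: pmono_act_def lookup_add power_add prod.distrib)

lemma act_mult: "act A (f * g) = act A f * act A g"
proof -
  have "f * g = (\<Sum>m\<in>Poly_Mapping.keys f. \<Sum>m'\<in>Poly_Mapping.keys g.
      const_poly (coef f m) * (const_poly (coef g m') * pmono (m + m')))"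
    by (subst poly_sum_monoms[of f], subst poly_sum_monoms[of g])
      (simp add: sum_product pmono_add mult_ac)
  then have "act A (f * g) = (\<Sum>m\<in>Poly_Mapping.keys f. \<Sum>m'\<in>Poly_Mapping.keys g.
      const_poly (coef f m) * (const_poly (coef g m') * (pmono_act A m * pmono_act A m')))"
    by (simp add: act_sum act_const_mult act_pmono pmono_act_add)
  also have "\<dots> = act A f * act A g"
    by (simp add: act_def sum_product mult_ac)
  finally show ?thesis .
qed

lemma act_const [simp]: "act A (const_poly c) = const_poly c"
  using act_const_mult[of A c "pmono 0"] act_pmono[of A 0] by (simp add: pmono_act_def)

lemma act_1 [simp]: "act A 1 = 1"
  using act_const[of A 1] by simp

lemma act_power: "act A (f ^ n) = act A f ^ n"
  by (induction n) (simp_all add: act_mult)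

lemma act_prod: "act A (prod f S) = (\<Prod>x\<in>S. act A (f x))"
  by (induction S rule: infinite_finite_induct) (simp_all add: act_mult)

lemma act_var: "act A (var_poly z) = lin_form A z"
proof -
  have "act A (var_poly z) = (\<Prod>w\<in>UNIV. lin_form A w ^ expo (Poly_Mapping.single z 1) w)"
    using act_pmono[of A "Poly_Mapping.single z 1"] by (simp add: pmono_def var_poly_def pmono_act_def)
  also have "\<dots> = (\<Prod>w\<in>UNIV. if w = z then lin_form A w else 1)"
    by (intro prod.cong) (auto simp: lookup_single when_def)
  finally show ?thesis by simp
qed

lemma act_lin_form: "act A (lin_form B z) = lin_form (B ** A) z"
proof -
  have "act A (lin_form B z)
      = (\<Sum>w\<in>UNIV. \<Sum>v\<in>UNIV. const_poly (B $ z $ w * A $ w $ v) * var_poly v)"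
    by (simp add: lin_form_def[of B] act_sum act_const_mult act_var lin_form_def[of A]
        sum_distrib_left const_poly_mult mult.assoc)
  also have "\<dots> = lin_form (B ** A) z"
    by (subst sum.swap)
      (simp add: lin_form_def matrix_matrix_mult_def const_poly_sum sum_distrib_right)
  finally show ?thesis .
qed

text \<open>Substitution is contravariant: replacing v by Av in f(Bv) gives f(BAv), so matrices act
  from the right.\<close>

lemma act_act: "act A (act B f) = act (B ** A) f"
  by (simp add: act_def[of B] act_sum act_const_mult pmono_act_def act_prod act_power
      act_lin_form act_def[of "B ** A"])

lemma lin_form_mat_1: "lin_form (mat 1) z = var_poly z"
proof -
  have "lin_form (mat 1) z = (\<Sum>w\<in>UNIV. if z = w then var_poly w else 0)"
    unfolding lin_form_def by (intro sum.cong) (auto simp: mat_def)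
  then show ?thesis by simp
qed

lemma act_mat_1: "act (mat 1) f = f"
  by (subst (2) poly_sum_monoms[of f]) (simp add: act_def pmono_act_def lin_form_mat_1 pmono_eq_prod)


section \<open>Homogeneous polynomials\<close>

lemma homogeneous_iff: "homogeneous n f \<longleftrightarrow> (\<forall>m. coef f m \<noteq> 0 \<longrightarrow> mdeg m = n)"
  by (auto simp: homogeneous_def in_keys_iff mdeg_def)

lemma mdeg_add: "mdeg (m + m') = mdeg m + mdeg m'"
  by (simp add: mdeg_def lookup_add sum.distrib)

lemma homogeneous_0 [simp]: "homogeneous n 0"
  by (simp add: homogeneous_iff)

lemma homogeneous_add: "homogeneous n f \<Longrightarrow> homogeneous n g \<Longrightarrow> homogeneous n (f + g)"
  unfolding homogeneous_iff lookup_add by (metis add_0)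

lemma homogeneous_sum: "(\<And>x. x \<in> S \<Longrightarrow> homogeneous n (f x)) \<Longrightarrow> homogeneous n (sum f S)"
  by (induction S rule: infinite_finite_induct) (auto intro: homogeneous_add)

lemma homogeneous_mult:
  assumes "homogeneous n f" "homogeneous k g"
  shows "homogeneous (n + k) (f * g)"
  using keys_mult[of f g] assms
  by (auto simp: homogeneous_def lookup_add sum.distrib)

lemma homogeneous_const: "homogeneous 0 (const_poly c)"
  by (auto simp: homogeneous_iff const_poly_def lookup_single when_def mdeg_def)

lemma homogeneous_const_mult: "homogeneous n f \<Longrightarrow> homogeneous n (const_poly c * f)"
  by (simp add: homogeneous_iff)

lemma homogeneous_prod:
  "(\<And>x. x \<in> S \<Longrightarrow> homogeneous (d x) (f x)) \<Longrightarrow> homogeneous (sum d S) (prod f S)"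
  by (induction S rule: infinite_finite_induct)
    (use homogeneous_const[of 1] in \<open>auto intro: homogeneous_mult\<close>)

lemma homogeneous_power: "homogeneous n f \<Longrightarrow> homogeneous (k * n) (f ^ k)"
  by (induction k) (use homogeneous_const[of 1] in \<open>auto intro: homogeneous_mult\<close>)

lemma homogeneous_pmono: "homogeneous (mdeg m) (pmono m)"
  by (simp add: homogeneous_iff coef_pmono)

lemma homogeneous_var: "homogeneous 1 (var_poly z)"
  using homogeneous_pmono[of "Poly_Mapping.single z 1"]
  by (simp add: mdeg_def lookup_single when_def pmono_def var_poly_def)

lemma homogeneous_pmono_act: "homogeneous (mdeg m) (pmono_act A m)"
proof -
  have "homogeneous 1 (lin_form A z)" for z
    unfolding lin_form_def
    by (intro homogeneous_sum homogeneous_const_mult homogeneous_var)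
  then show ?thesis
    unfolding pmono_act_def mdeg_def
    by (intro homogeneous_prod) (use homogeneous_power[of 1] in simp)
qed

lemma homogeneous_act:
  assumes "homogeneous n f"
  shows "homogeneous n (act A f)"
  unfolding act_def
proof (intro homogeneous_sum homogeneous_const_mult)
  fix m assume "m \<in> Poly_Mapping.keys f"
  with assms have "mdeg m = n" by (simp add: homogeneous_def mdeg_def)
  then show "homogeneous n (pmono_act A m)"
    using homogeneous_pmono_act by blast
qed

definition monoms :: "nat \<Rightarrow> (var \<Rightarrow>\<^sub>0 nat) set" where
  "monoms n = {m. mdeg m = n}"

lemma finite_monoms: "finite (monoms n)"
proof (rule finite_imageD)
  show "inj_on expo (monoms n)"
    unfolding inj_on_def poly_mapping_eq_iff by blast
  have "expo m z \<le> n" if "m \<in> monoms n" for m z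
    using that member_le_sum[of z UNIV "expo m"] by (simp add: monoms_def mdeg_def)
  then have "expo ` monoms n \<subseteq> PiE UNIV (\<lambda>_. {..n})"
    by (simp add: image_subset_iff PiE_UNIV_domain)
  then show "finite (expo ` monoms n)"
    by (rule finite_subset) (intro finite_PiE; simp)
qed

lemma homogeneous_sum_monoms:
  assumes "homogeneous n f"
  shows "f = (\<Sum>m\<in>monoms n. const_poly (coef f m) * pmono m)"
  using assms
  by (intro poly_sum_monoms_superset finite_monoms) (auto simp: homogeneous_def monoms_def mdeg_def)

section \<open>Traces on homogeneous polynomials\<close>

text \<open>The trace of the n-th symmetric power of A, read off the monomial basis of the forms of
  degree n.\<close>

definition sym_trace :: "nat \<Rightarrow> cmat8 \<Rightarrow> complex" where
  "sym_trace n A = (\<Sum>m\<in>monoms n. coef (act A (pmono m)) m)"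

lemma coef_act_act:
  assumes "m \<in> monoms n"
  shows "coef (act A (act B (pmono m))) k
    = (\<Sum>l\<in>monoms n. coef (act B (pmono m)) l * coef (act A (pmono l)) k)"
proof -
  have "homogeneous n (act B (pmono m))"
    using assms homogeneous_act homogeneous_pmono[of m] by (simp add: monoms_def)
  from homogeneous_sum_monoms[OF this]
  have "act A (act B (pmono m))
      = act A (\<Sum>l\<in>monoms n. const_poly (coef (act B (pmono m)) l) * pmono l)"
    by simp
  then show ?thesis
    by (simp add: act_sum act_const_mult lookup_sum)
qed

text \<open>In the monomial basis this is tr(XY) = tr(YX) for finite matrices indexed by
  \<open>monoms n\<close>.\<close>

lemma sym_trace_commute: "sym_trace n (A ** B) = sym_trace n (B ** A)"
proof -
  have *: "sym_trace n (A ** B) = (\<Sum>m\<in>monoms n. \<Sum>l\<in>monoms n.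
      coef (act A (pmono m)) l * coef (act B (pmono l)) m)" for A B
    unfolding sym_trace_def act_act[symmetric] by (intro sum.cong coef_act_act) auto
  show ?thesis
    unfolding * by (subst sum.swap) (simp add: mult.commute)
qed

lemma sym_trace_conj:
  assumes "invertible Q" "A ** Q = Q ** D"
  shows "sym_trace n A = sym_trace n D"
proof -
  from assms(1) obtain Q' where Q': "Q ** Q' = mat 1" "Q' ** Q = mat 1"
    unfolding invertible_def by blast
  have "A = Q ** (D ** Q')"
    by (metis Q'(1) assms(2) matrix_mul_assoc matrix_mul_rid)
  then have "sym_trace n A = sym_trace n (Q ** (D ** Q'))"
    by (rule arg_cong)
  also have "\<dots> = sym_trace n (D ** Q' ** Q)"
    by (rule sym_trace_commute)
  also have "D ** Q' ** Q = D"
    by (simp add: Q'(2) flip: matrix_mul_assoc)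
  finally show ?thesis .
qed

definition diag_mat :: "('n \<Rightarrow> 'a::zero) \<Rightarrow> 'a ^ 'n ^ 'n" where
  "diag_mat d = (\<chi> i j. if i = j then d i else 0)"

lemma act_diag_mat:
  "act (diag_mat d) (pmono m) = const_poly (\<Prod>z\<in>UNIV. d z ^ expo m z) * pmono m"
proof -
  have "lin_form (diag_mat d) z = const_poly (d z) * var_poly z" for z
  proof -
    have "lin_form (diag_mat d) z = (\<Sum>w\<in>UNIV. if z = w then const_poly (d z) * var_poly w else 0)"
      unfolding lin_form_def by (intro sum.cong) (auto simp: diag_mat_def)
    then show ?thesis by simp
  qed
  then show ?thesis
    unfolding act_pmono pmono_act_def
    by (simp add: power_mult_distrib prod.distrib pmono_eq_prod const_poly_prod const_poly_power)
qed

lemma sym_trace_diag: "sym_trace n (diag_mat d) = (\<Sum>m\<in>monoms n. \<Prod>z\<in>UNIV. d z ^ expo m z)"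
  by (simp add: sym_trace_def act_diag_mat coef_pmono)

lemma diag_mat_const: "diag_mat (\<lambda>_. c) = mat c"
  by (simp add: diag_mat_def mat_def)

lemma act_scalar:
  assumes "homogeneous n f"
  shows "act (mat c) f = const_poly (c ^ n) * f"
proof -
  have "act (mat c) f = (\<Sum>m\<in>monoms n. const_poly (coef f m) * act (mat c) (pmono m))"
    by (subst homogeneous_sum_monoms[OF assms]) (simp add: act_sum act_const_mult)
  also have "\<dots> = (\<Sum>m\<in>monoms n. const_poly (c ^ n) * (const_poly (coef f m) * pmono m))"
    unfolding diag_mat_const[symmetric] act_diag_mat
    by (intro sum.cong refl) (simp add: monoms_def mdeg_def power_sum[symmetric] mult_ac)
  also have "\<dots> = const_poly (c ^ n) * f"
    by (subst (2) homogeneous_sum_monoms[OF assms]) (simp add: sum_distrib_left)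
  finally show ?thesis .
qed

definition geom_fps :: "complex \<Rightarrow> complex fps" where
  "geom_fps c = Abs_fps (\<lambda>n. c ^ n)"

lemma geom_fps_mult: "(1 - fps_X * fps_const c) * geom_fps c = 1"
proof (rule fps_ext)
  fix n
  show "fps_nth ((1 - fps_X * fps_const c) * geom_fps c) n = fps_nth 1 n"
    by (cases n) (simp_all add: algebra_simps mult.assoc geom_fps_def)
qed

text \<open>The coefficient is the complete homogeneous symmetric polynomial of the
  \<open>d z\<close> with z in S. Splitting off the exponent of one further variable matches the
  Cauchy product of series.\<close>

lemma prod_geom_fps_nth:
  assumes "finite S"
  shows "fps_nth (\<Prod>z\<in>S. geom_fps (d z)) n
    = (\<Sum>m\<in>{m \<in> monoms n. \<forall>z. z \<notin> S \<longrightarrow> expo m z = 0}. \<Prod>z\<in>S. d z ^ expo m z)"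
  using assms
proof (induction S arbitrary: n rule: finite_induct)
  case empty
  have "(\<forall>z. expo m z = 0) \<longleftrightarrow> m = 0" for m
    by (metis lookup_zero poly_mapping_eqI)
  moreover have "mdeg 0 = 0" by (simp add: mdeg_def)
  ultimately have "{m \<in> monoms n. \<forall>z. expo m z = 0} = (if n = 0 then {0} else {})"
    by (auto simp: monoms_def)
  then show ?case by simp
next
  case (insert z S)
  let ?M = "\<lambda>S n. {m \<in> monoms n. \<forall>z. z \<notin> S \<longrightarrow> expo m z = 0}"
  have deg: "mdeg (m + Poly_Mapping.single z i) = mdeg m + i" for m i
    by (simp add: mdeg_def lookup_add sum.distrib lookup_single when_def)
  have fin: "finite (?M S n)" for n
    using finite_monoms by simp
  have "fps_nth (\<Prod>z\<in>insert z S. geom_fps (d z)) n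
      = (\<Sum>i\<in>{0..n}. \<Sum>m\<in>?M S (n - i). d z ^ i * (\<Prod>z\<in>S. d z ^ expo m z))"
    using insert by (simp add: fps_mult_nth geom_fps_def sum_distrib_left)
  also have "\<dots> = (\<Sum>(i, m)\<in>(SIGMA i:{0..n}. ?M S (n - i)). d z ^ i * (\<Prod>z\<in>S. d z ^ expo m z))"
    using fin by (subst sum.Sigma) auto
  also have "\<dots> = (\<Sum>m\<in>?M (insert z S) n. \<Prod>z\<in>insert z S. d z ^ expo m z)"
  proof (rule sum.reindex_bij_witness[where
        j = "\<lambda>(i, m). m + Poly_Mapping.single z i" and
        i = "\<lambda>m. (expo m z, m - Poly_Mapping.single z (expo m z))"])
    fix p assume "p \<in> (SIGMA i:{0..n}. ?M S (n - i))"
    then obtain i m where p: "p = (i, m)" "i \<le> n" "m \<in> ?M S (n - i)" by auto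
    then have mz: "expo m z = 0" using insert.hyps by auto
    let ?m = "m + Poly_Mapping.single z i"
    have ez: "expo ?m z = i" using mz by (simp add: lookup_add)
    have eS: "expo ?m y = expo m y" if "y \<in> S" for y
      using that insert.hyps by (auto simp: lookup_add lookup_single when_def)
    show "(\<lambda>m. (expo m z, m - Poly_Mapping.single z (expo m z))) ((\<lambda>(i, m). m + Poly_Mapping.single z i) p) = p"
      using ez p by simp
    show "(case p of (i, m) \<Rightarrow> m + Poly_Mapping.single z i) \<in> ?M (insert z S) n"
      using p by (auto simp: monoms_def deg lookup_add lookup_single when_def)
    have "(\<Prod>y\<in>insert z S. d y ^ expo ?m y) = d z ^ i * (\<Prod>y\<in>S. d y ^ expo m y)"
      using insert.hyps ez eS by simp
    then show "(\<Prod>y\<in>insert z S. d y ^ expo (case p of (i, m) \<Rightarrow> m + Poly_Mapping.single z i) y)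
        = (case p of (i, m) \<Rightarrow> d z ^ i * (\<Prod>z\<in>S. d z ^ expo m z))"
      using p by simp
  next
    fix m assume m: "m \<in> ?M (insert z S) n"
    have eq: "m - Poly_Mapping.single z (expo m z) + Poly_Mapping.single z (expo m z) = m"
      by (rule poly_mapping_eqI) (simp add: lookup_add lookup_minus lookup_single when_def)
    show "(\<lambda>(i, m). m + Poly_Mapping.single z i) (expo m z, m - Poly_Mapping.single z (expo m z)) = m"
      using eq by simp
    have "mdeg (m - Poly_Mapping.single z (expo m z)) + expo m z = n"
      using deg[of "m - Poly_Mapping.single z (expo m z)" "expo m z"] eq m by (simp add: monoms_def)
    then show "(expo m z, m - Poly_Mapping.single z (expo m z)) \<in> (SIGMA i:{0..n}. ?M S (n - i))"
      using m by (auto simp: monoms_def lookup_minus lookup_single when_def)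
  qed
  finally show ?case .
qed

lemma Abs_fps_sym_trace_diag:
  "Abs_fps (\<lambda>n. sym_trace n (diag_mat d)) = (\<Prod>z\<in>UNIV. geom_fps (d z))"
  by (rule fps_ext) (simp add: prod_geom_fps_nth sym_trace_diag)

section \<open>Diagonalisation of matrices of finite order\<close>

lemma sum_roots_of_unity:
  fixes k i :: nat
  assumes "0 < i" "i < k"
  shows "(\<Sum>j<k. (cis (2 * pi / k) ^ j) ^ i) = 0"
proof -
  let ?w = "cis (2 * pi / k)"
  have "?w ^ i = exp (\<i> * of_real (real i * (2 * pi / k)))"
    by (simp only: Complex.DeMoivre) (simp only: cis_conv_exp)
  moreover have "\<dots> \<noteq> 1"
  proof
    assume "exp (\<i> * of_real (real i * (2 * pi / k))) = 1"
    then obtain n :: int where "real i * (2 * pi / k) = of_int (2 * n) * pi"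
      unfolding exp_eq_1 by auto
    then have "real i = of_int n * real k"
      using assms by (simp add: field_simps)
    then have "int i = n * int k"
      by (metis of_int_eq_iff of_int_mult of_int_of_nat_eq)
    then have "int k dvd int i" by simp
    then show False using assms by (simp add: nat_dvd_not_less)
  qed
  ultimately have ne: "?w ^ i \<noteq> 1" by simp
  have "?w ^ k = 1"
    unfolding Complex.DeMoivre using assms by simp
  then have one: "(?w ^ i) ^ k = 1"
    by (metis mult.commute power_mult power_one)
  have "(\<Sum>j<k. (?w ^ j) ^ i) = (\<Sum>j<k. (?w ^ i) ^ j)"
    by (simp add: mult.commute flip: power_mult)
  also have "\<dots> = 0"
    using ne one by (simp add: geometric_sum)
  finally show ?thesis .
qed

lemma matrix_vector_mult_sum: "A *v sum f S = (\<Sum>x\<in>S. A *v f x)"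
  by (induction S rule: infinite_finite_induct) (simp_all add: matrix_vector_right_distrib)

text \<open>The operators \<open>P j\<close> are k times the projections belonging to the characters
  of the cyclic group generated by A. The vector \<open>P j v\<close> satisfies A x = w^(-j) x, and
  the sum of all \<open>P j v\<close> is k v.\<close>

lemma finite_order_eigenvectors_span:
  fixes A :: "complex ^ 'n ^ 'n"
  assumes k: "k > 0" and ord: "\<And>v. ((*v) A ^^ k) v = v"
  shows "vec.span {v. \<exists>c. A *v v = c *s v} = UNIV"
proof -
  let ?E = "{v. \<exists>c. A *v v = c *s v}"
  let ?w = "cis (2 * pi / k)"
  have wk: "?w ^ k = 1" unfolding Complex.DeMoivre using k by simp
  define P where "P j v = (\<Sum>i<k. ((?w ^ j) ^ i) *s ((*v) A ^^ i) v)" for j v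
  have "P j v \<in> ?E" for j v
  proof -
    define c where "c = ?w ^ j"
    have c: "c ^ k = 1" "c \<noteq> 0"
      using wk by (simp_all only: c_def power_mult[symmetric] mult.commute[of j k])
        (simp_all add: power_mult)
    define f where "f i = (c ^ i) *s ((*v) A ^^ i) v" for i
    have "c *s (A *v f i) = f (Suc i)" for i
      by (simp add: f_def vector_scalar_commute)
    then have "c *s (A *v P j v) = (\<Sum>i<k. f (Suc i))"
      by (simp add: P_def c_def[symmetric] f_def[symmetric] matrix_vector_mult_sum vec.scale_sum_right)
    also have "\<dots> = (\<Sum>i<k. f i) + f k - f 0"
      by (metis add_diff_cancel_left' lessThan_Suc_atMost sum.lessThan_Suc sum.lessThan_Suc_shift)
    also have "f k = f 0" using c ord by (simp add: f_def)
    finally have "c *s (A *v P j v) = P j v"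
      by (simp add: P_def c_def[symmetric] f_def[symmetric])
    then have "A *v P j v = inverse c *s P j v"
      using c by (metis vector_scalar_mult_def vec.scale_scale vec.scale_one left_inverse)
    then show ?thesis by blast
  qed
  then have span: "P j v \<in> vec.span ?E" for j v
    by (rule vec.span_base)
  have "v \<in> vec.span ?E" for v
  proof -
    have "(\<Sum>j<k. P j v) = (\<Sum>i<k. (\<Sum>j<k. (?w ^ j) ^ i) *s ((*v) A ^^ i) v)"
      unfolding P_def by (subst sum.swap) (simp add: vec.scale_sum_left)
    also have "\<dots> = (\<Sum>i<k. if i = 0 then of_nat k *s v else 0)"
      by (intro sum.cong) (use sum_roots_of_unity in auto)
    also have "\<dots> = of_nat k *s v" using k by simp
    finally have "v = inverse (of_nat k) *s (\<Sum>j<k. P j v)"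
      using k by (simp add: vec.scale_scale)
    also have "\<dots> \<in> vec.span ?E"
      by (intro vec.span_scale vec.span_sum span)
    finally show ?thesis .
  qed
  then show ?thesis by blast
qed

lemma finite_order_diagonalizable:
  fixes A :: "complex ^ 'n ^ 'n"
  assumes "k > 0" "\<And>v. ((*v) A ^^ k) v = v"
  obtains Q :: "complex ^ 'n ^ 'n" and d where "invertible Q" "A ** Q = Q ** diag_mat d"
proof -
  let ?E = "{v. \<exists>c. A *v v = c *s v}"
  obtain B where B: "B \<subseteq> ?E" "vec.independent B" "?E \<subseteq> vec.span B"
    by (rule vec.maximal_independent_subset)
  have span: "vec.span B = UNIV"
    using vec.span_minimal[OF B(3) vec.subspace_span] finite_order_eigenvectors_span[OF assms]
    by (simp add: top.extremum_unique)
  have fin: "finite B"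
    using B(2) by (rule vec.finiteI_independent)
  have "card B = CARD('n)"
    using vec.dim_eq_card_independent[OF B(2)] vec.dim_span[of B]
    by (simp add: span card_cart_basis)
  then obtain b :: "'n \<Rightarrow> _" where b: "bij_betw b UNIV B"
    using finite_same_card_bij[of "UNIV :: 'n set" B] fin by auto
  have "\<forall>j. \<exists>c. A *v b j = c *s b j"
    using b B(1) by (auto simp: bij_betw_def)
  then obtain d where d: "\<And>j. A *v b j = d j *s b j" by metis
  define Q :: "complex ^ 'n ^ 'n" where "Q = (\<chi> i j. b j $ i)"
  have col: "column j Q = b j" for j
    by (simp add: column_def Q_def vec_eq_iff)
  have "columns Q = B"
    using b by (auto simp: columns_def col bij_betw_def)
  then have "invertible Q"
    using span matrix_right_invertible_span_columns[of Q] invertible_right_inverse[of Q] by simp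
  moreover have "A ** Q = Q ** diag_mat d"
  proof -
    have "(A ** Q) $ i $ j = (A *v b j) $ i" for i j
      by (simp add: matrix_matrix_mult_def matrix_vector_mult_def Q_def)
    moreover have "(Q ** diag_mat d) $ i $ j = d j * b j $ i" for i j
      by (simp add: matrix_matrix_mult_def Q_def diag_mat_def if_distrib mult.commute cong: if_cong)
    ultimately show ?thesis
      by (simp add: vec_eq_iff d)
  qed
  ultimately show ?thesis by (rule that)
qed

section \<open>Determinants of 1 - tA and generating functions of traces\<close>

lemma matrix_diff_mult_distrib:
  fixes A B :: "'a::comm_ring_1 ^ 'n ^ 'm"
  shows "(A - B) ** C = A ** C - B ** C"
  by (simp add: vec_eq_iff matrix_matrix_mult_def left_diff_distrib sum_subtractf)

lemma matrix_mult_diff_distrib: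
  fixes B C :: "'a::comm_ring_1 ^ 'n ^ 'm"
  shows "A ** (B - C) = A ** B - A ** C"
  by (simp add: vec_eq_iff matrix_matrix_mult_def right_diff_distrib sum_subtractf)

text \<open>The matrix 1 - tA in any dimension: determinants are needed for the 8 by 8 elements and
  for their 4 by 4 blocks.\<close>

definition pencil :: "complex ^ 'n ^ 'n \<Rightarrow> complex fps ^ 'n ^ 'n" where
  "pencil A = mat 1 - (\<chi> r c. fps_X * fps_const (A $ r $ c))"

lemma id_minus_t_eq_pencil: "id_minus_t = pencil"
  by (simp add: fun_eq_iff id_minus_t_def pencil_def)

text \<open>Constant matrices embed into matrices of power series, where Q intertwines the two
  pencils. The determinant of the embedded Q cancels, because a right inverse is embedded along with
  Q.\<close>

lemma det_pencil_conj:
  fixes A D Q :: "complex ^ 'n ^ 'n"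
  assumes "invertible Q" "A ** Q = Q ** D"
  shows "det (pencil A) = det (pencil D)"
proof -
  define lift :: "complex ^ 'n ^ 'n \<Rightarrow> complex fps ^ 'n ^ 'n" where "lift M = (\<chi> r c. fps_const (M $ r $ c))" for M
  have lift_sum: "fps_const (sum f S) = (\<Sum>x\<in>S. fps_const (f x))" for f :: "'n \<Rightarrow> complex" and S
    by (induction S rule: infinite_finite_induct) (simp_all flip: fps_const_add)
  have lift_mult: "lift (M ** N) = lift M ** lift N" for M N
    by (simp add: vec_eq_iff lift_def matrix_matrix_mult_def lift_sum)
  have lift_1: "lift (mat 1) = mat 1"
    by (simp add: vec_eq_iff lift_def mat_def)
  have id: "pencil M = mat 1 - (\<chi> r c. fps_X * lift M $ r $ c)" for M
    by (simp add: pencil_def lift_def)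
  have "pencil A ** lift Q = lift Q - (\<chi> r c. fps_X * lift (A ** Q) $ r $ c)"
    by (simp add: id matrix_diff_mult_distrib lift_mult)
      (simp add: vec_eq_iff matrix_matrix_mult_def sum_distrib_left mult.assoc)
  moreover have "lift Q ** pencil D = lift Q - (\<chi> r c. fps_X * lift (Q ** D) $ r $ c)"
    by (simp add: id matrix_mult_diff_distrib lift_mult)
      (simp add: vec_eq_iff matrix_matrix_mult_def sum_distrib_left mult_ac)
  ultimately have "pencil A ** lift Q = lift Q ** pencil D"
    using assms(2) by simp
  then have "det (pencil A) * det (lift Q) = det (lift Q) * det (pencil D)"
    by (metis det_mul)
  moreover have "det (lift Q) \<noteq> 0"
  proof -
    from assms(1) obtain Q' where "Q ** Q' = mat 1" unfolding invertible_def by blast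
    then have "lift Q ** lift Q' = mat 1"
      by (simp only: lift_mult[symmetric] lift_1)
    then have "det (lift Q) * det (lift Q') = 1"
      by (simp only: det_mul[symmetric] det_I)
    then show ?thesis by auto
  qed
  ultimately show ?thesis by simp
qed

lemma det_pencil_diag: "det (pencil (diag_mat d)) = (\<Prod>z\<in>UNIV. 1 - fps_X * fps_const (d z))"
  by (subst det_diagonal) (auto simp: pencil_def diag_mat_def mat_def intro!: prod.cong)

text \<open>After diagonalisation both sides are the product of the series 1/(1 - dt) over the
  eigenvalues d.\<close>

lemma sym_trace_fps:
  assumes "k > 0" "\<And>v. ((*v) A ^^ k) v = v"
  shows "Abs_fps (\<lambda>n. sym_trace n A) = 1 / det (id_minus_t A)"
proof -
  obtain Q :: cmat8 and d where Qd: "invertible Q" "A ** Q = Q ** diag_mat d"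
    using finite_order_diagonalizable[OF assms] by blast
  have "Abs_fps (\<lambda>n. sym_trace n A) = (\<Prod>z\<in>UNIV. geom_fps (d z))"
    by (simp add: sym_trace_conj[OF Qd] Abs_fps_sym_trace_diag)
  moreover have "det (id_minus_t A) * (\<Prod>z\<in>UNIV. geom_fps (d z)) = 1"
    by (simp add: det_pencil_conj[OF Qd] id_minus_t_eq_pencil det_pencil_diag geom_fps_mult flip: prod.distrib)
  ultimately show ?thesis
    by (metis (no_types, lifting) mult_zero_left nonzero_mult_div_cancel_left zero_neq_one)
qed

section \<open>Molien's theorem\<close>

lemma representation_sum_const:
  assumes "cpoly.independent B" "\<And>x. x \<in> S \<Longrightarrow> f x \<in> cpoly.span B"
  shows "cpoly.representation B (\<Sum>x\<in>S. const_poly (c x) * f x) b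
    = (\<Sum>x\<in>S. c x * cpoly.representation B (f x) b)"
proof -
  have "cpoly.representation B (\<Sum>x\<in>S. scale_poly (c x) (f x))
      = (\<lambda>b. \<Sum>x\<in>S. cpoly.representation B (scale_poly (c x) (f x)) b)"
    using assms by (intro cpoly.representation_sum) (auto intro: cpoly.span_scale)
  then show ?thesis
    using assms by (simp add: cpoly.representation_scale flip: scale_poly_def)
qed

text \<open>With a basis \<open>B\<close> of the image of a projection \<open>Q\<close> and the coordinate functions \<open>b\<^sup>*\<close>, the
  diagonal entries of \<open>Q\<close> add up to the sum of \<open>b\<^sup>*(Q b) = b\<^sup>*(b) = 1\<close> over \<open>B\<close>.\<close>
lemma dim_eq_trace:
  assumes hom: "\<And>m. m \<in> monoms n \<Longrightarrow> Q (pmono m) \<in> I"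
    and lin: "\<And>f. homogeneous n f \<Longrightarrow> Q f = (\<Sum>m\<in>monoms n. const_poly (coef f m) * Q (pmono m))"
    and I: "\<And>f. f \<in> I \<Longrightarrow> homogeneous n f \<and> Q f = f"
  shows "of_nat (cpoly_dim I) = (\<Sum>m\<in>monoms n. coef (Q (pmono m)) m)"
proof -
  obtain B where B: "B \<subseteq> I" "cpoly.independent B" "I \<subseteq> cpoly.span B" "card B = cpoly_dim I"
    by (rule cpoly.basis_exists)
  have "B \<subseteq> cpoly.span (pmono ` monoms n)"
  proof
    fix b assume "b \<in> B"
    then have "homogeneous n b" using B(1) I by blast
    then have "b = (\<Sum>m\<in>monoms n. scale_poly (coef b m) (pmono m))"
      unfolding scale_poly_def by (rule homogeneous_sum_monoms)
    also have "\<dots> \<in> cpoly.span (pmono ` monoms n)"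
      by (intro cpoly.span_sum cpoly.span_scale cpoly.span_base) auto
    finally show "b \<in> cpoly.span (pmono ` monoms n)" .
  qed
  then have fin: "finite B"
    using cpoly.independent_span_bound[OF _ B(2)] finite_monoms by blast
  let ?r = "cpoly.representation B"
  have spanI: "f \<in> cpoly.span B" if "f \<in> I" for f
    using that B(3) by blast
  have rep: "coef f m = (\<Sum>b\<in>B. ?r f b * coef b m)" if "f \<in> I" for f m
  proof -
    have "f = (\<Sum>b\<in>B. scale_poly (?r f b) b)"
      using cpoly.sum_representation_eq[OF B(2) spanI[OF that] fin order_refl] by simp
    then have "coef f m = coef (\<Sum>b\<in>B. scale_poly (?r f b) b) m"
      by (rule arg_cong)
    then show ?thesis by (simp add: lookup_sum)
  qed
  have diag: "(\<Sum>m\<in>monoms n. coef b m * ?r (Q (pmono m)) b) = 1" if "b \<in> B" for b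
  proof -
    have bI: "homogeneous n b" "Q b = b" using that B(1) I by blast+
    have "(\<Sum>m\<in>monoms n. coef b m * ?r (Q (pmono m)) b)
        = ?r (\<Sum>m\<in>monoms n. const_poly (coef b m) * Q (pmono m)) b"
      using B(2) by (intro representation_sum_const[symmetric] spanI hom)
    also have "\<dots> = ?r b b"
      using lin[OF bI(1)] bI(2) by simp
    also have "\<dots> = 1"
      using cpoly.representation_basis[OF B(2) that] by simp
    finally show ?thesis .
  qed
  have "(\<Sum>m\<in>monoms n. coef (Q (pmono m)) m)
      = (\<Sum>m\<in>monoms n. \<Sum>b\<in>B. ?r (Q (pmono m)) b * coef b m)"
    by (intro sum.cong refl rep hom)
  also have "\<dots> = (\<Sum>b\<in>B. \<Sum>m\<in>monoms n. coef b m * ?r (Q (pmono m)) b)"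
    by (subst sum.swap) (simp add: mult.commute)
  also have "\<dots> = of_nat (cpoly_dim I)"
    by (simp add: diag B(4)[symmetric])
  finally show ?thesis ..
qed

locale finite_matrix_group =
  fixes G :: "cmat8 set"
  assumes finite: "finite G"
    and one_closed: "mat 1 \<in> G"
    and mult_closed: "A \<in> G \<Longrightarrow> B \<in> G \<Longrightarrow> A ** B \<in> G"
    and invertible: "A \<in> G \<Longrightarrow> invertible A"
begin

definition invariant :: "cpoly \<Rightarrow> bool" where
  "invariant f \<longleftrightarrow> (\<forall>A\<in>G. act A f = f)"

definition reynolds :: "cpoly \<Rightarrow> cpoly" where
  "reynolds f = const_poly (1 / of_nat (card G)) * (\<Sum>A\<in>G. act A f)"

lemma card_pos: "card G > 0"
  using finite one_closed by (auto simp: card_gt_0_iff)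

lemma inj_mult:
  assumes "A \<in> G"
  shows "inj ((**) A :: cmat8 \<Rightarrow> cmat8)"
proof -
  obtain A' where A': "A' ** A = mat 1" using invertible[OF assms] unfolding invertible_def by blast
  have "A' ** (A ** B) = B" for B :: cmat8
    by (simp add: A' matrix_mul_assoc)
  then show ?thesis by (rule inj_on_inverseI)
qed

lemma bij_mult_left:
  assumes "A \<in> G"
  shows "bij_betw ((**) A) G G"
proof -
  have "inj_on ((**) A) G"
    using inj_mult[OF assms] by (rule inj_on_subset) simp
  moreover have "(**) A ` G \<subseteq> G"
    using mult_closed[OF assms] by blast
  ultimately show ?thesis
    using endo_inj_surj[OF finite] by (simp add: bij_betw_def)
qed

lemma bij_mult_right:
  assumes "A \<in> G"
  shows "bij_betw (\<lambda>B. B ** A) G G"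
proof -
  obtain A' where A': "A ** A' = mat 1" using invertible[OF assms] unfolding invertible_def by blast
  have "B ** A ** A' = B" for B :: cmat8
    by (simp add: A' flip: matrix_mul_assoc)
  then have "inj_on (\<lambda>B. B ** A) G" by (rule inj_on_inverseI)
  moreover have "(\<lambda>B. B ** A) ` G \<subseteq> G"
    using mult_closed[OF _ assms] by blast
  ultimately show ?thesis
    using endo_inj_surj[OF finite] by (simp add: bij_betw_def)
qed

text \<open>Two powers of A coincide because G is finite, and injectivity of left multiplication
  cancels the smaller one. The order is phrased by iterates on vectors, the form in which
  diagonalisation uses it.\<close>

lemma finite_order:
  assumes "A \<in> G"
  obtains k where "k > 0" "\<And>v. ((*v) A ^^ k) v = v"
proof -
  let ?p = "\<lambda>i. ((**) A ^^ i) (mat 1)"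
  have "?p i \<in> G" for i
    by (induction i) (use one_closed mult_closed assms in auto)
  then have "range ?p \<subseteq> G" by blast
  then have "\<not> inj ?p"
    using finite_subset[OF _ finite] range_inj_infinite by blast
  then obtain i' j' where "?p i' = ?p j'" "i' \<noteq> j'"
    unfolding inj_def by blast
  then obtain i j where ij: "i < j" "?p i = ?p j"
    by (cases "i' < j'") (auto simp: not_less le_less)
  have "?p (i + (j - i)) = ((**) A ^^ i) (?p (j - i))"
    unfolding funpow_add by simp
  then have "((**) A ^^ i) (mat 1) = ((**) A ^^ i) (?p (j - i))"
    using ij by simp
  then have one: "?p (j - i) = mat 1"
    by (rule injD[OF inj_fn[OF inj_mult[OF assms]], symmetric])
  have "((*v) A ^^ l) v = ?p l *v v" for l v
    by (induction l) (simp_all add: matrix_vector_mul_assoc)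
  with one have "((*v) A ^^ (j - i)) v = v" for v by simp
  with ij(1) show thesis by (intro that[of "j - i"]) auto
qed

lemma act_reynolds:
  assumes "A \<in> G"
  shows "act A (reynolds f) = reynolds f"
proof -
  have "(\<Sum>B\<in>G. act A (act B f)) = (\<Sum>B\<in>G. act B f)"
    unfolding act_act using bij_mult_right[OF assms] by (rule sum.reindex_bij_betw)
  then show ?thesis by (simp add: reynolds_def act_const_mult act_sum)
qed

lemma reynolds_act:
  assumes "A \<in> G"
  shows "reynolds (act A f) = reynolds f"
proof -
  have "(\<Sum>B\<in>G. act B (act A f)) = (\<Sum>B\<in>G. act B f)"
    unfolding act_act using bij_mult_left[OF assms] by (rule sum.reindex_bij_betw)
  then show ?thesis by (simp add: reynolds_def)
qed

lemma invariant_reynolds: "invariant (reynolds f)"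
  by (simp add: invariant_def act_reynolds)

lemma reynolds_invariant: "invariant f \<Longrightarrow> reynolds f = f"
  using card_pos
  by (simp add: reynolds_def invariant_def const_poly_of_nat[symmetric] mult.assoc[symmetric]
      const_poly_mult[symmetric])

lemma reynolds_add: "reynolds (f + g) = reynolds f + reynolds g"
  by (simp add: reynolds_def act_add sum.distrib distrib_left)

lemma reynolds_const_mult: "reynolds (const_poly c * f) = const_poly c * reynolds f"
  by (simp add: reynolds_def act_const_mult sum_distrib_left mult.left_commute)

lemma reynolds_sum: "reynolds (sum f S) = (\<Sum>x\<in>S. reynolds (f x))"
  by (induction S rule: infinite_finite_induct) (simp_all add: reynolds_add, simp_all add: reynolds_def)

lemma homogeneous_reynolds: "homogeneous n f \<Longrightarrow> homogeneous n (reynolds f)"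
  unfolding reynolds_def by (intro homogeneous_const_mult homogeneous_sum homogeneous_act)

text \<open>\<open>reynolds\<close> projects the forms of degree n onto the invariant ones, and its
  trace is the average of the traces of the group elements.\<close>

lemma dim_invariants:
  "of_nat (cpoly_dim {f. invariant f \<and> homogeneous n f})
    = 1 / of_nat (card G) * (\<Sum>A\<in>G. sym_trace n A)"
proof -
  have "of_nat (cpoly_dim {f. invariant f \<and> homogeneous n f})
      = (\<Sum>m\<in>monoms n. coef (reynolds (pmono m)) m)"
  proof (rule dim_eq_trace)
    fix m assume "m \<in> monoms n"
    then show "reynolds (pmono m) \<in> {f. invariant f \<and> homogeneous n f}"
      using homogeneous_reynolds homogeneous_pmono[of m] invariant_reynolds by (auto simp: monoms_def)
  next
    fix f assume "homogeneous n f"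
    then have "reynolds f = reynolds (\<Sum>m\<in>monoms n. const_poly (coef f m) * pmono m)"
      by (intro arg_cong[where f = reynolds] homogeneous_sum_monoms)
    then show "reynolds f = (\<Sum>m\<in>monoms n. const_poly (coef f m) * reynolds (pmono m))"
      by (simp add: reynolds_sum reynolds_const_mult)
  qed (auto simp: reynolds_invariant)
  also have "\<dots> = 1 / of_nat (card G) * (\<Sum>A\<in>G. sym_trace n A)"
    unfolding reynolds_def sym_trace_def
    by (simp add: lookup_sum sum_divide_distrib[symmetric]) (rule disjI2, rule sum.swap)
  finally show ?thesis .
qed

theorem molien: "molien_series G = Abs_fps (\<lambda>n. of_nat (cpoly_dim {f. invariant f \<and> homogeneous n f}))"
proof (rule fps_ext)
  fix n
  have nth: "fps_nth (1 / det (id_minus_t A)) n = sym_trace n A" if A: "A \<in> G" for A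
  proof -
    obtain k where "k > 0" "\<And>v. ((*v) A ^^ k) v = v"
      using finite_order[OF A] by blast
    from sym_trace_fps[OF this] show ?thesis
      by (metis fps_nth_Abs_fps)
  qed
  have "fps_nth (molien_series G) n
      = 1 / of_nat (card G) * (\<Sum>A\<in>G. fps_nth (1 / det (id_minus_t A)) n)"
    unfolding molien_series_def fps_mult_left_const_nth fps_sum_nth ..
  also have "\<dots> = 1 / of_nat (card G) * (\<Sum>A\<in>G. sym_trace n A)"
    by (simp add: nth cong: sum.cong)
  finally show "fps_nth (molien_series G) n
      = fps_nth (Abs_fps (\<lambda>n. of_nat (cpoly_dim {f. invariant f \<and> homogeneous n f}))) n"
    by (simp only: dim_invariants fps_nth_Abs_fps)
qed

end

section \<open>The points of the plane over the field with two elements\<close>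

definition idx :: "bit ^ 2 \<Rightarrow> nat" where
  "idx a = (if a $ 1 = 1 then 2 else 0) + (if a $ 2 = 1 then 1 else 0)"

definition pt :: "nat \<Rightarrow> bit ^ 2" where
  "pt k = (\<chi> i. if i = 1 then of_bool (k = 2 \<or> k = 3) else of_bool (k = 1 \<or> k = 3))"

lemma pt_nth [simp]:
  "pt k $ 1 = of_bool (k = 2 \<or> k = 3)" "pt k $ 2 = of_bool (k = 1 \<or> k = 3)"
  by (simp_all add: pt_def)

lemma idx_pt [simp]: "idx (pt 0) = 0" "idx (pt (Suc 0)) = 1" "idx (pt 2) = 2" "idx (pt 3) = 3"
  by (simp_all add: idx_def)

lemma idx_pt_less: "k < 4 \<Longrightarrow> idx (pt k) = k"
  by (auto simp: numeral_eq_Suc less_Suc_eq)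
    (simp_all add: idx_def)

lemma pt_idx [simp]: "pt (idx a) = a"
  by (cases "a $ 1"; cases "a $ 2") (auto simp: vec_eq_iff forall_2 idx_def)

lemma idx_less [simp]: "idx a < 4"
  by (simp add: idx_def)

lemma idx_eq_iff [simp]: "idx a = idx b \<longleftrightarrow> a = b"
  by (metis pt_idx)

lemma pt_inject: "k < 4 \<Longrightarrow> l < 4 \<Longrightarrow> pt k = pt l \<longleftrightarrow> k = l"
  by (metis idx_pt_less)

lemma pt_neq [simp]:
  "pt 0 \<noteq> pt (Suc 0)" "pt 0 \<noteq> pt 2" "pt 0 \<noteq> pt 3" "pt (Suc 0) \<noteq> pt 2" "pt (Suc 0) \<noteq> pt 3" "pt 2 \<noteq> pt 3"
  "pt (Suc 0) \<noteq> pt 0" "pt 2 \<noteq> pt 0" "pt 3 \<noteq> pt 0" "pt 2 \<noteq> pt (Suc 0)" "pt 3 \<noteq> pt (Suc 0)" "pt 3 \<noteq> pt 2"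
  by (simp_all add: pt_inject)

lemma UNIV_pt: "(UNIV :: (bit ^ 2) set) = {pt 0, pt 1, pt 2, pt 3}"
proof -
  have "a \<in> {pt 0, pt 1, pt 2, pt 3}" for a
    by (cases "a $ 1"; cases "a $ 2") (auto simp: vec_eq_iff forall_2)
  then show ?thesis by blast
qed

lemma all_pt: "(\<forall>a. P a) \<longleftrightarrow> P (pt 0) \<and> P (pt 1) \<and> P (pt 2) \<and> P (pt 3)"
  by (metis UNIV_I UNIV_pt insertE empty_iff)

lemma sum_pt: "(\<Sum>a\<in>UNIV. f a) = f (pt 0) + f (pt 1) + f (pt 2) + (f (pt 3) :: 'a::comm_monoid_add)"
  by (simp add: UNIV_pt add.assoc)

lemma prod_pt: "(\<Prod>a\<in>UNIV. f a) = f (pt 0) * f (pt 1) * f (pt 2) * (f (pt 3) :: 'a::comm_monoid_mult)"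
  by (simp add: UNIV_pt mult.assoc)

section \<open>Gaussian integers\<close>

text \<open>Pairs of integers keep the computations in the group executable; complex numbers enter
  only through the injective ring embedding \<open>gi\<close>.\<close>

type_synonym gint = "int \<times> int"

definition gi :: "gint \<Rightarrow> complex" where
  "gi z = Complex (of_int (fst z)) (of_int (snd z))"

definition gadd :: "gint \<Rightarrow> gint \<Rightarrow> gint" where
  "gadd z w = (fst z + fst w, snd z + snd w)"

definition gsub :: "gint \<Rightarrow> gint \<Rightarrow> gint" where
  "gsub z w = (fst z - fst w, snd z - snd w)"

definition gmul :: "gint \<Rightarrow> gint \<Rightarrow> gint" where
  "gmul z w = (fst z * fst w - snd z * snd w, fst z * snd w + snd z * fst w)"

lemma gi_gadd: "gi (gadd z w) = gi z + gi w"
  by (simp add: gi_def gadd_def complex_eq_iff)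

lemma gi_gsub: "gi (gsub z w) = gi z - gi w"
  by (simp add: gi_def gsub_def complex_eq_iff)

lemma gi_gmul: "gi (gmul z w) = gi z * gi w"
  by (simp add: gi_def gmul_def complex_eq_iff)

lemma gi_eq_iff [simp]: "gi z = gi w \<longleftrightarrow> z = w"
  by (auto simp: gi_def prod_eq_iff)

lemma gi_0: "gi (0, 0) = 0"
  by (simp add: gi_def complex_eq_iff)

definition units :: "gint list" where
  "units = [(1,0), (0,1), (-1,0), (0,-1)]"

lemma gi_units: "gi ` set units = {1, \<i>, -1, -\<i>}"
  by (simp add: units_def gi_def Complex_eq)

lemma power4_eq_1_iff: "(c :: complex) ^ 4 = 1 \<longleftrightarrow> c \<in> {1, \<i>, -1, -\<i>}"
proof
  assume "c ^ 4 = 1"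
  moreover have "c ^ 4 - 1 = (c - 1) * (c + 1) * (c - \<i>) * (c + \<i>)"
    by (simp add: algebra_simps power4_eq_xxxx power2_eq_square)
  ultimately show "c \<in> {1, \<i>, -1, -\<i>}"
    by (auto simp: eq_neg_iff_add_eq_0)
qed (auto simp: power4_eq_xxxx)

type_synonym gmat = "gint list list"

text \<open>Tables of Gaussian integers represent twice the matrix.\<close>

definition of_gmat :: "gmat \<Rightarrow> cmat4" where
  "of_gmat M = (\<chi> a b. gi (M ! idx a ! idx b) / 2)"

definition gmat_mult :: "gmat \<Rightarrow> gmat \<Rightarrow> gmat" where
  "gmat_mult M N = map (\<lambda>r. map (\<lambda>k.
      gadd (gadd (gadd (gmul (r ! 0) (N ! 0 ! k)) (gmul (r ! Suc 0) (N ! Suc 0 ! k)))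
        (gmul (r ! 2) (N ! 2 ! k))) (gmul (r ! 3) (N ! 3 ! k))) [0, 1, 2, 3]) M"

lemma of_gmat_mult:
  assumes "length M = 4"
  shows "(of_gmat M ** of_gmat N) $ a $ b = gi (gmat_mult M N ! idx a ! idx b) / 4"
proof -
  have nth: "map f [0, Suc 0, 2, 3] ! idx b = f (idx b)" for f :: "nat \<Rightarrow> gint"
    using idx_less[of b] by (auto simp: numeral_eq_Suc less_Suc_eq)
  show ?thesis
    using assms
    by (simp add: of_gmat_def matrix_matrix_mult_def sum_pt gmat_mult_def gi_gadd gi_gmul nth
        add_divide_distrib del: list.map)
qed

section \<open>Cosets of the monomial subgroup\<close>

text \<open>Representatives for the right cosets of the subgroup of monomial matrices, found by closing
  the identity under right multiplication by the generators.\<close>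

definition frames :: "gmat list" where
  "frames = [
  [[(2,0),(0,0),(0,0),(0,0)],
     [(0,0),(2,0),(0,0),(0,0)],
     [(0,0),(0,0),(2,0),(0,0)],
     [(0,0),(0,0),(0,0),(2,0)]],
  [[(0,1),(0,1),(0,1),(0,1)],
     [(0,1),(0,-1),(0,1),(0,-1)],
     [(0,1),(0,1),(0,-1),(0,-1)],
     [(0,1),(0,-1),(0,-1),(0,1)]],
  [[(0,1),(-1,0),(0,1),(-1,0)],
     [(0,1),(1,0),(0,1),(1,0)],
     [(0,1),(-1,0),(0,-1),(1,0)],
     [(0,1),(1,0),(0,-1),(-1,0)]],
  [[(-1,-1),(-1,1),(0,0),(0,0)],
     [(-1,1),(-1,-1),(0,0),(0,0)],
     [(0,0),(0,0),(-1,-1),(-1,1)],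
     [(0,0),(0,0),(-1,1),(-1,-1)]],
  [[(-1,0),(0,1),(0,1),(-1,0)],
     [(1,0),(0,1),(0,1),(1,0)],
     [(-1,0),(0,1),(0,-1),(1,0)],
     [(1,0),(0,1),(0,-1),(-1,0)]],
  [[(-1,0),(-1,0),(0,1),(0,1)],
     [(1,0),(1,0),(0,1),(0,1)],
     [(1,0),(-1,0),(0,-1),(0,1)],
     [(-1,0),(1,0),(0,-1),(0,1)]],
  [[(-1,-1),(-1,-1),(0,0),(0,0)],
     [(-1,1),(1,-1),(0,0),(0,0)],
     [(0,0),(0,0),(-1,-1),(-1,-1)],
     [(0,0),(0,0),(-1,1),(1,-1)]],
  [[(0,0),(-1,1),(-1,-1),(0,0)],
     [(0,0),(-1,-1),(-1,1),(0,0)],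
     [(-1,-1),(0,0),(0,0),(-1,1)],
     [(-1,1),(0,0),(0,0),(-1,-1)]],
  [[(0,0),(-1,1),(0,0),(-1,-1)],
     [(0,0),(-1,-1),(0,0),(-1,1)],
     [(-1,1),(0,0),(-1,-1),(0,0)],
     [(-1,-1),(0,0),(-1,1),(0,0)]],
  [[(-1,0),(-1,0),(0,1),(0,-1)],
     [(1,0),(-1,0),(0,1),(0,1)],
     [(-1,0),(-1,0),(0,-1),(0,1)],
     [(1,0),(-1,0),(0,-1),(0,-1)]],
  [[(-1,0),(0,-1),(0,1),(-1,0)],
     [(1,0),(0,1),(0,1),(-1,0)],
     [(1,0),(0,-1),(0,-1),(-1,0)],
     [(-1,0),(0,1),(0,-1),(-1,0)]],
  [[(1,-1),(0,0),(1,-1),(0,0)],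
     [(0,0),(-1,-1),(0,0),(-1,-1)],
     [(1,-1),(0,0),(-1,1),(0,0)],
     [(0,0),(-1,-1),(0,0),(1,1)]],
  [[(0,0),(-1,-1),(-1,-1),(0,0)],
     [(0,0),(1,-1),(-1,1),(0,0)],
     [(-1,-1),(0,0),(0,0),(-1,-1)],
     [(-1,1),(0,0),(0,0),(1,-1)]],
  [[(0,-1),(-1,0),(0,-1),(1,0)],
     [(-1,0),(0,1),(1,0),(0,1)],
     [(0,-1),(1,0),(0,-1),(-1,0)],
     [(1,0),(0,1),(-1,0),(0,1)]],
  [[(0,-1),(0,-1),(0,-1),(0,1)],
     [(-1,0),(-1,0),(1,0),(-1,0)],
     [(0,-1),(0,1),(0,-1),(0,-1)],
     [(1,0),(-1,0),(-1,0),(-1,0)]]]"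

definition gen_T :: gmat where
  "gen_T = frames ! 1"

definition gen_E :: gmat where
  "gen_E = [[(2,0),(0,0),(0,0),(0,0)], [(0,0),(0,2),(0,0),(0,0)], [(0,0),(0,0),(2,0),(0,0)], [(0,0),(0,0),(0,0),(0,2)]]"

definition gen_swap :: "nat \<Rightarrow> nat \<Rightarrow> gmat" where
  "gen_swap p q = map (\<lambda>k. map (\<lambda>l. if l = (if k = p then q else if k = q then p else k) then (2,0) else (0,0)) [0, 1, 2, 3]) [0, 1, 2, 3]"

text \<open>The six transpositions stand for the affine maps: they generate all permutations of the
  four points, and every permutation of F_2^2 is affine. Scalars are treated separately.\<close>

definition frame_gens :: "gmat list" where
  "frame_gens = [gen_T, gen_E, gen_swap 0 1, gen_swap 0 2, gen_swap 0 3,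
     gen_swap 1 2, gen_swap 1 3, gen_swap 2 3]"

text \<open>The permutation of the cosets by each generator.\<close>

definition frame_action :: "nat list list" where
  "frame_action = [[1, 0, 3, 2, 7, 8, 11, 4, 5, 13, 10, 6, 12, 9, 14],
    [0, 2, 1, 6, 9, 10, 3, 12, 8, 4, 5, 11, 7, 14, 13],
    [0, 1, 4, 3, 2, 5, 6, 8, 7, 9, 13, 12, 11, 10, 14],
    [0, 1, 2, 7, 5, 4, 12, 3, 8, 10, 9, 11, 6, 13, 14],
    [0, 1, 5, 8, 4, 2, 11, 7, 3, 13, 10, 6, 12, 9, 14],
    [0, 1, 5, 8, 4, 2, 11, 7, 3, 13, 10, 6, 12, 9, 14],
    [0, 1, 2, 7, 5, 4, 12, 3, 8, 10, 9, 11, 6, 13, 14],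
    [0, 1, 4, 3, 2, 5, 6, 8, 7, 9, 13, 12, 11, 10, 14]]"

text \<open>The factor \<open>2\<close> makes up for the different scalings of a product and of a single table.\<close>

definition row_matches :: "gmat \<Rightarrow> gint list \<Rightarrow> (nat \<times> gint) list" where
  "row_matches N r = filter (\<lambda>(s, u). map (gmul (gmul (2,0) u)) (N ! s) = r)
     (List.product [0, 1, 2, 3] units)"

text \<open>Certifies that \<open>M\<close> lies in the coset of \<open>N\<close>: up to the factor
  2, its rows are unit multiples of distinct rows of \<open>N\<close>, and the units multiply to 1
  or -1, which yields the determinant condition of \<open>unit_diag\<close>.\<close>

definition monomial_match :: "gmat \<Rightarrow> gmat \<Rightarrow> bool" where
  "monomial_match M N \<longleftrightarrow> (let cs = map (hd \<circ> row_matches N) M in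
     list_all (\<lambda>r. row_matches N r \<noteq> []) M \<and> distinct (map fst cs) \<and>
     foldr gmul (map snd cs) (1,0) \<in> {(1,0), (-1,0)})"

definition frames_closed :: bool where
  "frames_closed \<longleftrightarrow> list_all2 (\<lambda>g js. list_all2 (\<lambda>M j. j < 15 \<and> monomial_match (gmat_mult M g) (frames ! j))
     frames js) frame_gens frame_action"

text \<open>These 120 evaluated products show that the 15 cosets are permuted by right
  multiplication with each table of \<open>frame_gens\<close>. This is what bounds the group from
  above.\<close>

lemma frames_closed: frames_closed
  by code_simp

lemma frames_shape: "length frames = 15" "list_all (\<lambda>M. length M = 4 \<and> list_all (\<lambda>r. length r = 4) M) frames"
  by code_simp+

text \<open>Two rows are proportional iff all their \<open>2 \<times> 2\<close> minors vanish.\<close>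

definition parallel :: "gint list \<Rightarrow> gint list \<Rightarrow> bool" where
  "parallel r s \<longleftrightarrow> list_all (\<lambda>(k, l). gmul (r ! k) (s ! l) = gmul (r ! l) (s ! k))
     (List.product [0, 1, 2, 3] [0, 1, 2, 3])"

fun pairwise_skew :: "gint list list \<Rightarrow> bool" where
  "pairwise_skew [] \<longleftrightarrow> True"
| "pairwise_skew (r # rs) \<longleftrightarrow> r \<noteq> [(0,0), (0,0), (0,0), (0,0)] \<and> list_all (\<lambda>s. \<not> parallel r s) rs \<and> pairwise_skew rs"

text \<open>All 60 rows span different lines. Injectivity of the enumeration, and with it the exact
  order of the group, rests on this.\<close>

lemma frames_skew: "pairwise_skew (concat frames)"
  by code_simp

lemma gi_1: "gi (1, 0) = 1"
  by (simp add: gi_def complex_eq_iff)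

lemma gi_2: "gi (2, 0) = 2"
  by (simp add: gi_def complex_eq_iff)

definition frame :: "nat \<Rightarrow> cmat4" where
  "frame j = of_gmat (frames ! j)"

definition elt :: "complex \<Rightarrow> (bit ^ 2 \<Rightarrow> complex) \<Rightarrow> (bit ^ 2 \<Rightarrow> bit ^ 2) \<Rightarrow> nat \<Rightarrow> cmat4" where
  "elt c d \<sigma> j = (\<chi> a b. c * d a * frame j $ \<sigma> a $ b)"

definition unit_diag :: "(bit ^ 2 \<Rightarrow> complex) \<Rightarrow> bool" where
  "unit_diag d \<longleftrightarrow> (\<forall>a. d a ^ 4 = 1) \<and> (\<Prod>a\<in>UNIV. d a)\<^sup>2 = 1"

definition elts :: "cmat4 set" where
  "elts = {elt c d \<sigma> j | c d \<sigma> j. c ^ 8 = 1 \<and> unit_diag d \<and> \<sigma> permutes UNIV \<and> j < 15}"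

lemma elts_I: "c ^ 8 = 1 \<Longrightarrow> unit_diag d \<Longrightarrow> \<sigma> permutes UNIV \<Longrightarrow> j < 15 \<Longrightarrow> elt c d \<sigma> j \<in> elts"
  unfolding elts_def by blast

lemma unit_diag_mult:
  assumes "unit_diag d" "unit_diag d'" "\<sigma> permutes UNIV"
  shows "unit_diag (\<lambda>a. d a * d' (\<sigma> a))"
proof -
  have "(\<Prod>a\<in>UNIV. d' (\<sigma> a)) = (\<Prod>a\<in>UNIV. d' a)"
    using prod.permute[OF assms(3), of d'] by (simp add: comp_def)
  then show ?thesis
    using assms by (simp add: unit_diag_def power_mult_distrib prod.distrib)
qed

text \<open>Only the frame meets \<open>g\<close>; the diagonal and the permutation that come out
  are pulled to the left through \<sigma>, which reindexes \<open>d'\<close>.\<close>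

lemma elt_mult:
  assumes "frame j ** g = elt 1 d' \<sigma>' j'"
  shows "elt c d \<sigma> j ** g = elt c (\<lambda>a. d a * d' (\<sigma> a)) (\<sigma>' \<circ> \<sigma>) j'"
proof -
  have "(elt c d \<sigma> j ** g) $ a $ b = c * d a * (frame j ** g) $ \<sigma> a $ b" for a b
    by (simp add: elt_def matrix_matrix_mult_def sum_distrib_left mult.assoc)
  then show ?thesis
    by (simp add: assms vec_eq_iff) (simp add: elt_def)
qed

lemma elts_closed:
  assumes "\<And>j. j < 15 \<Longrightarrow> \<exists>d \<sigma> j'. unit_diag d \<and> \<sigma> permutes UNIV \<and> j' < 15 \<and> frame j ** g = elt 1 d \<sigma> j'"
    and "A \<in> elts"
  shows "A ** g \<in> elts"
proof -
  from assms(2) obtain c d \<sigma> j where A: "A = elt c d \<sigma> j" "c ^ 8 = 1" "unit_diag d" "\<sigma> permutes UNIV" "j < 15"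
    unfolding elts_def by blast
  from assms(1)[OF A(5)] obtain d' \<sigma>' j' where
    g: "unit_diag d'" "\<sigma>' permutes UNIV" "j' < 15" "frame j ** g = elt 1 d' \<sigma>' j'" by blast
  show ?thesis
    unfolding A(1) elt_mult[OF g(4)]
    by (intro elts_I A unit_diag_mult g permutes_compose)
qed

lemma monomial_match_sound:
  assumes "monomial_match (gmat_mult M g) N" "length M = 4"
    and len: "length N = 4" "\<And>s. s < 4 \<Longrightarrow> length (N ! s) = 4"
  obtains d \<sigma> where "unit_diag d" "\<sigma> permutes UNIV"
    "of_gmat M ** of_gmat g = (\<chi> a b. d a * of_gmat N $ \<sigma> a $ b)"
proof -
  let ?P = "gmat_mult M g"
  \<comment> \<open>Entry k holds the row of \<open>N\<close> and the unit that match row k of the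
    product; \<sigma> and \<open>d\<close> are read off from it.\<close>
  define cs where "cs = map (hd \<circ> row_matches N) ?P"
  have lP: "length ?P = 4" using assms(2) by (simp add: gmat_mult_def)
  then have lcs: "length cs = 4" by (simp add: cs_def)
  have dist: "distinct (map fst cs)" and pr: "foldr gmul (map snd cs) (1,0) \<in> {(1,0), (-1,0)}"
    and ne: "\<And>r. r \<in> set ?P \<Longrightarrow> row_matches N r \<noteq> []"
    using assms(1) by (auto simp: monomial_match_def Let_def cs_def list_all_iff)
  have cs: "fst (cs ! k) < 4" "snd (cs ! k) \<in> set units"
      "map (gmul (gmul (2,0) (snd (cs ! k)))) (N ! fst (cs ! k)) = ?P ! k" if "k < 4" for k
  proof -
    have "cs ! k = hd (row_matches N (?P ! k))"
      using that lP by (simp add: cs_def)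
    then have "cs ! k \<in> set (row_matches N (?P ! k))"
      using ne[of "?P ! k"] that lP by simp
    then show "fst (cs ! k) < 4" "snd (cs ! k) \<in> set units"
      "map (gmul (gmul (2,0) (snd (cs ! k)))) (N ! fst (cs ! k)) = ?P ! k"
      unfolding row_matches_def set_filter by (auto split: prod.splits)
  qed
  define \<sigma> where "\<sigma> a = pt (fst (cs ! idx a))" for a
  define d where "d a = gi (snd (cs ! idx a))" for a
  have "inj \<sigma>"
  proof (rule injI)
    fix a b assume "\<sigma> a = \<sigma> b"
    then have "fst (cs ! idx a) = fst (cs ! idx b)"
      by (simp add: \<sigma>_def pt_inject cs)
    then have "map fst cs ! idx a = map fst cs ! idx b"
      by (simp add: lcs)
    then have "idx a = idx b"
      by (subst (asm) nth_eq_iff_index_eq[OF dist]) (simp_all add: lcs)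
    then show "a = b" by simp
  qed
  then have "\<sigma> permutes UNIV"
    by (simp add: permutes_univ bij_def finite_UNIV_inj_surj bij_iff[symmetric])
  moreover have "unit_diag d"
  proof -
    have "d a \<in> gi ` set units" for a
      using cs(2)[of "idx a"] by (simp add: d_def)
    then have "d a ^ 4 = 1" for a
      unfolding power4_eq_1_iff gi_units by blast
    moreover have "(\<Prod>a\<in>UNIV. d a) = gi (foldr gmul (map snd cs) (1,0))"
    proof -
      from lcs obtain x0 x1 x2 x3 where x: "cs = [x0, x1, x2, x3]"
        by (auto simp: numeral_eq_Suc length_Suc_conv)
      show ?thesis
        by (simp add: d_def prod_pt x gi_gmul gi_1 mult.assoc)
    qed
    moreover have "(gi (foldr gmul (map snd cs) (1,0)))\<^sup>2 = 1"
      using pr by (elim insertE) (simp_all add: gi_def power2_eq_square complex_eq_iff)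
    ultimately show ?thesis by (simp add: unit_diag_def)
  qed
  moreover have "of_gmat M ** of_gmat g = (\<chi> a b. d a * of_gmat N $ \<sigma> a $ b)"
  proof -
    have "(of_gmat M ** of_gmat g) $ a $ b = d a * of_gmat N $ \<sigma> a $ b" for a b
    proof -
      note c = cs[of "idx a", OF idx_less]
      have "?P ! idx a ! idx b = gmul (gmul (2,0) (snd (cs ! idx a))) (N ! fst (cs ! idx a) ! idx b)"
        using c len by (simp flip: c(3))
      moreover have "idx (\<sigma> a) = fst (cs ! idx a)"
        using c(1) by (simp add: \<sigma>_def idx_pt_less)
      ultimately show ?thesis
        using assms(2) by (simp add: of_gmat_mult gi_gmul gi_2 d_def) (simp add: of_gmat_def)
    qed
    then show ?thesis by (simp add: vec_eq_iff)
  qed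
  ultimately show thesis using that by blast
qed

lemma elts_closed_frame_gens:
  assumes "g \<in> set frame_gens" "A \<in> elts"
  shows "A ** of_gmat g \<in> elts"
proof (rule elts_closed[OF _ assms(2)])
  fix j :: nat assume j: "j < 15"
  from assms(1) obtain k where k: "k < length frame_gens" "g = frame_gens ! k"
    by (metis in_set_conv_nth)
  define j' where "j' = frame_action ! k ! j"
  have "list_all2 (\<lambda>M j. j < 15 \<and> monomial_match (gmat_mult M g) (frames ! j)) frames (frame_action ! k)"
    using frames_closed k unfolding frames_closed_def list_all2_conv_all_nth by blast
  then have m: "j' < 15" "monomial_match (gmat_mult (frames ! j) g) (frames ! j')"
    using j frames_shape(1) by (auto simp: list_all2_conv_all_nth j'_def)
  have len: "length (frames ! i) = 4" "\<And>s. s < 4 \<Longrightarrow> length (frames ! i ! s) = 4" if "i < 15" for i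
  proof -
    have "frames ! i \<in> set frames" using that frames_shape(1) by simp
    then have 4: "length (frames ! i) = 4" "\<forall>r\<in>set (frames ! i). length r = 4"
      using frames_shape(2) by (simp_all add: list_all_iff)
    show "length (frames ! i) = 4" by (rule 4)
    show "length (frames ! i ! s) = 4" if "s < 4" for s
      using 4 that by simp
  qed
  obtain d \<sigma> where "unit_diag d" "\<sigma> permutes UNIV"
    "of_gmat (frames ! j) ** of_gmat g = (\<chi> a b. d a * of_gmat (frames ! j') $ \<sigma> a $ b)"
    by (rule monomial_match_sound[OF m(2) len(1)[OF j] len(1)[OF m(1)] len(2)[OF m(1)]])
  then show "\<exists>d \<sigma> j'. unit_diag d \<and> \<sigma> permutes UNIV \<and> j' < 15 \<and> frame j ** of_gmat g = elt 1 d \<sigma> j'"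
    using m(1) by (intro exI[of _ d] exI[of _ \<sigma>] exI[of _ j']) (simp add: frame_def elt_def)
qed

lemma of_gmat_gen_T: "of_gmat gen_T = T2"
proof -
  have sq: "((1 + \<i>) / 2)\<^sup>2 = \<i> / 2"
    by (simp add: power2_eq_square algebra_simps)
  have gi: "gi (0, 1) = \<i>" "gi (0, -1) = -\<i>"
    by (simp_all add: gi_def complex_eq_iff)
  have "\<forall>a b. of_gmat gen_T $ a $ b = T2 $ a $ b"
    unfolding all_pt T2_def sq by (simp add: of_gmat_def gen_T_def frames_def sum_2 gi)
  then show ?thesis by (simp add: vec_eq_iff)
qed

lemma of_gmat_gen_E: "of_gmat gen_E = E2"
proof -
  have "\<forall>a b. of_gmat gen_E $ a $ b = E2 $ a $ b"
    unfolding all_pt by (simp add: of_gmat_def gen_E_def E2_def gi_def complex_eq_iff)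
  then show ?thesis by (simp add: vec_eq_iff)
qed

lemma affine_matrix_nth: "affine_matrix \<sigma> $ a $ b = (if b = \<sigma> a then 1 else 0)"
  by (simp add: affine_matrix_def)

lemma nth_map_4: "map f [0, 1, 2, 3] ! idx b = f (idx b)"
  using idx_less[of b] by (auto simp: numeral_eq_Suc less_Suc_eq)

lemma of_gmat_gen_swap:
  assumes "p < 4" "q < 4"
  shows "of_gmat (gen_swap p q) = affine_matrix (Transposition.transpose (pt p) (pt q))"
proof -
  have eq: "idx a = k \<longleftrightarrow> a = pt k" if "k < 4" for a k
    using idx_eq_iff[of a "pt k"] that by (simp add: idx_pt_less)
  have "of_gmat (gen_swap p q) $ a $ b
      = affine_matrix (Transposition.transpose (pt p) (pt q)) $ a $ b" for a b
  proof -
    have "gen_swap p q ! idx a ! idx b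
        = (if idx b = (if idx a = p then q else if idx a = q then p else idx a) then (2,0) else (0,0))"
      unfolding gen_swap_def nth_map_4 ..
    then show ?thesis
      using assms by (simp add: of_gmat_def affine_matrix_nth Transposition.transpose_def eq gi_2 gi_0)
  qed
  then show ?thesis by (simp add: vec_eq_iff)
qed

lemma affine_matrix_comp: "affine_matrix \<sigma> ** affine_matrix \<tau> = affine_matrix (\<tau> \<circ> \<sigma>)"
proof -
  have "(affine_matrix \<sigma> ** affine_matrix \<tau>) $ a $ b = affine_matrix (\<tau> \<circ> \<sigma>) $ a $ b" for a b
  proof -
    have "(affine_matrix \<sigma> ** affine_matrix \<tau>) $ a $ b
        = (\<Sum>k\<in>UNIV. if k = \<sigma> a then affine_matrix \<tau> $ k $ b else 0)"
      by (simp only: matrix_matrix_mult_def vec_lambda_beta)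
        (intro sum.cong refl, simp add: affine_matrix_nth)
    then show ?thesis by (simp add: affine_matrix_nth)
  qed
  then show ?thesis by (simp add: Finite_Cartesian_Product.vec_eq_iff[where 'b = "bit ^ 2"])
qed

lemma affine_matrix_id: "affine_matrix id = mat 1"
  unfolding affine_matrix_def mat_def by (intro arg_cong[where f = vec_lambda] ext) auto

lemma elts_closed_swap:
  assumes "A \<in> elts"
  shows "A ** affine_matrix (Transposition.transpose a b) \<in> elts"
proof -
  have *: "A ** affine_matrix (Transposition.transpose (pt p) (pt q)) \<in> elts"
    if "(p, q) \<in> {(0,1), (0,2), (0,3), (1,2), (1,3), (2,3)}" for p q
  proof -
    have "gen_swap p q \<in> set frame_gens" using that by (auto simp: frame_gens_def)
    from elts_closed_frame_gens[OF this assms] show ?thesis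
      using that by (subst (asm) of_gmat_gen_swap) auto
  qed
  have id: "A ** affine_matrix (Transposition.transpose a a) \<in> elts" for a
    using assms by (simp add: affine_matrix_id)
  have "\<forall>a b. A ** affine_matrix (Transposition.transpose a b) \<in> elts"
    unfolding all_pt
    using *[of 0 1] *[of 0 2] *[of 0 3] *[of 1 2] *[of 1 3] *[of 2 3] assms
    by (simp add: id affine_matrix_id Transposition.transpose_commute[of "pt 3"] Transposition.transpose_commute[of "pt 2" "pt (Suc 0)"]
        Transposition.transpose_commute[of _ "pt 0"])
  then show ?thesis by blast
qed

lemma elts_closed_perm:
  assumes "\<sigma> permutes (UNIV :: (bit ^ 2) set)" "A \<in> elts"
  shows "A ** affine_matrix \<sigma> \<in> elts"
  using assms(1) finite_class.finite_UNIV
proof (induction \<sigma> rule: permutes_induct)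
  case id
  then show ?case using assms(2) by (simp add: affine_matrix_id[unfolded id_def] affine_matrix_id)
next
  case (swap a b p)
  then show ?case
    using elts_closed_swap by (metis affine_matrix_comp matrix_mul_assoc)
qed

lemma mat_mult: "mat c ** (A :: complex ^ 'n ^ 'm) = (\<chi> i j. c * A $ i $ j)"
  by (simp add: vec_eq_iff matrix_matrix_mult_def mat_def if_distrib if_distribR cong: if_cong)

lemma mult_mat: "(A :: complex ^ 'n ^ 'm) ** mat c = (\<chi> i j. c * A $ i $ j)"
  by (simp add: vec_eq_iff matrix_matrix_mult_def mat_def if_distrib mult.commute cong: if_cong)

lemma elts_closed_scalar:
  assumes "c ^ 8 = 1" "A \<in> elts"
  shows "A ** mat c \<in> elts"
proof -
  from assms(2) obtain c' d \<sigma> j where A: "A = elt c' d \<sigma> j" "c' ^ 8 = 1" "unit_diag d" "\<sigma> permutes UNIV" "j < 15"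
    unfolding elts_def by blast
  then have "A ** mat c = elt (c * c') d \<sigma> j"
    by (simp add: mult_mat elt_def vec_eq_iff)
  then show ?thesis
    using A assms(1) by (auto intro!: elts_I simp: power_mult_distrib)
qed

lemma frame_0: "frame 0 = mat 1"
proof -
  have "\<forall>a b. frame 0 $ a $ b = mat 1 $ a $ b"
    unfolding all_pt by (simp add: frame_def of_gmat_def frames_def mat_def gi_0 gi_2)
  then show ?thesis by (simp add: vec_eq_iff)
qed

lemma elts_one: "mat 1 \<in> elts"
proof -
  have "elt 1 (\<lambda>_. 1) id 0 = mat 1"
    by (simp add: elt_def vec_eq_iff frame_0)
  moreover have "elt 1 (\<lambda>_. 1) id 0 \<in> elts"
    by (intro elts_I) (simp_all add: unit_diag_def permutes_id)
  ultimately show ?thesis by simp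
qed

section \<open>Block diagonal matrices\<close>

lemma diag2_nth [simp]:
  "diag2 A $ Inl a $ Inl b = A $ a $ b" "diag2 A $ Inr a $ Inr b = A $ a $ b"
  "diag2 A $ Inl a $ Inr b = 0" "diag2 A $ Inr a $ Inl b = 0"
  by (simp_all add: diag2_def)

lemma UNIV_var: "(UNIV :: var set) = range Inl \<union> range Inr"
  by (metis UNIV_Plus_UNIV Plus_def)

lemma sum_var:
  fixes f :: "var \<Rightarrow> 'a::comm_monoid_add"
  shows "(\<Sum>z\<in>UNIV. f z) = (\<Sum>a\<in>UNIV. f (Inl a)) + (\<Sum>a\<in>UNIV. f (Inr a))"
  unfolding UNIV_var by (subst sum.union_disjoint) (auto simp: sum.reindex)

lemma prod_var:
  fixes f :: "var \<Rightarrow> 'a::comm_monoid_mult"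
  shows "(\<Prod>z\<in>UNIV. f z) = (\<Prod>a\<in>UNIV. f (Inl a)) * (\<Prod>a\<in>UNIV. f (Inr a))"
  unfolding UNIV_var by (subst prod.union_disjoint) (auto simp: prod.reindex)

lemma cmat8_eqI:
  assumes "\<And>z w. (A :: cmat8) $ z $ w = B $ z $ w"
  shows "A = B"
  using assms by (simp add: Finite_Cartesian_Product.vec_eq_iff)

lemma diag2_mult: "diag2 (A ** B) = diag2 A ** diag2 B"
proof (rule cmat8_eqI)
  fix z w
  show "diag2 (A ** B) $ z $ w = (diag2 A ** diag2 B) $ z $ w"
    by (cases z; cases w) (simp_all add: matrix_matrix_mult_def sum_var)
qed

lemma diag2_mat: "diag2 (mat c) = mat c"
proof (rule cmat8_eqI)
  fix z w
  show "diag2 (mat c) $ z $ w = mat c $ z $ w"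
    by (cases z; cases w) (simp_all add: mat_def)
qed

lemma diag2_diag_mat: "diag2 (diag_mat d) = diag_mat (case_sum d d)"
proof (rule cmat8_eqI)
  fix z w
  show "diag2 (diag_mat d) $ z $ w = diag_mat (case_sum d d) $ z $ w"
    by (cases z; cases w) (simp_all add: diag_mat_def)
qed

lemma inj_diag2: "inj diag2"
proof (rule injI)
  fix A B assume "diag2 A = diag2 B"
  then have "diag2 A $ Inl a $ Inl b = diag2 B $ Inl a $ Inl b" for a b by simp
  then show "A = B" by (simp add: Finite_Cartesian_Product.vec_eq_iff)
qed

lemma invertible_diag2: "invertible A \<Longrightarrow> invertible (diag2 A)"
  unfolding invertible_def by (metis diag2_mult diag2_mat)

text \<open>Instead of expanding a block determinant, A is diagonalised: conjugation by
  \<open>diag2 Q\<close> lists every eigenvalue of A twice.\<close>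

lemma det_id_minus_t_diag2:
  assumes "k > 0" "\<And>v. ((*v) (diag2 A) ^^ k) v = v"
  shows "det (id_minus_t (diag2 A)) = (det (pencil A))\<^sup>2"
proof -
  \<comment> \<open>Padding with zeros in the second block carries iterates of A to iterates of
    \<open>diag2 A\<close>, so A inherits the finite order.\<close>
  define emb :: "complex ^ (bit ^ 2) \<Rightarrow> complex ^ var" where "emb v = (\<chi> z. case_sum (\<lambda>a. v $ a) (\<lambda>_. 0) z)" for v
  have step: "diag2 A *v emb v = emb (A *v v)" for v
  proof -
    have "(diag2 A *v emb v) $ z = emb (A *v v) $ z" for z
      by (cases z) (simp_all add: matrix_vector_mult_def sum_var emb_def)
    then show ?thesis by (simp add: Finite_Cartesian_Product.vec_eq_iff)
  qed
  have iter: "((*v) (diag2 A) ^^ l) (emb v) = emb (((*v) A ^^ l) v)" for l v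
    by (induction l) (simp_all add: step)
  have "((*v) A ^^ k) v = v" for v
  proof -
    have "emb (((*v) A ^^ k) v) = emb v"
      using iter[of k v] assms(2) by simp
    then have "emb (((*v) A ^^ k) v) $ Inl a = emb v $ Inl a" for a by simp
    then show ?thesis by (simp add: emb_def Finite_Cartesian_Product.vec_eq_iff)
  qed
  then obtain Q :: cmat4 and d where Qd: "invertible Q" "A ** Q = Q ** diag_mat d"
    using finite_order_diagonalizable[OF assms(1)] by blast
  have Qd2: "diag2 A ** diag2 Q = diag2 Q ** diag_mat (case_sum d d)"
    by (simp only: Qd(2) diag2_mult[symmetric] diag2_diag_mat[symmetric])
  show ?thesis
    unfolding id_minus_t_eq_pencil det_pencil_conj[OF invertible_diag2[OF Qd(1)] Qd2]
      det_pencil_conj[OF Qd] det_pencil_diag prod_var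
    by (simp add: power2_eq_square)
qed

section \<open>The group as a union of cosets\<close>

lemma invertible_one: "invertible (mat 1 :: 'a::semiring_1 ^ 'n ^ 'n)"
  unfolding invertible_def by (intro exI[of _ "mat 1"]) simp

lemma group_GL8: "group GL8"
proof (rule groupI)
  fix A assume "A \<in> carrier GL8"
  then obtain B where B: "A ** B = mat 1" "B ** A = mat 1"
    by (auto simp: GL8_def invertible_def)
  then have "invertible B" unfolding invertible_def by blast
  with B show "\<exists>y\<in>carrier GL8. y \<otimes>\<^bsub>GL8\<^esub> A = \<one>\<^bsub>GL8\<^esub>"
    by (auto simp: GL8_def)
qed (auto simp: GL8_def invertible_mult matrix_mul_assoc invertible_one)

lemma mult_GL8 [simp]: "A \<otimes>\<^bsub>GL8\<^esub> B = A ** B"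
  by (simp add: GL8_def)

lemma one_GL8 [simp]: "\<one>\<^bsub>GL8\<^esub> = mat 1"
  by (simp add: GL8_def)

lemma carrier_GL8 [simp]: "A \<in> carrier GL8 \<longleftrightarrow> invertible A"
  by (simp add: GL8_def)

definition G2_gens :: "cmat8 set" where
  "G2_gens = {diag2 T2, diag2 E2, mat eta8} \<union> {diag2 (affine_matrix \<sigma>) | \<sigma>. \<sigma> \<in> affine_maps}"

lemma G2_eq_generate: "G2 = generate GL8 G2_gens"
  by (simp add: G2_def G2_gens_def)

lemma G2_mult: "A \<in> G2 \<Longrightarrow> B \<in> G2 \<Longrightarrow> A ** B \<in> G2"
  unfolding G2_eq_generate by (metis generate.eng mult_GL8)

lemma G2_one: "mat 1 \<in> G2"
  unfolding G2_eq_generate by (metis generate.one one_GL8)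

lemma G2_gen: "A \<in> G2_gens \<Longrightarrow> A \<in> G2"
  unfolding G2_eq_generate by (rule generate.incl)

lemma eta8_squared: "eta8\<^sup>2 = \<i>"
proof -
  have "(complex_of_real (sqrt 2))\<^sup>2 = 2"
    by (simp flip: of_real_power)
  then show ?thesis
    by (simp add: eta8_def power_divide) (simp add: power2_eq_square algebra_simps)
qed

lemma eta8_power_8: "eta8 ^ 8 = 1"
proof -
  have "eta8 ^ 8 = (eta8\<^sup>2) ^ 4" by (simp flip: power_mult)
  then show ?thesis by (simp add: eta8_squared power4_eq_xxxx)
qed

text \<open>The square of c is a power of i, which is the square of \<open>eta8\<close>; the
  remaining sign is absorbed by \<open>eta8\<close> to the fourth power being -1.\<close>

lemma root_of_unity_8:
  assumes "c ^ 8 = (1 :: complex)"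
  shows "\<exists>k<8. c = eta8 ^ k"
proof -
  have "(c\<^sup>2) ^ 4 = 1" using assms by (simp flip: power_mult)
  then have "c\<^sup>2 \<in> {1, \<i>, -1, -\<i>}" by (simp only: power4_eq_1_iff)
  then obtain k where k: "k < 4" "c\<^sup>2 = \<i> ^ k"
    by (elim insertE) (auto intro: that[of 0] that[of 1] that[of 2] that[of 3] simp: power3_eq_cube)
  then have "c\<^sup>2 = (eta8 ^ k)\<^sup>2"
    by (metis eta8_squared mult.commute power_mult)
  then have "c = eta8 ^ k \<or> c = - (eta8 ^ k)"
    by (simp add: power2_eq_iff)
  moreover have "eta8 ^ (k + 4) = - (eta8 ^ k)"
  proof -
    have "eta8 ^ 4 = (eta8\<^sup>2)\<^sup>2" by (simp flip: power_mult)
    then show ?thesis by (simp add: power_add eta8_squared)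
  qed
  ultimately show ?thesis
    using k(1) by (metis add_less_cancel_right numeral_Bit0 less_add_same_cancel1 trans_less_add1)
qed

lemma affine_maps_permute: "\<sigma> \<in> affine_maps \<Longrightarrow> \<sigma> permutes UNIV"
proof -
  assume "\<sigma> \<in> affine_maps"
  then obtain M w where \<sigma>: "\<sigma> = (\<lambda>a. M *v a + w)" "invertible (M :: bit ^ 2 ^ 2)"
    unfolding affine_maps_def by blast
  obtain M' where M': "M' ** M = mat 1" using \<sigma>(2) unfolding invertible_def by blast
  have "M' *v (\<sigma> a - w) = a" for a
    by (simp add: \<sigma>(1) matrix_vector_mul_assoc M')
  then have "inj \<sigma>" by (rule inj_on_inverseI[where g = "\<lambda>b. M' *v (b - w)"])
  then show ?thesis
    by (simp add: permutes_univ bij_def finite_UNIV_inj_surj bij_iff[symmetric])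
qed

text \<open>The four points of F_2^2 add up to 0, and so do their images. Hence the image of 11 is
  the sum of the other three images, as it is for the affine map determined by the images of 00, 01
  and 10.\<close>

lemma permute_affine:
  assumes "\<sigma> permutes (UNIV :: (bit ^ 2) set)"
  shows "\<sigma> \<in> affine_maps"
proof -
  define w where "w = \<sigma> (pt 0)"
  \<comment> \<open>\<open>pt 2\<close> is the first unit vector and \<open>pt 1\<close> the second,
    hence the order of the two columns.\<close>
  define M :: "bit ^ 2 ^ 2" where "M = (\<chi> i j. if j = 1 then \<sigma> (pt 2) $ i - w $ i else \<sigma> (pt 1) $ i - w $ i)"
  have "(\<Sum>a\<in>UNIV. \<sigma> a) = (\<Sum>a\<in>UNIV. a)"
    using sum.permute[OF assms, of "\<lambda>a. a"] by (simp add: comp_def)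
  also have "(\<Sum>a\<in>UNIV. a :: bit ^ 2) = 0"
    by (simp add: sum_pt vec_eq_iff forall_2)
  finally have sum0: "\<sigma> (pt 0) + \<sigma> (pt 1) + \<sigma> (pt 2) + \<sigma> (pt 3) = 0"
    by (simp add: sum_pt)
  have 3: "\<sigma> (pt 3) $ i = \<sigma> (pt 0) $ i + \<sigma> (pt 1) $ i + \<sigma> (pt 2) $ i" for i
  proof -
    have "(\<sigma> (pt 0) + \<sigma> (pt 1) + \<sigma> (pt 2) + \<sigma> (pt 3)) $ i = 0" using sum0 by simp
    then show ?thesis
      by (cases "\<sigma> (pt 0) $ i"; cases "\<sigma> (pt 1) $ i"; cases "\<sigma> (pt 2) $ i"; cases "\<sigma> (pt 3) $ i") auto
  qed
  have bits: "x + x = 0" for x :: bit by (cases x) auto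
  have "\<forall>a. \<sigma> a = M *v a + w"
    unfolding all_pt
    by (auto simp: vec_eq_iff matrix_vector_mult_def sum_2 M_def w_def 3 bits add.assoc add_ac)
  moreover have "invertible M"
  proof -
    have "inj \<sigma>" using assms permutes_inj by blast
    then have "inj ((*v) M)"
      using calculation by (metis (mono_tags, lifting) injD injI)
    then show ?thesis
      by (metis invertible_left_inverse matrix_left_invertible_injective)
  qed
  ultimately show ?thesis
    unfolding affine_maps_def by blast
qed

text \<open>The sign matrix squares to 4 and its prefactor is i/2. The inverse of \<open>T2\<close>
  is obtained from this.\<close>

lemma T2_mult_T2: "T2 ** T2 = mat (- 1)"
proof -
  have sq: "((1 + \<i>) / 2)\<^sup>2 = \<i> / 2"
    by (simp add: power2_eq_square algebra_simps)
  have "\<forall>a b. (T2 ** T2) $ a $ b = mat (- 1) $ a $ b"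
    unfolding all_pt matrix_matrix_mult_def T2_def sq by (simp add: sum_pt mat_def sum_2)
  then show ?thesis by (simp add: Finite_Cartesian_Product.vec_eq_iff)
qed

lemma E2_eq_diag_mat: "E2 = diag_mat (\<lambda>a. if a $ 2 = 1 then \<i> else 1)"
  by (simp add: E2_def diag_mat_def)

lemma diag_mat_mult: "diag_mat d ** diag_mat d' = diag_mat (\<lambda>a. d a * (d' a :: complex))"
proof -
  have "(diag_mat d ** diag_mat d') $ i $ j = diag_mat (\<lambda>a. d a * d' a) $ i $ j" for i j
  proof -
    have "(diag_mat d ** diag_mat d') $ i $ j = (\<Sum>k\<in>UNIV. if k = i then d i * (if i = j then d' i else 0) else 0)"
      by (simp only: matrix_matrix_mult_def diag_mat_def vec_lambda_beta) (intro sum.cong, auto)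
    then show ?thesis by (simp add: diag_mat_def)
  qed
  then show ?thesis by (simp add: Finite_Cartesian_Product.vec_eq_iff)
qed

lemma invertible_rightI: "A ** B = mat 1 \<Longrightarrow> invertible (A :: complex ^ 'n ^ 'n)"
  by (metis invertible_right_inverse)

lemma G2_gens_invertible:
  assumes "A \<in> G2_gens"
  shows "invertible A"
proof -
  have "invertible T2"
  proof (rule invertible_rightI)
    show "T2 ** (T2 ** mat (- 1)) = mat 1"
      unfolding matrix_mul_assoc T2_mult_T2 unfolding diag_mat_const[symmetric] diag_mat_mult by simp
  qed
  moreover have "invertible E2"
  proof (rule invertible_rightI)
    show "E2 ** diag_mat (\<lambda>a. if a $ 2 = 1 then -\<i> else 1) = mat 1"
      unfolding E2_eq_diag_mat diag_mat_mult by (simp add: diag_mat_const[symmetric] if_distrib cong: if_cong)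
  qed
  moreover have "invertible (mat eta8 :: cmat8)"
  proof (rule invertible_rightI)
    have "eta8 * eta8 ^ 7 = 1" using eta8_power_8 by (simp add: power_eq_if)
    then show "mat eta8 ** mat (eta8 ^ 7) = (mat 1 :: cmat8)"
      unfolding diag_mat_const[symmetric] diag_mat_mult by simp
  qed
  moreover have "invertible (affine_matrix \<sigma>)" if "\<sigma> \<in> affine_maps" for \<sigma>
  proof (rule invertible_rightI)
    show "affine_matrix \<sigma> ** affine_matrix (inv_into UNIV \<sigma>) = mat 1"
      using permutes_inv_o(2)[OF affine_maps_permute[OF that]]
      by (simp add: affine_matrix_comp affine_matrix_id)
  qed
  ultimately show ?thesis
    using assms unfolding G2_gens_def by (auto intro: invertible_diag2)
qed

section \<open>Scalars, diagonal matrices, permutations and frames in the group\<close>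

lemma G2_T2: "diag2 T2 \<in> G2" and G2_E2: "diag2 E2 \<in> G2"
  by (rule G2_gen; simp add: G2_gens_def)+

lemma G2_affine: "\<sigma> permutes UNIV \<Longrightarrow> diag2 (affine_matrix \<sigma>) \<in> G2"
  by (rule G2_gen) (use permute_affine in \<open>auto simp: G2_gens_def\<close>)

lemma G2_diag2_mult: "diag2 A \<in> G2 \<Longrightarrow> diag2 B \<in> G2 \<Longrightarrow> diag2 (A ** B) \<in> G2"
  by (simp add: diag2_mult G2_mult)

lemma G2_eta_power: "mat (eta8 ^ k) \<in> G2"
proof (induction k)
  case 0
  show ?case using G2_one by simp
next
  case (Suc k)
  have "mat eta8 \<in> G2" by (rule G2_gen) (simp add: G2_gens_def)
  then have "mat eta8 ** mat (eta8 ^ k) \<in> G2" using Suc by (rule G2_mult)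
  then show ?case
    unfolding diag_mat_const[symmetric] diag_mat_mult by simp
qed

lemma G2_scalar: "c ^ 8 = 1 \<Longrightarrow> diag2 (mat c) \<in> G2"
  using root_of_unity_8 G2_eta_power by (auto simp: diag2_mat)

lemma G2_diag_permute:
  assumes "diag2 (diag_mat d) \<in> G2" "\<sigma> permutes UNIV"
  shows "diag2 (diag_mat (d \<circ> \<sigma>)) \<in> G2"
proof -
  have "affine_matrix \<sigma> ** diag_mat d ** affine_matrix (inv_into UNIV \<sigma>) = diag_mat (d \<circ> \<sigma>)"
  proof -
    have "(affine_matrix \<sigma> ** diag_mat d ** affine_matrix (inv_into UNIV \<sigma>)) $ a $ b = diag_mat (d \<circ> \<sigma>) $ a $ b" for a b
    proof -
      have 1: "(affine_matrix \<sigma> ** diag_mat d) $ a $ k = (if k = \<sigma> a then d k else 0)" for k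
      proof -
        have "(affine_matrix \<sigma> ** diag_mat d) $ a $ k = (\<Sum>l\<in>UNIV. if l = \<sigma> a then (if l = k then d l else 0) else 0)"
          by (simp only: matrix_matrix_mult_def diag_mat_def vec_lambda_beta) (intro sum.cong, auto simp: affine_matrix_nth)
        then show ?thesis by auto
      qed
      have "(affine_matrix \<sigma> ** diag_mat d ** affine_matrix (inv_into UNIV \<sigma>)) $ a $ b
          = (\<Sum>l\<in>UNIV. (affine_matrix \<sigma> ** diag_mat d) $ a $ l * affine_matrix (inv_into UNIV \<sigma>) $ l $ b)"
        by (simp add: matrix_matrix_mult_def)
      also have "\<dots> = (\<Sum>l\<in>UNIV. if l = \<sigma> a then (if b = inv_into UNIV \<sigma> l then d l else 0) else 0)"
        unfolding 1 by (intro sum.cong refl) (auto simp: affine_matrix_nth)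
      also have "\<dots> = diag_mat (d \<circ> \<sigma>) $ a $ b"
        using permutes_inverses[OF assms(2)] by (auto simp: diag_mat_def)
      finally show ?thesis .
    qed
    then show ?thesis by (simp add: Finite_Cartesian_Product.vec_eq_iff)
  qed
  then show ?thesis
    using assms G2_affine[OF assms(2)] G2_affine[OF permutes_inv[OF assms(2)]] G2_diag2_mult by metis
qed

lemma G2_diag_mult:
  "diag2 (diag_mat d) \<in> G2 \<Longrightarrow> diag2 (diag_mat d') \<in> G2 \<Longrightarrow> diag2 (diag_mat (\<lambda>a. d a * d' a)) \<in> G2"
  using G2_diag2_mult by (simp flip: diag_mat_mult)

lemma G2_diag_power: "diag2 (diag_mat d) \<in> G2 \<Longrightarrow> diag2 (diag_mat (\<lambda>a. d a ^ k)) \<in> G2"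
proof (induction k)
  case 0
  then show ?case using G2_scalar[of 1] by (simp add: diag_mat_const)
next
  case (Suc k)
  then show ?case using G2_diag_mult by simp
qed

text \<open>The diagonal matrices with entries in \<open>\<mu>\<^sub>4\<close> and determinant \<open>\<plusminus>1\<close> are products of
  conjugates of \<open>E\<^sub>2\<close>, which put \<open>\<i>\<close> on two positions, and of the scalar \<open>\<i>\<close>.\<close>
lemma G2_unit_diag:
  assumes "unit_diag d"
  shows "diag2 (diag_mat d) \<in> G2"
proof -
  let ?u = "\<lambda>p q a. if a = pt p \<or> a = pt q then \<i> else 1 :: complex"
  have E: "diag2 (diag_mat (?u 1 3)) \<in> G2"
  proof -
    have "\<forall>a. (if a $ 2 = 1 then \<i> else 1) = ?u 1 3 a"
      unfolding all_pt by simp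
    then show ?thesis using G2_E2 unfolding E2_eq_diag_mat by simp
  qed
  let ?t = "\<lambda>p q. Transposition.transpose (pt p) (pt q)"
  have t: "?t p q permutes UNIV" for p q
    by (rule permutes_swap_id) auto
  have u1: "diag2 (diag_mat (?u 0 1)) \<in> G2"
  proof -
    have "\<forall>a. (?u 1 3 \<circ> ?t 0 3) a = ?u 0 1 a"
      unfolding all_pt by (simp add: Transposition.transpose_def)
    then have "?u 1 3 \<circ> ?t 0 3 = ?u 0 1" by blast
    then show ?thesis using G2_diag_permute[OF E t[of 0 3]] by simp
  qed
  have u3: "diag2 (diag_mat (?u 0 3)) \<in> G2"
  proof -
    have "\<forall>a. (?u 1 3 \<circ> ?t 0 1) a = ?u 0 3 a"
      unfolding all_pt by (simp add: Transposition.transpose_def)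
    then have "?u 1 3 \<circ> ?t 0 1 = ?u 0 3" by blast
    then show ?thesis using G2_diag_permute[OF E t[of 0 1]] by simp
  qed
  have u2: "diag2 (diag_mat (?u 0 2)) \<in> G2"
  proof -
    have "\<forall>a. (?u 0 3 \<circ> ?t 2 3) a = ?u 0 2 a"
      unfolding all_pt by (simp add: Transposition.transpose_def)
    then have "?u 0 3 \<circ> ?t 2 3 = ?u 0 2" by blast
    then show ?thesis using G2_diag_permute[OF u3 t[of 2 3]] by simp
  qed
  have i: "diag2 (diag_mat (\<lambda>_. -\<i>)) \<in> G2"
    using G2_scalar[of "-\<i>"] by (simp add: diag_mat_const power_eq_if)
  \<comment> \<open>The three factors multiply to -i at 00 and to i elsewhere; the scalar -i turns
    this into a single sign at 00.\<close>
  define neg :: "bit ^ 2 \<Rightarrow> complex" where "neg a = - \<i> * (?u 0 1 a * (?u 0 2 a * ?u 0 3 a))" for a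
  have neg: "diag2 (diag_mat neg) \<in> G2"
    unfolding neg_def by (intro G2_diag_mult u1 u2 u3 i)
  have neg_pt: "neg (pt 0) = - 1" "neg (pt 1) = 1" "neg (pt 2) = 1" "neg (pt 3) = 1"
    by (simp_all add: neg_def)
  have ex: "\<exists>k. d a = \<i> ^ k" for a
  proof -
    have "d a \<in> {1, \<i>, -1, -\<i>}"
      using assms by (simp only: unit_diag_def power4_eq_1_iff)
    moreover have "1 = \<i> ^ 0" "\<i> = \<i> ^ 1" "- 1 = \<i> ^ 2" "- \<i> = \<i> ^ 3"
      by (simp_all add: power3_eq_cube)
    ultimately show ?thesis by (elim insertE) (metis emptyE)+
  qed
  obtain k1 k2 k3 where k: "d (pt 1) = \<i> ^ k1" "d (pt 2) = \<i> ^ k2" "d (pt 3) = \<i> ^ k3"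
    using ex by metis
  \<comment> \<open>The exponents are chosen so that \<open>e\<close> agrees with \<open>d\<close>
    at the three nonzero points. The determinant condition then fixes the value at 00 up to a sign,
    which \<open>neg\<close> corrects.\<close>
  define e where "e a = ?u 0 1 a ^ k1 * (?u 0 2 a ^ k2 * ?u 0 3 a ^ k3)" for a
  have e: "diag2 (diag_mat e) \<in> G2"
    unfolding e_def by (intro G2_diag_mult G2_diag_power u1 u2 u3)
  have e_pt: "e (pt 1) = d (pt 1)" "e (pt 2) = d (pt 2)" "e (pt 3) = d (pt 3)"
    "e (pt 0) = d (pt 1) * (d (pt 2) * d (pt 3))"
    by (simp_all add: e_def k[unfolded One_nat_def])
  have "(d (pt 0) * e (pt 0))\<^sup>2 = 1"
    using assms by (simp add: unit_diag_def prod_pt e_pt mult.assoc)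
  moreover have "(e (pt 0) ^ 2)\<^sup>2 = 1"
    using assms by (simp add: unit_diag_def e_pt power_mult_distrib flip: power_mult)
  ultimately have "d (pt 0) ^ 2 * e (pt 0) ^ 2 = e (pt 0) ^ 2 * e (pt 0) ^ 2" "e (pt 0) \<noteq> 0"
    by (auto simp: power_mult_distrib power2_eq_square mult_ac)
  then have "d (pt 0) ^ 2 = e (pt 0) ^ 2"
    by (metis mult_right_cancel power_not_zero)
  then have "d (pt 0) = e (pt 0) \<or> d (pt 0) = - e (pt 0)"
    by (simp add: power2_eq_iff)
  then show ?thesis
  proof
    assume "d (pt 0) = e (pt 0)"
    then have "\<forall>a. d a = e a" unfolding all_pt by (simp add: e_pt(1-3)[unfolded One_nat_def])
    then have "d = e" by blast
    then show ?thesis using e by simp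
  next
    assume "d (pt 0) = - e (pt 0)"
    then have "\<forall>a. d a = e a * neg a" unfolding all_pt by (simp add: e_pt(1-3)[unfolded One_nat_def] neg_pt[unfolded One_nat_def])
    then have "d = (\<lambda>a. e a * neg a)" by blast
    then show ?thesis using G2_diag_mult[OF e neg] by simp
  qed
qed

text \<open>Every frame but the first is the product of an earlier one and a generator; the list gives
  the indices of both.\<close>

definition frame_tree :: "(nat \<times> nat) list" where
  "frame_tree = [(0,0), (1,1), (2,0), (2,2), (2,4), (3,1), (3,3), (3,4), (4,1), (5,1), (6,0), (6,3), (9,0), (13,1)]"

lemma frame_tree: "list_all (\<lambda>j. case frame_tree ! j of (p, k) \<Rightarrow> p < Suc j \<and> k < length frame_gens \<and>
    gmat_mult (frames ! p) (frame_gens ! k) = map (map (gmul (2,0))) (frames ! Suc j)) [0..<14]"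
  by code_simp

lemma G2_frame_gens:
  assumes "g \<in> set frame_gens"
  shows "diag2 (of_gmat g) \<in> G2"
proof -
  have swap: "diag2 (of_gmat (gen_swap p q)) \<in> G2" if "p < 4" "q < 4" for p q
    using that by (simp add: of_gmat_gen_swap G2_affine permutes_swap_id)
  show ?thesis
    using assms swap G2_T2 G2_E2 by (auto simp: frame_gens_def of_gmat_gen_T of_gmat_gen_E)
qed

lemma G2_frame:
  assumes "j < 15"
  shows "diag2 (frame j) \<in> G2"
  using assms
proof (induction j rule: less_induct)
  case (less j)
  show ?case
  proof (cases j)
    case 0
    then show ?thesis using G2_one by (simp add: frame_0 diag2_mat)
  next
    case (Suc i)
    \<comment> \<open>Entry i of \<open>frame_tree\<close> produces frame i + 1, since frame 0 is
      the identity.\<close>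
    obtain p k where pk: "frame_tree ! i = (p, k)" by fastforce
    have "i \<in> set [0..<14]" using Suc less.prems by simp
    with frame_tree pk have *: "p < Suc i" "k < length frame_gens"
      "gmat_mult (frames ! p) (frame_gens ! k) = map (map (gmul (2,0))) (frames ! Suc i)"
      unfolding list_all_iff by fastforce+
    have len: "length (frames ! l) = 4" "length (frames ! l ! idx a) = 4" if "l < 15" for l a
    proof -
      have "frames ! l \<in> set frames" using that frames_shape(1) by simp
      then have "length (frames ! l) = 4" "\<forall>r\<in>set (frames ! l). length r = 4"
        using frames_shape(2) by (simp_all add: list_all_iff)
      then show "length (frames ! l) = 4" "length (frames ! l ! idx a) = 4" by simp_all
    qed
    have "p < 15" using *(1) Suc less.prems by simp
    have "(frame p ** of_gmat (frame_gens ! k)) $ a $ b = frame j $ a $ b" for a b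
    proof -
      have "(frame p ** of_gmat (frame_gens ! k)) $ a $ b
          = gi (gmat_mult (frames ! p) (frame_gens ! k) ! idx a ! idx b) / 4"
        unfolding frame_def by (rule of_gmat_mult[OF len(1)[OF \<open>p < 15\<close>]])
      also have "\<dots> = frame j $ a $ b"
        using len(1)[of j] len(2)[of j a] less.prems Suc by (simp add: *(3) frame_def of_gmat_def gi_gmul gi_2)
      finally show ?thesis .
    qed
    then have "frame j = frame p ** of_gmat (frame_gens ! k)"
      by (simp add: Finite_Cartesian_Product.vec_eq_iff)
    moreover have "diag2 (frame p) \<in> G2"
      using less.IH[of p] *(1) Suc \<open>p < 15\<close> by simp
    ultimately show ?thesis
      using G2_diag2_mult G2_frame_gens[of "frame_gens ! k"] *(2) by simp
  qed
qed

lemma elt_eq_prod: "elt c d \<sigma> j = mat c ** (diag_mat d ** (affine_matrix \<sigma> ** frame j))"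
proof -
  have *: "(affine_matrix \<sigma> ** frame j) $ a $ b = frame j $ \<sigma> a $ b" for a b
  proof -
    have "(affine_matrix \<sigma> ** frame j) $ a $ b = (\<Sum>k\<in>UNIV. if k = \<sigma> a then frame j $ k $ b else 0)"
      by (simp only: matrix_matrix_mult_def vec_lambda_beta) (intro sum.cong, auto simp: affine_matrix_nth)
    then show ?thesis by simp
  qed
  have **: "(diag_mat d ** B) $ a $ b = d a * B $ a $ b" for B :: cmat4 and a b
  proof -
    have "(diag_mat d ** B) $ a $ b = (\<Sum>k\<in>UNIV. if k = a then d a * B $ k $ b else 0)"
      by (simp only: matrix_matrix_mult_def diag_mat_def vec_lambda_beta) (intro sum.cong, auto)
    then show ?thesis by simp
  qed
  show ?thesis
    by (simp add: mat_mult * ** elt_def mult.assoc)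
qed

lemma elts_subset_G2: "diag2 ` elts \<subseteq> G2"
proof
  fix A assume "A \<in> diag2 ` elts"
  then obtain c d \<sigma> j where "A = diag2 (elt c d \<sigma> j)" "c ^ 8 = 1" "unit_diag d" "\<sigma> permutes UNIV" "j < 15"
    unfolding elts_def by blast
  then show "A \<in> G2"
    unfolding elt_eq_prod
    by (simp only:) (intro G2_diag2_mult G2_scalar G2_unit_diag G2_affine G2_frame)
qed

lemma elts_closed_gens:
  assumes "g \<in> G2_gens" "A \<in> diag2 ` elts"
  shows "A ** g \<in> diag2 ` elts"
proof -
  from assms(2) obtain B where B: "A = diag2 B" "B \<in> elts" by blast
  have "\<exists>h. g = diag2 h \<and> B ** h \<in> elts"
  proof -
    have "B ** T2 \<in> elts" "B ** E2 \<in> elts"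
      using elts_closed_frame_gens[of gen_T B] elts_closed_frame_gens[of gen_E B] B(2)
      by (simp_all add: frame_gens_def of_gmat_gen_T of_gmat_gen_E)
    moreover have "B ** mat eta8 \<in> elts"
      using elts_closed_scalar[OF eta8_power_8 B(2)] .
    moreover have "B ** affine_matrix \<sigma> \<in> elts" if "\<sigma> \<in> affine_maps" for \<sigma>
      using elts_closed_perm[OF affine_maps_permute[OF that] B(2)] .
    ultimately show ?thesis
      using assms(1) unfolding G2_gens_def diag2_mat[symmetric] by blast
  qed
  then show ?thesis by (auto simp: B(1) diag2_mult[symmetric])
qed

section \<open>Enumeration of the group\<close>

text \<open>The diagonals normalised to entry 1 at 00, whose scalar is moved into the eighth root of
  unity. With entries x and y at 01 and 10, determinant 1 or -1 leaves xy and -xy for the last one: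
  32 triples.\<close>

definition diags :: "(gint \<times> gint \<times> gint) list" where
  "diags = concat (map (\<lambda>x. concat (map (\<lambda>y. map (\<lambda>s. (x, y, gmul s (gmul x y))) [(1,0), (-1,0)]) units)) units)"

definition perms :: "nat list list" where
  "perms = filter distinct (List.n_lists 4 [0, 1, 2, 3])"

fun diag_fun :: "gint \<times> gint \<times> gint \<Rightarrow> bit ^ 2 \<Rightarrow> complex" where
  "diag_fun (x, y, z) a = gi ([(1,0), x, y, z] ! idx a)"

definition perm_fun :: "nat list \<Rightarrow> bit ^ 2 \<Rightarrow> bit ^ 2" where
  "perm_fun p a = pt (p ! idx a)"

definition G2_index :: "(nat \<times> nat \<times> nat list \<times> gint \<times> gint \<times> gint) set" where
  "G2_index = {..<8} \<times> {..<15} \<times> set perms \<times> set diags"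

fun G2_elt :: "nat \<times> nat \<times> nat list \<times> gint \<times> gint \<times> gint \<Rightarrow> cmat4" where
  "G2_elt (k, j, p, d) = elt (eta8 ^ k) (diag_fun d) (perm_fun p) j"

lemma distinct_diags: "distinct diags"
  by code_simp

lemma length_diags: "length diags = 32"
  by code_simp

lemma distinct_perms: "distinct perms"
  unfolding perms_def by (intro distinct_filter distinct_n_lists) simp

lemma length_perms: "length perms = 24"
  by code_simp

lemma perms_iff: "p \<in> set perms \<longleftrightarrow> length p = 4 \<and> set p \<subseteq> {..<4} \<and> distinct p"
proof -
  have "{0, 1, 2, 3} = {..<4::nat}" by auto
  then show ?thesis by (auto simp: perms_def set_n_lists)
qed

lemma perm_fun_permutes:
  assumes "p \<in> set perms"
  shows "perm_fun p permutes UNIV"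
proof -
  have p: "length p = 4" "set p \<subseteq> {..<4}" "distinct p" using assms by (simp_all add: perms_iff)
  have "inj (perm_fun p)"
  proof (rule injI)
    fix a b assume "perm_fun p a = perm_fun p b"
    moreover have "p ! idx a < 4" "p ! idx b < 4"
      using p(2) nth_mem[of "idx a" p] nth_mem[of "idx b" p] p(1) by (auto simp del: nth_mem)
    ultimately have "p ! idx a = p ! idx b" by (simp add: perm_fun_def pt_inject)
    then show "a = b" using p by (simp add: nth_eq_iff_index_eq)
  qed
  then show ?thesis
    by (simp add: permutes_univ bij_def finite_UNIV_inj_surj bij_iff[symmetric])
qed

lemma permutes_perm_fun:
  assumes "\<sigma> permutes UNIV"
  obtains p where "p \<in> set perms" "\<sigma> = perm_fun p"
proof
  let ?p = "map (\<lambda>k. idx (\<sigma> (pt k))) [0, 1, 2, 3]"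
  have "inj \<sigma>" using assms by (rule permutes_inj)
  then show "?p \<in> set perms"
    unfolding perms_iff by (auto simp: inj_eq)
  show "\<sigma> = perm_fun ?p"
    unfolding perm_fun_def nth_map_4 by (simp add: fun_eq_iff)
qed

lemma diag_fun_pt: "diag_fun (x, y, z) (pt 0) = 1" "diag_fun (x, y, z) (pt 1) = gi x"
  "diag_fun (x, y, z) (pt 2) = gi y" "diag_fun (x, y, z) (pt 3) = gi z"
  by (simp_all add: gi_1)

lemma diags_iff: "(x, y, z) \<in> set diags \<longleftrightarrow> x \<in> set units \<and> y \<in> set units \<and> (\<exists>s\<in>{(1,0), (-1,0)}. z = gmul s (gmul x y))"
  unfolding diags_def by auto

lemma gi_minus_1: "gi (-1, 0) = -1"
  by (simp add: gi_def complex_eq_iff)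

lemma unit_diag_diag_fun:
  assumes "d \<in> set diags"
  shows "unit_diag (diag_fun d)"
proof -
  obtain x y z where d: "d = (x, y, z)" by (cases d)
  have units: "gi x ^ 4 = 1" "gi y ^ 4 = 1"
    using assms gi_units unfolding d diags_iff power4_eq_1_iff by blast+
  have z: "gi z = gi x * gi y \<or> gi z = - (gi x * gi y)"
    using assms unfolding d diags_iff by (auto simp: gi_gmul gi_1 gi_minus_1)
  define w where "w = gi x * gi y"
  have w: "w ^ 4 = 1" using units by (simp add: w_def power_mult_distrib)
  have "gi z ^ 4 = w ^ 4" "(w * gi z)\<^sup>2 = w ^ 4"
    using z by (auto simp: w_def[symmetric] power4_eq_xxxx power2_eq_square)
  then have "gi z ^ 4 = 1" "(gi x * (gi y * gi z))\<^sup>2 = (gi x ^ 4) * (gi y ^ 4)"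
    using w units by (simp_all add: w_def mult.assoc)
  moreover have "\<forall>a. diag_fun d a ^ 4 = 1"
    unfolding all_pt d diag_fun_pt using units calculation by simp
  ultimately show ?thesis
    unfolding unit_diag_def d prod_pt diag_fun_pt[unfolded One_nat_def] using units
    by (simp add: mult.assoc)
qed

lemma diag_fun_nonzero: "d \<in> set diags \<Longrightarrow> diag_fun d a \<noteq> 0"
  using unit_diag_diag_fun[of d] unfolding unit_diag_def
  by (metis power_zero_numeral zero_neq_one)

text \<open>Dividing by the entry at 00, whose fourth power is 1, keeps the determinant condition.
  It then reads (xyz)^2 = 1, and as (xy)^4 = 1 this means that z is xy or -xy.\<close>

lemma unit_diag_normalize:
  assumes "unit_diag d"
  obtains x where "x \<in> set diags" "\<And>a. d a = d (pt 0) * diag_fun x a"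
proof -
  define e where "e a = d a / d (pt 0)" for a
  have d4: "d a ^ 4 = 1" for a using assms by (simp add: unit_diag_def)
  have "e a ^ 4 = 1" for a by (simp add: e_def power_divide d4)
  then have "\<exists>x\<in>set units. e a = gi x" for a
    using gi_units by (metis (no_types, lifting) imageE power4_eq_1_iff)
  then obtain x y z where xyz: "x \<in> set units" "y \<in> set units" "z \<in> set units"
    "e (pt 1) = gi x" "e (pt 2) = gi y" "e (pt 3) = gi z" by metis
  have ne: "d (pt 0) \<noteq> 0" using d4[of "pt 0"] by auto
  have "(e (pt 1) * e (pt 2) * e (pt 3))\<^sup>2 = 1"
  proof -
    have "(d (pt 0) * d (pt 1) * d (pt 2) * d (pt 3))\<^sup>2 = 1"
      using assms by (simp add: unit_diag_def prod_pt)
    moreover have "d (pt 0) * d (pt 1) * d (pt 2) * d (pt 3) = d (pt 0) ^ 4 * (e (pt 1) * e (pt 2) * e (pt 3))"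
      using ne by (simp add: e_def power4_eq_xxxx)
    ultimately show ?thesis by (simp add: d4)
  qed
  then have sq: "(gi x * gi y * gi z)\<^sup>2 = 1" by (simp add: xyz(4)[unfolded One_nat_def] xyz)
  have "gi x ^ 4 = 1" "gi y ^ 4 = 1"
    using xyz(1,2) gi_units unfolding power4_eq_1_iff by blast+
  then have "((gi x * gi y)\<^sup>2)\<^sup>2 = 1"
    by (simp add: power_mult_distrib flip: power_mult)
  with sq have "(gi x * gi y)\<^sup>2 * gi z ^ 2 = (gi x * gi y)\<^sup>2 * (gi x * gi y) ^ 2" "(gi x * gi y)\<^sup>2 \<noteq> 0"
    by (simp_all only: power_mult_distrib[of _ "gi z"] power2_eq_square[of "(_::complex)\<^sup>2"]) auto
  then have "gi z ^ 2 = (gi x * gi y) ^ 2"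
    by (metis mult_left_cancel)
  then have "gi z = gi x * gi y \<or> gi z = - (gi x * gi y)"
    by (simp add: power2_eq_iff)
  then have "gi z = gi (gmul (1,0) (gmul x y)) \<or> gi z = gi (gmul (-1,0) (gmul x y))"
    by (simp add: gi_gmul gi_1 gi_minus_1)
  then have "z = gmul (1,0) (gmul x y) \<or> z = gmul (-1,0) (gmul x y)"
    by (simp only: gi_eq_iff)
  then have "(x, y, z) \<in> set diags"
    unfolding diags_iff using xyz(1,2) by blast
  moreover have e_eq: "\<forall>a. e a = diag_fun (x, y, z) a"
    unfolding all_pt diag_fun_pt by (simp add: xyz(4-6)[unfolded One_nat_def]) (use xyz ne in \<open>simp add: e_def\<close>)
  have "d a = d (pt 0) * diag_fun (x, y, z) a" for a
  proof -
    have "d a = d (pt 0) * e a" using ne by (simp add: e_def)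
    also have "e a = diag_fun (x, y, z) a" using e_eq by blast
    finally show ?thesis .
  qed
  ultimately show thesis using that by blast
qed

lemma elts_eq_image: "elts = G2_elt ` G2_index"
proof
  show "G2_elt ` G2_index \<subseteq> elts"
  proof
    fix A assume "A \<in> G2_elt ` G2_index"
    then obtain k j p d where *: "A = G2_elt (k, j, p, d)" "j < 15" "p \<in> set perms" "d \<in> set diags"
      unfolding G2_index_def by blast
    have "(eta8 ^ k) ^ 8 = 1"
      by (metis eta8_power_8 mult.commute power_mult power_one)
    then show "A \<in> elts"
      unfolding *(1) G2_elt.simps
      by (intro elts_I unit_diag_diag_fun perm_fun_permutes *)
  qed
  show "elts \<subseteq> G2_elt ` G2_index"
  proof
    fix A assume "A \<in> elts"
    then obtain c d \<sigma> j where *: "A = elt c d \<sigma> j" "c ^ 8 = 1" "unit_diag d" "\<sigma> permutes UNIV" "j < 15"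
      unfolding elts_def by blast
    obtain x where x: "x \<in> set diags" "\<And>a. d a = d (pt 0) * diag_fun x a"
      using unit_diag_normalize[OF *(3)] by blast
    obtain p where p: "p \<in> set perms" "\<sigma> = perm_fun p"
      using permutes_perm_fun[OF *(4)] by blast
    have "d (pt 0) ^ 4 = 1" using *(3) by (simp add: unit_diag_def)
    then have "(d (pt 0) ^ 4)\<^sup>2 = 1" by simp
    then have "d (pt 0) ^ 8 = 1" by (simp flip: power_mult)
    then have "(c * d (pt 0)) ^ 8 = 1"
      using *(2) by (simp add: power_mult_distrib)
    then obtain k where k: "k < 8" "c * d (pt 0) = eta8 ^ k" using root_of_unity_8 by blast
    have "c * d a = eta8 ^ k * diag_fun x a" for a
      using x(2)[of a] k(2) by (metis mult.assoc)
    then have "A = elt (eta8 ^ k) (diag_fun x) (perm_fun p) j"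
      unfolding *(1) elt_def p(2) by presburger
    then have "A = G2_elt (k, j, p, x)" by simp
    moreover have "(k, j, p, x) \<in> G2_index"
      using k(1) *(5) p(1) x(1) by (simp add: G2_index_def)
    ultimately show "A \<in> G2_elt ` G2_index" by blast
  qed
qed

section \<open>Distinct indices give distinct matrices\<close>

lemma gmul_commute: "gmul z w = gmul w z"
  by (simp add: gmul_def algebra_simps)

lemma parallel_sym:
  assumes "parallel r s"
  shows "parallel s r"
proof -
  have "gmul (r ! k) (s ! l) = gmul (r ! l) (s ! k) \<longleftrightarrow> gmul (s ! k) (r ! l) = gmul (s ! l) (r ! k)" for k l
    by (metis gmul_commute)
  then show ?thesis using assms unfolding parallel_def by presburger
qed

lemma pairwise_skew_nth:
  assumes "pairwise_skew xs" "i < length xs" "k < length xs" "i \<noteq> k"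
  shows "\<not> parallel (xs ! i) (xs ! k)"
  using assms
proof (induction xs arbitrary: i k)
  case (Cons r rs)
  have r: "\<not> parallel r (rs ! l)" if "l < length rs" for l
    using Cons.prems(1) that by (simp add: list_all_iff)
  show ?case
  proof (cases i; cases k)
    fix i' k' assume "i = Suc i'" "k = Suc k'"
    then show ?thesis using Cons by simp
  next
    fix i' assume "i = Suc i'" "k = 0"
    then show ?thesis using Cons.prems r[of i'] parallel_sym by fastforce
  next
    fix k' assume "i = 0" "k = Suc k'"
    then show ?thesis using Cons.prems r[of k'] by simp
  qed (use Cons.prems in simp)
qed simp

lemma pairwise_skew_nonzero: "pairwise_skew xs \<Longrightarrow> r \<in> set xs \<Longrightarrow> r \<noteq> [(0,0), (0,0), (0,0), (0,0)]"
  by (induction xs) auto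

lemma nth_concat_blocks:
  assumes "\<forall>M\<in>set Ms. length M = n" "j < length Ms" "s < n"
  shows "concat Ms ! (n * j + s) = Ms ! j ! s"
  using assms
proof (induction Ms arbitrary: j)
  case (Cons M Ms)
  then show ?case by (cases j) (auto simp: nth_append)
qed simp

lemma frame_rows:
  assumes "j < 15"
  shows "length (frames ! j ! idx a) = 4" "frames ! j ! idx a \<noteq> [(0,0), (0,0), (0,0), (0,0)]"
    "concat frames ! (4 * j + idx a) = frames ! j ! idx a"
proof -
  have *: "frames ! j \<in> set frames" using assms frames_shape(1) by simp
  then have len: "length (frames ! j) = 4" "\<forall>r\<in>set (frames ! j). length r = 4"
    using frames_shape(2) by (simp_all add: list_all_iff)
  then show "length (frames ! j ! idx a) = 4" by simp
  have "frames ! j ! idx a \<in> set (concat frames)"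
    using * len(1) by (auto intro!: bexI[of _ "frames ! j"])
  then show "frames ! j ! idx a \<noteq> [(0,0), (0,0), (0,0), (0,0)]"
    using pairwise_skew_nonzero[OF frames_skew] by blast
  show "concat frames ! (4 * j + idx a) = frames ! j ! idx a"
    using frames_shape assms by (intro nth_concat_blocks) (auto simp: list_all_iff)
qed

lemma length_concat_frames: "length (concat frames) = 60"
  by code_simp

lemma frame_row_nonzero:
  assumes "j < 15"
  obtains b where "frame j $ a $ b \<noteq> 0"
proof -
  let ?r = "frames ! j ! idx a"
  have "\<exists>b. ?r ! idx b \<noteq> (0, 0)"
  proof (rule ccontr)
    assume "\<not> (\<exists>b. ?r ! idx b \<noteq> (0, 0))"
    then have "?r ! idx b = (0, 0)" for b by blast
    from this[of "pt 0"] this[of "pt 1"] this[of "pt 2"] this[of "pt 3"]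
    have "?r ! 0 = (0,0)" "?r ! Suc 0 = (0,0)" "?r ! 2 = (0,0)" "?r ! 3 = (0,0)"
      by simp_all
    moreover obtain x0 x1 x2 x3 where "?r = [x0, x1, x2, x3]"
      using frame_rows(1)[OF assms, of a] by (auto simp: numeral_eq_Suc length_Suc_conv)
    ultimately show False using frame_rows(2)[OF assms, of a] by simp
  qed
  then obtain b where "?r ! idx b \<noteq> (0, 0)" by blast
  then have "frame j $ a $ b \<noteq> 0"
    using gi_eq_iff[of "?r ! idx b" "(0,0)"] by (simp add: frame_def of_gmat_def gi_0)
  then show thesis by (rule that)
qed

text \<open>Hence each row of a group element determines its coset and one value of its permutation.\<close>
lemma frame_rows_proportional:
  assumes "j < 15" "j' < 15" "x \<noteq> 0" "y \<noteq> 0"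
    and eq: "\<And>b. x * frame j $ a $ b = y * frame j' $ a' $ b"
  shows "j = j' \<and> a = a'"
proof -
  let ?r = "frames ! j ! idx a" and ?s = "frames ! j' ! idx a'"
  have eq': "x * gi (?r ! idx b) = y * gi (?s ! idx b)" for b
    using eq[of b] by (simp add: frame_def of_gmat_def)
  have "gmul (?r ! idx b) (?s ! idx c) = gmul (?r ! idx c) (?s ! idx b)" for b c
  proof -
    have "(x * gi (?r ! idx b)) * (y * gi (?s ! idx c)) = (y * gi (?s ! idx b)) * (x * gi (?r ! idx c))"
      by (simp only: eq')
    then have "gi (?r ! idx b) * gi (?s ! idx c) = gi (?r ! idx c) * gi (?s ! idx b)"
      using assms by (simp add: mult_ac)
    then show ?thesis by (simp flip: gi_gmul)
  qed
  then have pt: "gmul (?r ! k) (?s ! l) = gmul (?r ! l) (?s ! k)" if "k < 4" "l < 4" for k l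
    by (metis idx_pt_less that)
  have "parallel ?r ?s"
    unfolding parallel_def list_all_iff by (auto intro: pt)
  moreover have "4 * j + idx a < 60" "4 * j' + idx a' < 60"
    using assms idx_less[of a] idx_less[of a'] by linarith+
  ultimately have "4 * j + idx a = 4 * j' + idx a'"
    using pairwise_skew_nth[OF frames_skew, of "4 * j + idx a" "4 * j' + idx a'"] assms
    by (auto simp: length_concat_frames frame_rows(3))
  moreover from this have "j = j'"
    using idx_less[of a] idx_less[of a'] by linarith
  ultimately show ?thesis by simp
qed

lemma eta8_nonzero: "eta8 \<noteq> 0"
  using eta8_power_8 by auto

text \<open>If \<open>eta8\<close> to the power m is 1 with 0 < m < 8, then its fourth power makes m
  even and its square makes m/2 even, so m = 4; but the fourth power of \<open>eta8\<close> is
  -1.\<close>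

lemma inj_eta8_power: "inj_on (\<lambda>k. eta8 ^ k) {..<8}"
proof (rule inj_onI, rule ccontr)
  fix k l :: nat assume *: "k \<in> {..<8}" "l \<in> {..<8}" "eta8 ^ k = eta8 ^ l" "k \<noteq> l"
  have pow: "eta8 ^ m \<noteq> 1" if "0 < m" "m < 8" for m
  proof
    assume m: "eta8 ^ m = 1"
    have 4: "eta8 ^ 4 = -1"
    proof -
      have "eta8 ^ 4 = (eta8\<^sup>2)\<^sup>2" by (simp flip: power_mult)
      then show ?thesis by (simp add: eta8_squared)
    qed
    have "(-1 :: complex) ^ m = (eta8 ^ m) ^ 4"
      unfolding 4[symmetric] by (simp add: mult.commute flip: power_mult)
    then have "even m" by (simp add: m minus_one_power_iff split: if_splits)
    then obtain n where n: "m = 2 * n" by blast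
    have "(-1 :: complex) ^ n = (eta8 ^ m)\<^sup>2"
      unfolding 4[symmetric] n by (simp add: mult.commute flip: power_mult)
    then have "even n" by (simp add: m minus_one_power_iff split: if_splits)
    then have "m = 4" using that n by presburger
    then show False using m 4 by simp
  qed
  have "\<exists>k l. k < l \<and> l < 8 \<and> eta8 ^ k = eta8 ^ l"
    using * by (metis lessThan_iff linorder_neqE_nat)
  then obtain k l where kl: "k < l" "l < 8" "eta8 ^ k = eta8 ^ l" by blast
  then have "eta8 ^ k * eta8 ^ (l - k) = eta8 ^ k * 1"
    unfolding power_add[symmetric] by simp
  then have "eta8 ^ (l - k) = 1"
    using eta8_nonzero by simp
  then show False using pow[of "l - k"] kl by simp
qed

text \<open>Row a determines the frame and the value of the permutation at a. A nonzero entry of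
  that row then gives the product of scalar and diagonal entry, and the normalisation at 00
  separates the two.\<close>

lemma inj_G2_elt: "inj_on G2_elt G2_index"
proof (rule inj_onI)
  fix u v assume uv: "u \<in> G2_index" "v \<in> G2_index" "G2_elt u = G2_elt v"
  obtain k j p d where u: "u = (k, j, p, d)" "k < 8" "j < 15" "p \<in> set perms" "d \<in> set diags"
    using uv(1) unfolding G2_index_def by blast
  obtain k' j' p' d' where v: "v = (k', j', p', d')" "k' < 8" "j' < 15" "p' \<in> set perms" "d' \<in> set diags"
    using uv(2) unfolding G2_index_def by blast
  have eq: "eta8 ^ k * diag_fun d a * frame j $ perm_fun p a $ b
      = eta8 ^ k' * diag_fun d' a * frame j' $ perm_fun p' a $ b" for a b
  proof -
    have "G2_elt u $ a $ b = G2_elt v $ a $ b" using uv(3) by simp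
    then show ?thesis by (simp add: u v elt_def)
  qed
  have ne: "eta8 ^ k * diag_fun d a \<noteq> 0" "eta8 ^ k' * diag_fun d' a \<noteq> 0" for a
    using u v eta8_nonzero diag_fun_nonzero by simp_all
  have jp: "j = j'" "perm_fun p a = perm_fun p' a" for a
    using frame_rows_proportional[OF u(3) v(3) ne eq] by blast+
  have scal: "eta8 ^ k * diag_fun d a = eta8 ^ k' * diag_fun d' a" for a
  proof -
    obtain b where "frame j $ perm_fun p a $ b \<noteq> 0"
      using frame_row_nonzero[OF u(3)] by blast
    then show ?thesis using eq[of a b] jp by simp
  qed
  have "diag_fun x (pt 0) = 1" for x
    by (cases x) (simp add: gi_1)
  with scal[of "pt 0"] have "eta8 ^ k = eta8 ^ k'" by simp
  then have kk: "k = k'" using inj_eta8_power u(2) v(2) by (auto simp: inj_on_def)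
  with scal eta8_nonzero have dd: "diag_fun d a = diag_fun d' a" for a by simp
  have "d = d'"
  proof -
    obtain x y z where d: "d = (x, y, z)" by (cases d)
    obtain x' y' z' where d': "d' = (x', y', z')" by (cases d')
    show ?thesis
      using dd[of "pt 1"] dd[of "pt 2"] dd[of "pt 3"] unfolding d d' diag_fun_pt by simp
  qed
  moreover have "p = p'"
  proof (rule nth_equalityI)
    have len: "length p = 4" "length p' = 4" "\<And>i. i < 4 \<Longrightarrow> p ! i < 4 \<and> p' ! i < 4"
      using u(4) v(4) nth_mem[of _ p] nth_mem[of _ p'] unfolding perms_iff by (auto simp del: nth_mem)
    then show "length p = length p'" by simp
    fix i assume "i < length p"
    then have i: "i < 4" using len by simp
    have "pt (p ! i) = pt (p' ! i)"
      using jp(2)[of "pt i"] i by (simp add: perm_fun_def idx_pt_less)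
    then show "p ! i = p' ! i" using len(3)[OF i] by (simp add: pt_inject)
  qed
  ultimately show "u = v" using u(1) v(1) jp(1) kk by simp
qed

lemma finite_G2_index: "finite G2_index"
  by (simp add: G2_index_def)

lemma card_elts: "card elts = 92160"
proof -
  have "card elts = card G2_index"
    unfolding elts_eq_image by (rule card_image[OF inj_G2_elt])
  also have "\<dots> = 8 * (15 * (24 * 32))"
    unfolding G2_index_def
    by (simp add: card_cartesian_product distinct_card distinct_perms distinct_diags length_perms length_diags)
  finally show ?thesis by simp
qed

lemma finite_elts: "finite elts"
  unfolding elts_eq_image using finite_G2_index by blast

lemma elts_closed_G2:
  assumes "g \<in> G2" "A \<in> diag2 ` elts"
  shows "A ** g \<in> diag2 ` elts"
proof -
  have "\<forall>A \<in> diag2 ` elts. A ** g \<in> diag2 ` elts"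
    using assms(1) unfolding G2_eq_generate
  proof (induction rule: generate.induct)
    case one
    then show ?case by auto
  next
    case (incl h)
    then show ?case using elts_closed_gens by blast
  next
    case (inv h)
    interpret group GL8 by (rule group_GL8)
    have h: "h \<in> carrier GL8" using inv G2_gens_invertible by simp
    have hinv: "h ** inv\<^bsub>GL8\<^esub> h = mat 1" using r_inv[OF h] by simp
    \<comment> \<open>Right multiplication by \<open>h\<close> is an injective self-map of a finite
      set, hence onto, so multiplication by the inverse of \<open>h\<close> preserves the set
      too.\<close>
    have "inj_on (\<lambda>A. A ** h) (diag2 ` elts)"
      by (rule inj_on_inverseI[where g = "\<lambda>B. B ** inv\<^bsub>GL8\<^esub> h"]) (simp add: hinv flip: matrix_mul_assoc)
    moreover have "(\<lambda>A. A ** h) ` (diag2 ` elts) \<subseteq> diag2 ` elts"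
      using elts_closed_gens[OF inv] by blast
    ultimately have surj: "(\<lambda>A. A ** h) ` (diag2 ` elts) = diag2 ` elts"
      by (intro endo_inj_surj finite_imageI finite_elts)
    show ?case
    proof
      fix A assume "A \<in> diag2 ` elts"
      then have "A \<in> (\<lambda>A. A ** h) ` (diag2 ` elts)" by (simp only: surj)
      then obtain B where B: "B \<in> diag2 ` elts" "A = B ** h" by (rule imageE)
      then have "A ** inv\<^bsub>GL8\<^esub> h = B"
        by (simp add: hinv flip: matrix_mul_assoc)
      then show "A ** inv\<^bsub>GL8\<^esub> h \<in> diag2 ` elts" using B by simp
    qed
  next
    case (eng h1 h2)
    then show ?case unfolding mult_GL8 matrix_mul_assoc by blast
  qed
  then show ?thesis using assms(2) by blast
qed

lemma G2_eq: "G2 = diag2 ` elts"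
proof
  show "diag2 ` elts \<subseteq> G2" by (rule elts_subset_G2)
  show "G2 \<subseteq> diag2 ` elts"
  proof
    fix g assume "g \<in> G2"
    moreover have "mat 1 \<in> diag2 ` elts"
      using elts_one diag2_mat[of 1] by (metis imageI)
    ultimately show "g \<in> diag2 ` elts"
      using elts_closed_G2[of g "mat 1"] by simp
  qed
qed

lemma card_G2: "card G2 = 92160"
  unfolding G2_eq by (simp add: card_image[OF inj_on_subset[OF inj_diag2]] card_elts)

interpretation G2: finite_matrix_group G2
proof
  show "finite G2" unfolding G2_eq using finite_elts by blast
  show "mat 1 \<in> G2" by (rule G2_one)
  show "A ** B \<in> G2" if "A \<in> G2" "B \<in> G2" for A B
    using that by (rule G2_mult)
  show "invertible A" if "A \<in> G2" for A
  proof -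
    have "G2_gens \<subseteq> carrier GL8" using G2_gens_invertible by auto
    then have "A \<in> carrier GL8"
      using that group.generate_in_carrier[OF group_GL8, of G2_gens A]
      unfolding G2_eq_generate by blast
    then show ?thesis by simp
  qed
qed

section \<open>Binary words\<close>

definition wadd :: "(nat \<Rightarrow> bit) \<Rightarrow> (nat \<Rightarrow> bit) \<Rightarrow> nat \<Rightarrow> bit" where
  "wadd u v = (\<lambda>i. u i + v i)"

definition wdot :: "nat \<Rightarrow> (nat \<Rightarrow> bit) \<Rightarrow> (nat \<Rightarrow> bit) \<Rightarrow> bit" where
  "wdot n u v = (\<Sum>i=1..n. u i * v i)"

definition bit_sign :: "bit \<Rightarrow> complex" where
  "bit_sign b = (if b = 0 then 1 else - 1)"

lemma bit_add_self [simp]: "x + x = (0 :: bit)"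
  by (cases x) auto

lemma wadd_self [simp]: "wadd u u = (\<lambda>_. 0)"
  by (simp add: wadd_def)

lemma wadd_0 [simp]: "wadd u (\<lambda>_. 0) = u" "wadd (\<lambda>_. 0) u = u"
  by (simp_all only: wadd_def add_0_left add_0_right)

lemma wadd_assoc: "wadd (wadd u v) w = wadd u (wadd v w)"
  by (simp only: wadd_def add.assoc)

lemma wadd_commute: "wadd u v = wadd v u"
  by (simp only: wadd_def add.commute)

lemma wadd_cancel [simp]: "wadd u (wadd u v) = v" "wadd (wadd v u) u = v"
  by (simp_all add: wadd_assoc flip: wadd_assoc[of u u v])

lemma wdot_wadd: "wdot n (wadd u v) w = wdot n u w + wdot n v w"
  by (simp only: wdot_def wadd_def distrib_right sum.distrib)

lemma wdot_commute: "wdot n u v = wdot n v u"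
  unfolding wdot_def by (intro sum.cong refl mult.commute)

lemma wdot_0 [simp]: "wdot n (\<lambda>_. 0) v = 0"
  by (simp add: wdot_def)

lemma bit_sign_add: "bit_sign (x + y) = bit_sign x * bit_sign y"
  by (cases x; cases y) (auto simp: bit_sign_def)

lemma bit_sign_0 [simp]: "bit_sign 0 = 1"
  by (simp add: bit_sign_def)

lemma bit_sign_1 [simp]: "bit_sign 1 = -1"
  by (simp add: bit_sign_def)

lemma bit_sign_sum: "bit_sign (sum f S) = (\<Prod>x\<in>S. bit_sign (f x))"
proof (induction S rule: infinite_finite_induct)
  case (insert x F)
  then show ?case
    by (simp only: sum.insert[OF insert.hyps] prod.insert[OF insert.hyps] bit_sign_add)
qed simp_all

lemma UNIV_bit: "UNIV = {0, 1 :: bit}"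
  using bit.exhaust by auto

lemma sum_bit:
  fixes f :: "bit \<Rightarrow> 'a::comm_monoid_add"
  shows "(\<Sum>y\<in>UNIV. f y) = f 0 + f 1"
  by (simp add: UNIV_bit)

lemma bij_betw_words: "bij_betw (\<lambda>u. restrict u {1..n}) (words n) (PiE {1..n} (\<lambda>_. UNIV))"
proof (rule bij_betw_byWitness[where f' = "\<lambda>g i. if i \<in> {1..n} then g i else 0"])
  show "\<forall>u\<in>words n. (\<lambda>i. if i \<in> {1..n} then restrict u {1..n} i else 0) = u"
    by (auto simp: words_def fun_eq_iff)
  show "\<forall>g\<in>PiE {1..n} (\<lambda>_. UNIV). restrict (\<lambda>i. if i \<in> {1..n} then g i else 0) {1..n} = g"
    by (auto simp: fun_eq_iff PiE_def extensional_def)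
qed (auto simp: words_def)

text \<open>Choosing one of two terms in every coordinate is choosing a word. The Fourier transforms
  over words below all come from this expansion.\<close>

lemma prod_sum_words:
  fixes f :: "nat \<Rightarrow> bit \<Rightarrow> 'a::comm_semiring_1"
  shows "(\<Prod>i=1..n. f i 0 + f i 1) = (\<Sum>v\<in>words n. \<Prod>i=1..n. f i (v i))"
proof -
  have "(\<Prod>i=1..n. f i 0 + f i 1) = (\<Prod>i=1..n. \<Sum>y\<in>UNIV. f i y)"
    by (simp add: sum_bit)
  also have "\<dots> = (\<Sum>g\<in>PiE {1..n} (\<lambda>_. UNIV). \<Prod>i=1..n. f i (g i))"
    by (rule prod_sum_PiE) auto
  also have "\<dots> = (\<Sum>v\<in>words n. \<Prod>i=1..n. f i (restrict v {1..n} i))"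
    by (rule sum.reindex_bij_betw[OF bij_betw_words, symmetric])
  also have "\<dots> = (\<Sum>v\<in>words n. \<Prod>i=1..n. f i (v i))"
    by (intro sum.cong prod.cong) auto
  finally show ?thesis .
qed

lemma finite_words: "finite (words n)"
  using bij_betw_finite[OF bij_betw_words] by (simp add: finite_PiE)

lemma words_wadd: "u \<in> words n \<Longrightarrow> v \<in> words n \<Longrightarrow> wadd u v \<in> words n"
  by (simp add: words_def wadd_def)

lemma words_0: "(\<lambda>_. 0) \<in> words n"
  by (simp add: words_def)

section \<open>Linear codes\<close>

lemma linear_code_iff:
  "binary_linear_code n D \<longleftrightarrow> D \<subseteq> words n \<and> (\<lambda>_. 0) \<in> D \<and> (\<forall>u\<in>D. \<forall>v\<in>D. wadd u v \<in> D)"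
proof -
  have "(\<lambda>i. c * u i) \<in> D" if "u \<in> D" "(\<lambda>_. 0) \<in> D" for c u
  proof (cases "c = 0")
    case False
    then have "(\<lambda>i. c * u i) = u" by (simp only: bit_not_zero_iff mult_1_left)
    then show ?thesis using that by simp
  qed (use that in simp)
  then show ?thesis unfolding binary_linear_code_def wadd_def by blast
qed

lemma dual_code_iff: "v \<in> dual_code n D \<longleftrightarrow> v \<in> words n \<and> (\<forall>u\<in>D. wdot n u v = 0)"
  by (simp add: dual_code_def wdot_def)

lemma finite_code: "binary_linear_code n D \<Longrightarrow> finite D"
  unfolding linear_code_iff using finite_subset finite_words by blast

lemma bij_betw_wadd:
  assumes "binary_linear_code n D" "u \<in> D"
  shows "bij_betw (wadd u) D D"
  using assms unfolding linear_code_iff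
  by (intro bij_betw_byWitness[where f' = "wadd u"]) auto

text \<open>If v is not in the dual, some u0 in D has inner product 1 with v, and translating the
  sum by u0 reverses its sign.\<close>

lemma sum_character:
  assumes D: "binary_linear_code n D" and v: "v \<in> words n"
  shows "(\<Sum>u\<in>D. bit_sign (wdot n u v)) = (if v \<in> dual_code n D then of_nat (card D) else 0)"
proof (cases "v \<in> dual_code n D")
  case True
  then show ?thesis by (simp add: dual_code_iff)
next
  case False
  then obtain u0 where u0: "u0 \<in> D" "wdot n u0 v = 1"
    using v by (auto simp: dual_code_iff)
  have "(\<Sum>u\<in>D. bit_sign (wdot n u v)) = (\<Sum>u\<in>D. bit_sign (wdot n (wadd u0 u) v))"
    by (rule sum.reindex_bij_betw[OF bij_betw_wadd[OF D u0(1)], symmetric])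
  also have "\<dots> = - (\<Sum>u\<in>D. bit_sign (wdot n u v))"
    by (simp only: wdot_wadd u0(2) bit_sign_add bit_sign_1 mult_minus1 sum_negf)
  finally show ?thesis using False by simp
qed

text \<open>The double sum of characters over D and all words is evaluated in both orders: summing
  over D first leaves the dual code, summing over all words first leaves only u = 0.\<close>

lemma card_dual_code:
  assumes D: "binary_linear_code n D"
  shows "card D * card (dual_code n D) = 2 ^ n"
proof -
  have sub: "dual_code n D \<subseteq> words n" by (auto simp: dual_code_iff)
  have "of_nat (card D * card (dual_code n D))
      = (\<Sum>v\<in>words n. if v \<in> dual_code n D then of_nat (card D) else (0::complex))"
    using sub finite_words by (simp add: sum.If_cases Int_absorb1 mult.commute)
  also have "\<dots> = (\<Sum>v\<in>words n. \<Sum>u\<in>D. bit_sign (wdot n u v))"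
    by (intro sum.cong refl) (simp add: sum_character[OF D])
  also have "\<dots> = (\<Sum>u\<in>D. \<Sum>v\<in>words n. bit_sign (wdot n u v))"
    by (rule sum.swap)
  also have "\<dots> = (\<Sum>u\<in>D. if u = (\<lambda>_. 0) then 2 ^ n else 0)"
  proof (intro sum.cong refl)
    fix u assume u: "u \<in> D"
    have "(\<Sum>v\<in>words n. bit_sign (wdot n u v)) = (\<Prod>i=1..n. bit_sign (u i * 0) + bit_sign (u i * 1))"
      unfolding wdot_def bit_sign_sum by (rule prod_sum_words[symmetric])
    also have "\<dots> = (if u = (\<lambda>_. 0) then 2 ^ n else 0)"
    proof (cases "u = (\<lambda>_. 0)")
      case False
      then obtain i where "u i \<noteq> 0" by (metis ext)
      moreover have "i \<in> {1..n}"
        using u D \<open>u i \<noteq> 0\<close> unfolding linear_code_iff words_def by blast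
      moreover have "bit_sign (u i * 0) + bit_sign (u i * 1) = 0"
        using \<open>u i \<noteq> 0\<close> by (cases "u i") auto
      ultimately show ?thesis using False by (auto intro!: prod_zero bexI[of _ i])
    qed simp
    finally show "(\<Sum>v\<in>words n. bit_sign (wdot n u v)) = (if u = (\<lambda>_. 0) then 2 ^ n else 0)" .
  qed
  also have "\<dots> = 2 ^ n"
    using D finite_code[OF D] by (simp add: linear_code_iff)
  finally have "of_nat (card D * card (dual_code n D)) = (of_nat (2 ^ n) :: complex)" by simp
  then show ?thesis by (simp only: of_nat_eq_iff)
qed

lemma weight_wadd:
  "weight n (wadd u v) + 2 * card {i \<in> {1..n}. u i \<noteq> 0 \<and> v i \<noteq> 0} = weight n u + weight n v"
proof -
  let ?a = "{i \<in> {1..n}. u i \<noteq> 0 \<and> v i = 0}" and ?b = "{i \<in> {1..n}. u i = 0 \<and> v i \<noteq> 0}"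
    and ?c = "{i \<in> {1..n}. u i \<noteq> 0 \<and> v i \<noteq> 0}"
  have "{i \<in> {1..n}. u i \<noteq> 0} = ?a \<union> ?c" "{i \<in> {1..n}. v i \<noteq> 0} = ?b \<union> ?c" by auto
  moreover have "{i \<in> {1..n}. wadd u v i \<noteq> 0} = ?a \<union> ?b"
  proof -
    have "u i + v i \<noteq> 0 \<longleftrightarrow> (u i \<noteq> 0 \<and> v i = 0) \<or> (u i = 0 \<and> v i \<noteq> 0)" for i
      by (cases "u i"; cases "v i") auto
    then show ?thesis by (auto simp: wadd_def)
  qed
  moreover have "card (?a \<union> ?c) = card ?a + card ?c" "card (?b \<union> ?c) = card ?b + card ?c"
    "card (?a \<union> ?b) = card ?a + card ?b"
    by (rule card_Un_disjoint; auto)+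
  ultimately show ?thesis by (simp add: weight_def)
qed

lemma wdot_eq_0_iff: "wdot n u v = 0 \<longleftrightarrow> even (card {i \<in> {1..n}. u i \<noteq> 0 \<and> v i \<noteq> 0})"
proof -
  have "u i * v i = (if u i \<noteq> 0 \<and> v i \<noteq> 0 then 1 else 0)" for i
    by (cases "u i"; cases "v i") auto
  then have "wdot n u v = of_nat (card {i \<in> {1..n}. u i \<noteq> 0 \<and> v i \<noteq> 0})"
    unfolding wdot_def by (simp only: sum.inter_filter[symmetric] finite_atLeastAtMost) simp
  moreover have "(of_nat k :: bit) = 0 \<longleftrightarrow> even k" for k
    by (induction k) auto
  ultimately show ?thesis by simp
qed

definition doubly_even :: "nat \<Rightarrow> (nat \<Rightarrow> bit) set \<Rightarrow> bool" where
  "doubly_even n D \<longleftrightarrow> binary_linear_code n D \<and> (\<forall>u\<in>D. 4 dvd weight n u)"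

text \<open>The weight of u + v is the sum of the weights minus twice the size of the common
  support, which is therefore even.\<close>

lemma doubly_even_orthogonal:
  assumes "4 dvd weight n u" "4 dvd weight n v" "4 dvd weight n (wadd u v)"
  shows "wdot n u v = 0"
proof -
  have "even k" if "4 dvd x" "4 dvd y" "4 dvd z" "z + 2 * k = x + y" for x y z k :: nat
    using that by presburger
  from this[OF assms weight_wadd] show ?thesis unfolding wdot_eq_0_iff .
qed

lemma doubly_even_wadd:
  assumes "4 dvd weight n u" "4 dvd weight n v" "wdot n u v = 0"
  shows "4 dvd weight n (wadd u v)"
proof -
  have "4 dvd z" if "4 dvd x" "4 dvd y" "even k" "z + 2 * k = x + y" for x y z k :: nat
    using that by presburger
  from this[OF assms(1,2) assms(3)[unfolded wdot_eq_0_iff] weight_wadd] show ?thesis .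
qed

lemma doubly_even_subset_dual: "doubly_even n D \<Longrightarrow> D \<subseteq> dual_code n D"
  unfolding doubly_even_def linear_code_iff subset_iff dual_code_iff
  by (meson doubly_even_orthogonal)

definition adjoin :: "(nat \<Rightarrow> bit) set \<Rightarrow> (nat \<Rightarrow> bit) \<Rightarrow> (nat \<Rightarrow> bit) set" where
  "adjoin D v = D \<union> wadd v ` D"

lemma linear_adjoin:
  assumes "binary_linear_code n D" "v \<in> words n"
  shows "binary_linear_code n (adjoin D v)"
proof -
  have D: "D \<subseteq> words n" "(\<lambda>_. 0) \<in> D" "\<And>u w. u \<in> D \<Longrightarrow> w \<in> D \<Longrightarrow> wadd u w \<in> D"
    using assms(1) unfolding linear_code_iff by blast+
  have 1: "wadd (wadd v u) w = wadd v (wadd u w)" for u w by (rule wadd_assoc)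
  have 2: "wadd u (wadd v w) = wadd v (wadd u w)" for u w
    by (simp only: wadd_def add.left_commute)
  have "wadd x y \<in> adjoin D v" if "x \<in> adjoin D v" "y \<in> adjoin D v" for x y
    using that unfolding adjoin_def
    by (elim UnE imageE) (simp_all only: 1 2 wadd_cancel D(3) UnI1 UnI2 imageI)
  moreover have "adjoin D v \<subseteq> words n"
    using D(1) assms(2) words_wadd unfolding adjoin_def by blast
  moreover have "(\<lambda>_. 0) \<in> adjoin D v" using D(2) by (simp add: adjoin_def)
  ultimately show ?thesis unfolding linear_code_iff by blast
qed

lemma doubly_even_adjoin:
  assumes "doubly_even n D" "v \<in> dual_code n D" "4 dvd weight n v"
  shows "doubly_even n (adjoin D v)"
proof -
  have "v \<in> words n" using assms(2) by (simp add: dual_code_iff)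
  then have "binary_linear_code n (adjoin D v)"
    using assms(1) linear_adjoin unfolding doubly_even_def by blast
  moreover have "4 dvd weight n (wadd v u)" if "u \<in> D" for u
    using that assms by (intro doubly_even_wadd) (auto simp: doubly_even_def dual_code_iff wdot_commute)
  ultimately show ?thesis
    using assms(1) unfolding doubly_even_def adjoin_def by auto
qed

section \<open>The action on word monomials\<close>

definition bvec :: "bit \<Rightarrow> bit \<Rightarrow> bit ^ 2" where
  "bvec x y = (\<chi> k. if k = 1 then x else y)"

definition side :: "nat set \<Rightarrow> nat \<Rightarrow> bit ^ 2 \<Rightarrow> var" where
  "side T i a = (if i \<in> T then Inr a else Inl a)"

text \<open>The factors are indexed by coordinates, so the same monomial may come from several
  choices of \<open>T\<close>, \<open>u\<close> and \<open>v\<close>. In return, substitutions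
  become operations on pairs of words.\<close>

definition word_monom :: "nat \<Rightarrow> nat set \<Rightarrow> (nat \<Rightarrow> bit) \<Rightarrow> (nat \<Rightarrow> bit) \<Rightarrow> cpoly" where
  "word_monom n T u v = (\<Prod>i=1..n. var_poly (side T i (bvec (u i) (v i))))"

lemma bvec_nth [simp]: "bvec x y $ 1 = x" "bvec x y $ 2 = y"
  by (simp_all add: bvec_def)

lemma bvec_eq_iff: "bvec x y = a \<longleftrightarrow> x = a $ 1 \<and> y = a $ 2"
  unfolding Finite_Cartesian_Product.vec_eq_iff forall_2 bvec_nth ..

lemma bvec_surj: "bvec (a $ 1) (a $ 2) = a"
  by (simp add: bvec_eq_iff)

lemma jacobi_poly_eq:
  assumes "T \<subseteq> {1..n}"
  shows "jacobi_poly n C T = (\<Sum>(u, v)\<in>C \<times> C. word_monom n T u v)"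
  unfolding jacobi_poly_def
proof (intro sum.cong refl, clarify)
  fix u v :: "nat \<Rightarrow> bit"
  have group: "(\<Prod>a\<in>UNIV. f a ^ pair_count a X u v) = (\<Prod>i\<in>X. f (bvec (u i) (v i)))"
    if "finite X" for f :: "bit ^ 2 \<Rightarrow> cpoly" and X
  proof -
    have "(\<Prod>a\<in>UNIV. f a ^ pair_count a X u v)
        = (\<Prod>a\<in>UNIV. \<Prod>i\<in>{i \<in> X. bvec (u i) (v i) = a}. f (bvec (u i) (v i)))"
      unfolding pair_count_def bvec_eq_iff[symmetric] by (intro prod.cong refl) simp
    also have "\<dots> = (\<Prod>i\<in>X. f (bvec (u i) (v i)))"
      by (rule prod.group[OF that finite_class.finite_UNIV]) simp
    finally show ?thesis .
  qed
  have fin: "finite T" using assms finite_subset by blast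
  have "(\<Prod>a\<in>UNIV. var_poly (Inr a) ^ pair_count a T u v * var_poly (Inl a) ^ pair_count a ({1..n} - T) u v)
      = (\<Prod>i\<in>T. var_poly (Inr (bvec (u i) (v i)))) * (\<Prod>i\<in>{1..n} - T. var_poly (Inl (bvec (u i) (v i))))"
    by (simp add: prod.distrib group fin)
  also have "\<dots> = (\<Prod>i\<in>T. var_poly (side T i (bvec (u i) (v i)))) * (\<Prod>i\<in>{1..n} - T. var_poly (side T i (bvec (u i) (v i))))"
    by (intro arg_cong2[where f = "(*)"] prod.cong) (auto simp: side_def)
  also have "\<dots> = word_monom n T u v"
    unfolding word_monom_def using prod.subset_diff[OF assms, of "\<lambda>i. var_poly (side T i (bvec (u i) (v i)))"]
    by (simp add: mult.commute)
  finally show "(\<Prod>a\<in>UNIV. var_poly (Inr a) ^ pair_count a T u v * var_poly (Inl a) ^ pair_count a ({1..n} - T) u v)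
      = word_monom n T u v" .
qed

lemma lin_form_side: "lin_form (diag2 A) (side T i a) = (\<Sum>b\<in>UNIV. const_poly (A $ a $ b) * var_poly (side T i b))"
  by (simp add: lin_form_def side_def sum_var)

lemma act_word_monom:
  "act (diag2 A) (word_monom n T u v)
    = (\<Prod>i=1..n. \<Sum>b\<in>UNIV. const_poly (A $ bvec (u i) (v i) $ b) * var_poly (side T i b))"
  by (simp add: word_monom_def act_prod act_var lin_form_side)

lemma homogeneous_word_monom: "homogeneous n (word_monom n T u v)"
  using homogeneous_prod[of "{1..n}" "\<lambda>_. 1" "\<lambda>i. var_poly (side T i (bvec (u i) (v i)))"] homogeneous_var
  by (simp add: word_monom_def)

text \<open>Word monomials are eigenvectors of \<open>E2\<close>; averaging over the group therefore
  kills those whose second word has weight not divisible by 4.\<close>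

lemma act_E2_word_monom:
  "act (diag2 E2) (word_monom n T u v) = const_poly (\<i> ^ weight n v) * word_monom n T u v"
proof -
  have row: "(\<Sum>b\<in>UNIV. const_poly (E2 $ a $ b) * var_poly (side T i b))
      = const_poly (if a $ 2 = 1 then \<i> else 1) * var_poly (side T i a)" for a i
  proof -
    have "(\<Sum>b\<in>UNIV. const_poly (E2 $ a $ b) * var_poly (side T i b))
        = (\<Sum>b\<in>UNIV. if b = a then const_poly (if a $ 2 = 1 then \<i> else 1) * var_poly (side T i a) else 0)"
      unfolding E2_def by (intro sum.cong refl) auto
    then show ?thesis by simp
  qed
  have "(\<Prod>i=1..n. if v i = 1 then \<i> else 1) = \<i> ^ weight n v"
    by (simp add: weight_def prod.If_cases Int_def)
  then show ?thesis
    unfolding act_word_monom row bvec_nth prod.distrib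
    unfolding word_monom_def const_poly_prod[symmetric] by simp
qed

lemma act_perm_word_monom:
  "act (diag2 (affine_matrix \<sigma>)) (word_monom n T u v)
    = word_monom n T (\<lambda>i. \<sigma> (bvec (u i) (v i)) $ 1) (\<lambda>i. \<sigma> (bvec (u i) (v i)) $ 2)"
proof -
  have "(\<Sum>b\<in>UNIV. const_poly (affine_matrix \<sigma> $ a $ b) * var_poly (side T i b)) = var_poly (side T i (\<sigma> a))" for a i
  proof -
    have "(\<Sum>b\<in>UNIV. const_poly (affine_matrix \<sigma> $ a $ b) * var_poly (side T i b))
        = (\<Sum>b\<in>UNIV. if b = \<sigma> a then var_poly (side T i b) else 0)"
      unfolding affine_matrix_def by (intro sum.cong refl) auto
    then show ?thesis by simp
  qed
  then show ?thesis unfolding act_word_monom by (simp add: word_monom_def bvec_surj)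
qed

text \<open>The scalar \<open>kappa\<close> is the one that comes with the Hadamard transform of the second bit in the
  product \<open>E\<^sub>2 T\<^sub>2 E\<^sub>2 T\<^sub>2 E\<^sub>2\<close>.\<close>

definition kappa :: complex where
  "kappa = - (1 + \<i>) / 2"

definition H2 :: cmat4 where
  "H2 = (\<chi> a b. if a $ 1 = b $ 1 then kappa * bit_sign (a $ 2 * b $ 2) else 0)"

definition swap_bits :: "bit ^ 2 \<Rightarrow> bit ^ 2" where
  "swap_bits a = bvec (a $ 2) (a $ 1)"

lemma cmat4_eqI:
  assumes "\<forall>a b. (A :: cmat4) $ a $ b = B $ a $ b"
  shows "A = B"
  using assms by (simp add: Finite_Cartesian_Product.vec_eq_iff)

lemma matrix_mult_nth: "(A ** B) $ a $ b = (\<Sum>k\<in>UNIV. A $ a $ k * B $ k $ b)"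
  by (simp add: matrix_matrix_mult_def)

lemma T2_nth: "T2 $ a $ b = \<i> / 2 * bit_sign (a $ 1 * b $ 1) * bit_sign (a $ 2 * b $ 2)"
proof -
  have sq: "((1 + \<i>) / 2)\<^sup>2 = \<i> / 2"
    by (simp add: power2_eq_square algebra_simps)
  show ?thesis
    unfolding T2_def sq
    by (cases "a $ 1"; cases "b $ 1"; cases "a $ 2"; cases "b $ 2") (simp_all add: sum_2)
qed

lemma kappa_squared: "kappa\<^sup>2 = \<i> / 2"
  by (simp add: kappa_def power2_eq_square field_simps)

lemma E2_mult_nth: "(E2 ** A) $ a $ b = (if a $ 2 = 1 then \<i> else 1) * A $ a $ b"
proof -
  have "(E2 ** A) $ a $ b = (\<Sum>k\<in>UNIV. if k = a then (if a $ 2 = 1 then \<i> else 1) * A $ a $ b else 0)"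
    by (simp only: matrix_matrix_mult_def E2_def vec_lambda_beta) (intro sum.cong, auto)
  then show ?thesis by simp
qed

lemma mult_E2_nth: "(A ** E2) $ a $ b = A $ a $ b * (if b $ 2 = 1 then \<i> else 1)"
proof -
  have "(A ** E2) $ a $ b = (\<Sum>k\<in>UNIV. if k = b then A $ a $ b * (if b $ 2 = 1 then \<i> else 1) else 0)"
    by (simp only: matrix_matrix_mult_def E2_def vec_lambda_beta) (intro sum.cong, auto)
  then show ?thesis by simp
qed

text \<open>Let H be the 2 by 2 sign matrix and S = diag(1, i). Then \<open>T2\<close> is i/2 times
  the tensor product of H with H, and \<open>E2\<close> is S on the second bit. On the first bit H
  occurs twice and gives 2, on the second S H S H S = (1 + i) H, and the scalars multiply to
  \<open>kappa\<close>.\<close>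

lemma H2_eq: "H2 = E2 ** (T2 ** (E2 ** (T2 ** E2)))"
proof (rule cmat4_eqI)
  have *: "(T2 ** (E2 ** (T2 ** E2))) $ a $ b
      = (\<Sum>k\<in>UNIV. T2 $ a $ k * ((if k $ 2 = 1 then \<i> else 1) * (T2 $ k $ b * (if b $ 2 = 1 then \<i> else 1))))" for a b
    unfolding matrix_mult_nth[of T2 "E2 ** _"] E2_mult_nth mult_E2_nth ..
  show "\<forall>a b. H2 $ a $ b = (E2 ** (T2 ** (E2 ** (T2 ** E2)))) $ a $ b"
    unfolding all_pt E2_mult_nth *
    by (simp add: H2_def T2_nth sum_pt kappa_def field_simps)
qed

text \<open>Conjugating \<open>H2\<close> by the exchange of the bits transforms the first bit. The
  two together transform both bits, with scalar \<open>kappa\<close> squared, which is the i/2 of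
  \<open>T2\<close>.\<close>

lemma T2_eq_H2: "T2 = H2 ** (affine_matrix swap_bits ** (H2 ** affine_matrix swap_bits))"
proof (rule cmat4_eqI)
  have inv: "swap_bits (swap_bits a) = a" for a by (simp add: swap_bits_def bvec_eq_iff)
  have 1: "(A ** affine_matrix swap_bits) $ a $ b = A $ a $ swap_bits b" for A :: cmat4 and a b
  proof -
    have "(A ** affine_matrix swap_bits) $ a $ b = (\<Sum>k\<in>UNIV. if k = swap_bits b then A $ a $ k else 0)"
      by (simp only: matrix_matrix_mult_def affine_matrix_def vec_lambda_beta) (intro sum.cong, auto simp: inv)
    then show ?thesis by simp
  qed
  have 2: "(affine_matrix swap_bits ** A) $ a $ b = A $ swap_bits a $ b" for A :: cmat4 and a b
  proof -
    have "(affine_matrix swap_bits ** A) $ a $ b = (\<Sum>k\<in>UNIV. if k = swap_bits a then A $ k $ b else 0)"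
      by (simp only: matrix_matrix_mult_def affine_matrix_def vec_lambda_beta) (intro sum.cong, auto)
    then show ?thesis by simp
  qed
  have "(H2 ** (affine_matrix swap_bits ** (H2 ** affine_matrix swap_bits))) $ a $ b
      = (\<Sum>k\<in>UNIV. H2 $ a $ k * H2 $ swap_bits k $ swap_bits b)" for a b
    unfolding matrix_mult_nth[of H2 "_ ** _"] 2 1 ..
  then show "\<forall>a b. T2 $ a $ b = (H2 ** (affine_matrix swap_bits ** (H2 ** affine_matrix swap_bits))) $ a $ b"
    unfolding all_pt
    by (simp add: H2_def T2_nth sum_pt swap_bits_def kappa_squared[unfolded power2_eq_square] field_simps)
qed

lemma swap_bits_permutes: "swap_bits permutes UNIV"
proof -
  have "swap_bits (swap_bits a) = a" for a by (simp add: swap_bits_def bvec_eq_iff)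
  then have "inj swap_bits" by (metis injI)
  then show ?thesis
    by (simp add: permutes_univ bij_def finite_UNIV_inj_surj bij_iff[symmetric])
qed

lemma G2_H2: "diag2 H2 \<in> G2"
  unfolding H2_eq by (intro G2_diag2_mult G2_T2 G2_E2)

text \<open>The product over coordinates expands into the discrete Fourier transform in the second
  word. The first word is untouched, since \<open>H2\<close> preserves the first bit.\<close>

lemma act_H2_word_monom:
  "act (diag2 H2) (word_monom n T u v)
    = const_poly (kappa ^ n) * (\<Sum>w\<in>words n. const_poly (bit_sign (wdot n v w)) * word_monom n T u w)"
proof -
  let ?f = "\<lambda>i y. const_poly (kappa * bit_sign (v i * y)) * var_poly (side T i (bvec (u i) y))"
  have UNIV: "(UNIV :: (bit ^ 2) set) = {bvec 0 0, bvec 0 1, bvec 1 0, bvec 1 1}"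
  proof -
    have "a \<in> {bvec 0 0, bvec 0 1, bvec 1 0, bvec 1 1}" for a
      using bvec_surj[of a] bit.exhaust[of "a $ 1"] bit.exhaust[of "a $ 2"] by (metis insertCI)
    then show ?thesis by blast
  qed
  have row: "(\<Sum>b\<in>UNIV. const_poly (H2 $ bvec (u i) (v i) $ b) * var_poly (side T i b)) = ?f i 0 + ?f i 1" for i
    unfolding UNIV by (cases "u i") (simp_all add: bvec_eq_iff H2_def)
  have "act (diag2 H2) (word_monom n T u v) = (\<Sum>w\<in>words n. \<Prod>i=1..n. ?f i (w i))"
    unfolding act_word_monom row by (rule prod_sum_words)
  also have "\<dots> = (\<Sum>w\<in>words n. const_poly (kappa ^ n) * (const_poly (bit_sign (wdot n v w)) * word_monom n T u w))"
    unfolding wdot_def bit_sign_sum word_monom_def const_poly_prod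
    by (intro sum.cong refl) (simp only: prod.distrib const_poly_mult prod_constant card_atLeastAtMost
        const_poly_power diff_Suc_1 mult.assoc)
  finally show ?thesis by (simp add: sum_distrib_left)
qed

lemma act_swap_word_monom: "act (diag2 (affine_matrix swap_bits)) (word_monom n T u v) = word_monom n T v u"
  by (simp add: act_perm_word_monom swap_bits_def)

text \<open>Adds the second word of a pair to the first; together with the exchange of the words
  this generates GL(2, F_2).\<close>

definition shear :: "bit ^ 2 \<Rightarrow> bit ^ 2" where
  "shear a = bvec (a $ 1 + a $ 2) (a $ 2)"

lemma shear_permutes: "shear permutes UNIV"
proof -
  have "shear (shear a) = a" for a by (cases "a $ 1"; cases "a $ 2") (simp_all add: shear_def bvec_eq_iff)
  then have "inj shear" by (metis injI)
  then show ?thesis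
    by (simp add: permutes_univ bij_def finite_UNIV_inj_surj bij_iff[symmetric])
qed

lemma act_shear_word_monom: "act (diag2 (affine_matrix shear)) (word_monom n T u v) = word_monom n T (wadd u v) v"
  unfolding act_perm_word_monom shear_def bvec_nth wadd_def ..

section \<open>Jacobi polynomials are invariant\<close>

lemma kappa_power_8: "kappa ^ 8 = 1 / 16"
proof -
  have "kappa ^ 8 = (kappa\<^sup>2) ^ 4" by (simp flip: power_mult)
  then show ?thesis by (simp add: kappa_squared power_divide power4_eq_xxxx)
qed

lemma type_II_dual: "type_II n C \<Longrightarrow> dual_code n C = C"
  by (simp add: type_II_def)

lemma jacobi_poly_sum:
  "T \<subseteq> {1..n} \<Longrightarrow> jacobi_poly n C T = (\<Sum>u\<in>C. \<Sum>v\<in>C. word_monom n T u v)"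
  by (simp add: jacobi_poly_eq sum.cartesian_product)

text \<open>This is the MacWilliams identity in the second word: summing characters over the
  self-dual C leaves exactly the words of C, each with the factor \<open>card C\<close>.\<close>

lemma act_H2_jacobi_poly:
  assumes "type_II n C" "T \<subseteq> {1..n}"
  shows "act (diag2 H2) (jacobi_poly n C T) = const_poly (kappa ^ n * of_nat (card C)) * jacobi_poly n C T"
proof -
  have C: "binary_linear_code n C" "C \<subseteq> words n" and dual: "dual_code n C = C"
    using assms(1) by (auto simp: type_II_def binary_linear_code_def)
  have "(\<Sum>v\<in>C. \<Sum>w\<in>words n. const_poly (bit_sign (wdot n v w)) * word_monom n T u w)
      = (\<Sum>w\<in>words n. const_poly (\<Sum>v\<in>C. bit_sign (wdot n v w)) * word_monom n T u w)" for u
    by (subst sum.swap) (simp add: const_poly_sum sum_distrib_right)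
  also have "\<dots> u = (\<Sum>w\<in>words n. if w \<in> C then const_poly (of_nat (card C)) * word_monom n T u w else 0)" for u
    by (intro sum.cong refl) (simp add: sum_character[OF C(1)] dual)
  also have "\<dots> u = const_poly (of_nat (card C)) * (\<Sum>w\<in>C. word_monom n T u w)" for u
    using C(2) finite_words by (simp add: sum.If_cases Int_absorb1 sum_distrib_left)
  finally have "(\<Sum>v\<in>C. \<Sum>w\<in>words n. const_poly (bit_sign (wdot n v w)) * word_monom n T u w)
    = const_poly (of_nat (card C)) * (\<Sum>w\<in>C. word_monom n T u w)" for u .
  then show ?thesis
    by (simp add: jacobi_poly_sum[OF assms(2)] act_sum act_H2_word_monom const_poly_mult mult.assoc
        flip: sum_distrib_left)
qed

lemma act_E2_jacobi_poly:
  assumes "type_II n C" "T \<subseteq> {1..n}"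
  shows "act (diag2 E2) (jacobi_poly n C T) = jacobi_poly n C T"
proof -
  have "\<i> ^ weight n v = 1" if "v \<in> C" for v
    using that assms(1) by (auto simp: type_II_def power_mult power4_eq_xxxx elim!: dvdE)
  then show ?thesis
    by (simp add: jacobi_poly_sum[OF assms(2)] act_sum act_E2_word_monom)
qed

lemma act_swap_jacobi_poly:
  assumes "T \<subseteq> {1..n}"
  shows "act (diag2 (affine_matrix swap_bits)) (jacobi_poly n C T) = jacobi_poly n C T"
  unfolding jacobi_poly_sum[OF assms] act_sum act_swap_word_monom by (rule sum.swap)

text \<open>The coefficient at the monomial of the pair (0, 0) counts the pairs with that monomial,
  so it is positive. Scalars by which two group elements act can then be compared.\<close>

lemma coef_jacobi_poly_nonzero:
  assumes "type_II n C" "T \<subseteq> {1..n}"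
  shows "jacobi_poly n C T \<noteq> 0"
proof -
  have C: "finite C" "(\<lambda>_. 0) \<in> C"
    using assms(1) finite_code by (auto simp: type_II_def linear_code_iff)
  define e where "e u v = (\<Sum>i=1..n. Poly_Mapping.single (side T i (bvec (u i) (v i))) (1::nat))" for u v
  have mono: "word_monom n T u v = pmono (e u v)" for u v
  proof -
    have "(\<Prod>i\<in>S. pmono (f i)) = pmono (sum f S)" for f and S :: "nat set"
      by (induction S rule: infinite_finite_induct) (simp_all add: pmono_add)
    from this[of "\<lambda>i. Poly_Mapping.single (side T i (bvec (u i) (v i))) 1" "{1..n}"] show ?thesis
      by (simp add: word_monom_def e_def var_poly_def pmono_def)
  qed
  let ?m = "e (\<lambda>_. 0) (\<lambda>_. 0)"
  have "coef (jacobi_poly n C T) ?m = of_nat (card {p \<in> C \<times> C. e (fst p) (snd p) = ?m})"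
    using C(1) by (simp add: jacobi_poly_eq[OF assms(2)] lookup_sum mono coef_pmono case_prod_beta
        sum.If_cases Int_def)
  moreover have "card {p \<in> C \<times> C. e (fst p) (snd p) = ?m} \<noteq> 0"
  proof -
    have fin: "finite {p \<in> C \<times> C. e (fst p) (snd p) = ?m}" using C(1) by simp
    have "((\<lambda>_. 0), (\<lambda>_. 0)) \<in> {p \<in> C \<times> C. e (fst p) (snd p) = ?m}" using C(2) by simp
    then show ?thesis unfolding card_0_eq[OF fin] by blast
  qed
  ultimately show ?thesis by auto
qed

lemma const_poly_mult_eq_iff:
  assumes "f \<noteq> 0" "const_poly a * f = const_poly b * f"
  shows "a = b"
proof -
  obtain m where "coef f m \<noteq> 0"
    using assms(1) by (metis lookup_zero poly_mapping_eqI)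
  moreover have "coef (const_poly a * f) m = coef (const_poly b * f) m" using assms(2) by simp
  ultimately show ?thesis by simp
qed

text \<open>The transform \<open>H\<^sub>2\<close> scales the Jacobi polynomial by some \<open>\<mu>\<close>. Writing \<open>T\<^sub>2\<close> as a product with
  two factors \<open>H\<^sub>2\<close> and \<open>H\<^sub>2\<close> as one with two factors \<open>T\<^sub>2\<close> gives \<open>\<mu> = \<mu>\<^sup>4\<close>.\<close>
lemma type_II_length:
  assumes "type_II n C"
  shows "8 dvd n" "kappa ^ n * of_nat (card C) = 1"
proof -
  let ?J = "jacobi_poly n C {}"
  define \<mu> where "\<mu> = kappa ^ n * of_nat (card C)"
  have T: "{} \<subseteq> {1..n}" by simp
  note H = act_H2_jacobi_poly[OF assms T, folded \<mu>_def] and E = act_E2_jacobi_poly[OF assms T]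
    and P = act_swap_jacobi_poly[OF T, of C]
  have T2: "act (diag2 T2) ?J = const_poly (\<mu>\<^sup>2) * ?J"
    unfolding T2_eq_H2 diag2_mult act_act[symmetric]
    by (simp add: H P act_const_mult const_poly_mult power2_eq_square mult.assoc)
  have "act (diag2 H2) ?J = const_poly (\<mu> ^ 4) * ?J"
    unfolding H2_eq diag2_mult act_act[symmetric]
    by (simp add: E T2 act_const_mult const_poly_mult mult.assoc[symmetric] const_poly_mult[symmetric]
        flip: power_add)
  then have "const_poly (\<mu> ^ 4) * ?J = const_poly \<mu> * ?J" using H by simp
  then have quart: "\<mu> ^ 4 = \<mu>"
    using const_poly_mult_eq_iff coef_jacobi_poly_nonzero[OF assms T] by blast
  have C: "binary_linear_code n C" "dual_code n C = C"
    using assms by (auto simp: type_II_def)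
  have card: "card C * card C = 2 ^ n"
    using card_dual_code[OF C(1)] C(2) by simp
  have "kappa \<noteq> 0" using kappa_power_8 by auto
  moreover have "card C \<noteq> 0" using card by (cases "card C = 0") simp_all
  ultimately have ne: "\<mu> \<noteq> 0" by (simp add: \<mu>_def)
  have "\<mu> * \<mu> ^ 3 = \<mu> * 1" using quart by (simp flip: power_Suc)
  then have cube: "\<mu> ^ 3 = 1" by (rule mult_left_cancel[OF ne, THEN iffD1])
  have "\<mu>\<^sup>2 = (kappa\<^sup>2) ^ n * of_nat (card C * card C)"
    by (simp add: \<mu>_def power_mult_distrib power2_eq_square mult_ac)
  also have "\<dots> = \<i> ^ n"
    by (simp add: card kappa_squared power_divide)
  finally have sq: "\<mu>\<^sup>2 = \<i> ^ n" .
  \<comment> \<open>Since \<mu> is both a cube root and an eighth root of unity, it is 1.\<close>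
  have "\<mu> ^ 8 = (\<mu>\<^sup>2) ^ 4" by (simp flip: power_mult)
  also have "\<dots> = (\<i> ^ 4) ^ n" by (simp only: sq mult.commute flip: power_mult)
  also have "\<dots> = 1" by (simp add: power4_eq_xxxx)
  finally have "\<mu> ^ 8 = 1" .
  moreover have "\<mu> ^ 9 = (\<mu> ^ 3) ^ 3" by (simp flip: power_mult)
  moreover have "\<mu> ^ 9 = \<mu> * \<mu> ^ 8" by (simp flip: power_Suc)
  ultimately have one: "\<mu> = 1" by (simp add: cube)
  then show "kappa ^ n * of_nat (card C) = 1" by (simp add: \<mu>_def)
  have "\<i> ^ n = 1" using sq one by simp
  then have "4 dvd n"
  proof -
    have "\<i> ^ n = \<i> ^ (4 * (n div 4) + n mod 4)" by simp
    also have "\<dots> = \<i> ^ (n mod 4)"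
      unfolding power_add power_mult by (simp add: power4_eq_xxxx)
    finally have "\<i> ^ n = \<i> ^ (n mod 4)" .
    moreover have "n mod 4 \<in> {0, 1, 2, 3}" by auto
    ultimately have "n mod 4 = 0"
      using \<open>\<i> ^ n = 1\<close> by (auto simp: power3_eq_cube complex_eq_iff)
    then show ?thesis by blast
  qed
  then obtain k where k: "n = 4 * k" by blast
  \<comment> \<open>The negative value of \<open>kappa ^ 4\<close> excludes odd k:
    \<open>kappa ^ n\<close> times the positive number \<open>card C\<close> would be negative
    instead of 1.\<close>
  have k4: "kappa ^ 4 = - 1 / 4"
  proof -
    have "kappa ^ 4 = (kappa\<^sup>2)\<^sup>2" by (simp flip: power_mult)
    then show ?thesis by (simp add: kappa_squared power_divide)
  qed
  have "even k"
  proof (rule ccontr)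
    assume "odd k"
    then have "kappa ^ n = - 1 / 4 ^ k" by (simp add: k power_mult k4 power_divide)
    with one[unfolded \<mu>_def] have "- complex_of_nat (card C) = 4 ^ k" by (simp add: field_simps)
    then have "Re (- complex_of_nat (card C)) = Re (of_nat (4 ^ k))" by simp
    then have "- real (card C) = real (4 ^ k)" by (simp only: uminus_complex.sel complex_Re_of_nat)
    moreover have "real (4 ^ k) > 0" by simp
    ultimately show False by linarith
  qed
  then show "8 dvd n" using k by auto
qed

text \<open>\<open>T2\<close> is reduced to \<open>H2\<close> and the exchange of words, the scalar
  acts trivially because 8 divides n, and an affine map applied in every coordinate permutes the
  pairs of codewords.\<close>

lemma jacobi_poly_invariant:
  assumes "type_II n C" "T \<subseteq> {1..n}"
  shows "G2.invariant (jacobi_poly n C T)"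
proof -
  let ?J = "jacobi_poly n C T"
  have H: "act (diag2 H2) ?J = ?J"
    using act_H2_jacobi_poly[OF assms] type_II_length(2)[OF assms(1)] by simp
  note P = act_swap_jacobi_poly[OF assms(2), of C]
  have T2: "act (diag2 T2) ?J = ?J"
    unfolding T2_eq_H2 diag2_mult act_act[symmetric] by (simp add: H P)
  have E2: "act (diag2 E2) ?J = ?J" by (rule act_E2_jacobi_poly[OF assms])
  have eta: "act (mat eta8) ?J = ?J"
  proof -
    have "homogeneous n ?J"
      unfolding jacobi_poly_sum[OF assms(2)] by (intro homogeneous_sum homogeneous_word_monom)
    moreover have "eta8 ^ n = 1"
      using type_II_length(1)[OF assms(1)] eta8_power_8 by (auto simp: power_mult)
    ultimately show ?thesis by (simp add: act_scalar)
  qed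
  have lin: "binary_linear_code n C" using assms(1) by (simp add: type_II_def)
  \<comment> \<open>Even weights put the all-one word into the dual, hence into C; it accounts for
    the translation part of an affine map.\<close>
  have ones: "(\<lambda>i. if i \<in> {1..n} then 1 else 0) \<in> C"
  proof -
    have "wdot n u (\<lambda>i. if i \<in> {1..n} then 1 else 0) = 0" if "u \<in> C" for u
    proof -
      have "{i \<in> {1..n}. u i \<noteq> 0 \<and> (if i \<in> {1..n} then 1 else 0 :: bit) \<noteq> 0} = {i \<in> {1..n}. u i \<noteq> 0}"
        by auto
      moreover have "4 dvd weight n u" using that assms(1) by (simp add: type_II_def)
      ultimately show ?thesis
        unfolding wdot_eq_0_iff weight_def by (simp only:) presburger
    qed
    then have "(\<lambda>i. if i \<in> {1..n} then 1 else 0) \<in> dual_code n C"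
      unfolding dual_code_iff words_def by auto
    then show ?thesis using type_II_dual[OF assms(1)] by simp
  qed
  have affine: "act (diag2 (affine_matrix \<sigma>)) ?J = ?J" if \<sigma>: "\<sigma> \<in> affine_maps" for \<sigma>
  proof -
    obtain M w where Mw: "\<sigma> = (\<lambda>a. M *v a + w)" "invertible (M :: bit ^ 2 ^ 2)"
      using \<sigma> unfolding affine_maps_def by blast
    \<comment> \<open>Outside 1..n the value is reset to 0, since \<sigma> need not fix 00.\<close>
    define r where "r k u v = (\<lambda>i. if i \<in> {1..n} then \<sigma> (bvec (u i) (v i)) $ k else 0)" for k u v
    let ?g = "\<lambda>p. (r 1 (fst p) (snd p), r 2 (fst p) (snd p))"
    have mem: "r k u v \<in> C" if uv: "u \<in> C" "v \<in> C" for u v k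
    proof -
      have cmul: "(\<lambda>i. c * x i) \<in> C" if "x \<in> C" for x c
        using lin that unfolding binary_linear_code_def by blast
      have "r k u v = wadd (wadd (\<lambda>i. M $ k $ 1 * u i) (\<lambda>i. M $ k $ 2 * v i))
          (\<lambda>i. w $ k * (if i \<in> {1..n} then 1 else 0))"
      proof
        fix i
        show "r k u v i = wadd (wadd (\<lambda>i. M $ k $ 1 * u i) (\<lambda>i. M $ k $ 2 * v i))
          (\<lambda>i. w $ k * (if i \<in> {1..n} then 1 else 0)) i"
        proof (cases "i \<in> {1..n}")
          case True
          then show ?thesis
            unfolding Mw(1) wadd_def r_def
            by (simp only: if_True vector_add_component matrix_vector_mult_def
                vec_lambda_beta sum_2 bvec_nth mult_1_right)
        next
          case False
          then have "u i = 0" "v i = 0"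
            using uv lin unfolding binary_linear_code_def words_def by blast+
          with False show ?thesis
            unfolding wadd_def r_def by (simp only: if_False mult_zero_right add_0_right)
        qed
      qed
      then show ?thesis
        using lin cmul uv ones unfolding linear_code_iff by (simp only:)
    qed
    have inj: "inj \<sigma>" using affine_maps_permute[OF \<sigma>] by (rule permutes_inj)
    have "inj_on ?g (C \<times> C)"
    proof (rule inj_onI)
      fix p q assume pq: "p \<in> C \<times> C" "q \<in> C \<times> C" "?g p = ?g q"
      obtain u v u' v' where uv: "p = (u, v)" "q = (u', v')" by (cases p, cases q)
      then have uv: "p = (u, v)" "q = (u', v')" "u \<in> C" "v \<in> C" "u' \<in> C" "v' \<in> C"
        using pq by simp_all
      have "r 1 u v = r 1 u' v'" "r 2 u v = r 2 u' v'" using pq(3) by (simp_all only: uv fst_conv snd_conv prod.inject)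
      then have eq: "r k u v i = r k u' v' i" for k i
        using exhaust_2[of k] by (elim disjE) (simp_all only:)
      have "u i = u' i \<and> v i = v' i" for i
      proof (cases "i \<in> {1..n}")
        case True
        then have "\<sigma> (bvec (u i) (v i)) $ k = \<sigma> (bvec (u' i) (v' i)) $ k" for k
          using eq[of k i] by (simp only: r_def if_True)
        then have "\<sigma> (bvec (u i) (v i)) = \<sigma> (bvec (u' i) (v' i))"
          unfolding Finite_Cartesian_Product.vec_eq_iff by blast
        then have "bvec (u i) (v i) = bvec (u' i) (v' i)" by (rule injD[OF inj])
        then show ?thesis unfolding bvec_eq_iff bvec_nth .
      next
        case False
        then have "u i = 0" "v i = 0" "u' i = 0" "v' i = 0"
          using uv lin unfolding binary_linear_code_def words_def by blast+
        then show ?thesis by simp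
      qed
      then show "p = q" unfolding uv(1,2) by (simp add: ext)
    qed
    moreover have "?g ` (C \<times> C) \<subseteq> C \<times> C"
      using mem by (simp add: image_subset_iff)
    moreover have "finite (C \<times> C)" using finite_code[OF lin] by simp
    ultimately have bij: "bij_betw ?g (C \<times> C) (C \<times> C)"
      unfolding bij_betw_def by (intro conjI endo_inj_surj)
    have "act (diag2 (affine_matrix \<sigma>)) (word_monom n T (fst p) (snd p)) = word_monom n T (fst (?g p)) (snd (?g p))" for p
      unfolding act_perm_word_monom fst_conv snd_conv unfolding word_monom_def
      by (intro prod.cong refl) (simp add: r_def)
    then have "act (diag2 (affine_matrix \<sigma>)) ?J
        = (\<Sum>p\<in>C \<times> C. word_monom n T (fst (?g p)) (snd (?g p)))"
      unfolding jacobi_poly_eq[OF assms(2)] case_prod_beta act_sum by simp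
    also have "\<dots> = (\<Sum>p\<in>C \<times> C. word_monom n T (fst p) (snd p))"
      by (rule sum.reindex_bij_betw[OF bij])
    finally show ?thesis
      unfolding jacobi_poly_eq[OF assms(2)] case_prod_beta .
  qed
  have gens: "act A ?J = ?J" if "A \<in> G2_gens" for A
    using that T2 E2 eta affine unfolding G2_gens_def by blast
  have "act A ?J = ?J" if "A \<in> G2" for A
    using that unfolding G2_eq_generate
  proof (induction rule: generate.induct)
    case one
    then show ?case by (simp add: act_mat_1)
  next
    case (inv h)
    interpret group GL8 by (rule group_GL8)
    have "h ** inv\<^bsub>GL8\<^esub> h = mat 1"
      using r_inv[of h] inv G2_gens_invertible by simp
    then have "act (inv\<^bsub>GL8\<^esub> h) (act h ?J) = ?J" by (simp add: act_act act_mat_1)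
    then show ?case using gens[OF inv] by simp
  next
    case (eng h1 h2)
    then show ?case by (simp flip: act_act)
  qed (rule gens)
  then show ?thesis by (simp add: G2.invariant_def)
qed

section \<open>Invariants are spanned by Jacobi polynomials\<close>

lemma jacobi_algebra_add: "f \<in> jacobi_algebra \<Longrightarrow> g \<in> jacobi_algebra \<Longrightarrow> f + g \<in> jacobi_algebra"
  unfolding jacobi_algebra_def by (rule generated_algebra.add)

lemma jacobi_algebra_const_mult: "f \<in> jacobi_algebra \<Longrightarrow> const_poly c * f \<in> jacobi_algebra"
  unfolding jacobi_algebra_def by (intro generated_algebra.mult generated_algebra.const)

lemma jacobi_algebra_0: "0 \<in> jacobi_algebra"
  using generated_algebra.const[of 0] by (simp add: jacobi_algebra_def)

lemma jacobi_algebra_sum: "(\<And>x. x \<in> S \<Longrightarrow> f x \<in> jacobi_algebra) \<Longrightarrow> sum f S \<in> jacobi_algebra"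
  by (induction S rule: infinite_finite_induct) (auto intro: jacobi_algebra_add jacobi_algebra_0)

lemma jacobi_algebra_of_mult:
  assumes "const_poly c * f \<in> jacobi_algebra" "c \<noteq> 0"
  shows "f \<in> jacobi_algebra"
proof -
  have "const_poly (inverse c) * (const_poly c * f) \<in> jacobi_algebra"
    using assms(1) by (rule jacobi_algebra_const_mult)
  also have "const_poly (inverse c) * (const_poly c * f) = f"
    using assms(2) by (simp flip: mult.assoc const_poly_mult)
  finally show ?thesis .
qed

lemma jacobi_algebra_diff: "f \<in> jacobi_algebra \<Longrightarrow> g \<in> jacobi_algebra \<Longrightarrow> f - g \<in> jacobi_algebra"
proof -
  assume "f \<in> jacobi_algebra" "g \<in> jacobi_algebra"
  then have "f + const_poly (- 1) * g \<in> jacobi_algebra"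
    by (intro jacobi_algebra_add jacobi_algebra_const_mult)
  moreover have "const_poly (- 1) = - (1 :: cpoly)"
    by (simp add: const_poly_def single_uminus)
  ultimately show ?thesis by simp
qed

lemma kappa_power: "n = 8 * k \<Longrightarrow> kappa ^ n = 1 / 16 ^ k"
  by (simp add: power_mult kappa_power_8 power_divide)

lemma mem_adjoin: "u \<in> D \<Longrightarrow> u \<in> adjoin D v" "u \<in> D \<Longrightarrow> wadd v u \<in> adjoin D v"
  by (simp_all add: adjoin_def)

context
  fixes n :: nat and T :: "nat set"
begin

definition rey :: "(nat \<Rightarrow> bit) \<Rightarrow> (nat \<Rightarrow> bit) \<Rightarrow> cpoly" where
  "rey u v = G2.reynolds (word_monom n T u v)"

text \<open>The sum written \<Lambda>(D) in the overview.\<close>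

definition code_rey :: "(nat \<Rightarrow> bit) set \<Rightarrow> cpoly" where
  "code_rey D = (\<Sum>u\<in>D. \<Sum>v\<in>D. rey u v)"

lemma rey_swap: "rey u v = rey v u"
  unfolding rey_def
  using G2.reynolds_act[OF G2_affine[OF swap_bits_permutes], of "word_monom n T u v"]
  by (simp add: act_swap_word_monom)

lemma rey_shear: "rey (wadd u v) v = rey u v"
  unfolding rey_def
  using G2.reynolds_act[OF G2_affine[OF shear_permutes], of "word_monom n T u v"]
  by (simp add: act_shear_word_monom)

text \<open>\<open>E2\<close> multiplies the monomial by a power of i different from 1 but leaves
  its average unchanged. By exchange and shear the same constraint falls on u and on u + v.\<close>

lemma rey_weight:
  assumes "\<not> 4 dvd weight n v"
  shows "rey u v = 0"
proof -
  have eq: "const_poly (\<i> ^ weight n v) * rey u v = const_poly 1 * rey u v"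
    unfolding rey_def
    using G2.reynolds_act[OF G2_E2, of "word_monom n T u v"]
    by (simp add: act_E2_word_monom G2.reynolds_const_mult)
  have "\<i> ^ weight n v \<noteq> 1"
  proof
    assume 1: "\<i> ^ weight n v = 1"
    have "\<i> ^ weight n v = \<i> ^ (4 * (weight n v div 4) + weight n v mod 4)" by simp
    also have "\<dots> = \<i> ^ (weight n v mod 4)"
      unfolding power_add power_mult by (simp add: power4_eq_xxxx)
    finally have "\<i> ^ (weight n v mod 4) = 1" using 1 by simp
    moreover have "weight n v mod 4 \<in> {1, 2, 3}" using assms by (auto simp: dvd_eq_mod_eq_0)
    ultimately show False by (auto simp: power3_eq_cube complex_eq_iff)
  qed
  then show ?thesis using const_poly_mult_eq_iff[OF _ eq] by blast
qed

lemma rey_length: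
  assumes "\<not> 8 dvd n"
  shows "rey u v = 0"
proof -
  have "act (mat eta8) (word_monom n T u v) = const_poly (eta8 ^ n) * word_monom n T u v"
    by (rule act_scalar[OF homogeneous_word_monom])
  then have eq: "const_poly (eta8 ^ n) * rey u v = const_poly 1 * rey u v"
    unfolding rey_def
    using G2.reynolds_act[OF G2_eta_power[of 1], of "word_monom n T u v"]
    by (simp add: G2.reynolds_const_mult)
  have "eta8 ^ n \<noteq> 1"
  proof
    assume 1: "eta8 ^ n = 1"
    have "eta8 ^ n = eta8 ^ (8 * (n div 8) + n mod 8)" by simp
    also have "\<dots> = eta8 ^ (n mod 8)"
      unfolding power_add power_mult by (simp add: eta8_power_8)
    finally have "eta8 ^ (n mod 8) = eta8 ^ 0" using 1 by simp
    then have "n mod 8 = 0" using inj_eta8_power by (auto simp: inj_on_def)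
    then show False using assms by presburger
  qed
  then show ?thesis using const_poly_mult_eq_iff[OF _ eq] by blast
qed

lemma rey_H2: "rey u v = const_poly (kappa ^ n) * (\<Sum>w\<in>words n. const_poly (bit_sign (wdot n v w)) * rey u w)"
  unfolding rey_def
  using G2.reynolds_act[OF G2_H2, of "word_monom n T u v"]
  by (simp add: act_H2_word_monom G2.reynolds_const_mult G2.reynolds_sum)

text \<open>Poisson summation in the second word: \<open>H2\<close> is absorbed by the average, and
  the characters of D single out the dual code.\<close>

lemma code_rey_H2:
  assumes D: "binary_linear_code n D"
  shows "code_rey D = const_poly (kappa ^ n * of_nat (card D)) * (\<Sum>u\<in>D. \<Sum>w\<in>dual_code n D. rey u w)"
proof -
  have sub: "dual_code n D \<subseteq> words n" by (auto simp: dual_code_iff)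
  have "(\<Sum>v\<in>D. rey u v) = const_poly (kappa ^ n * of_nat (card D)) * (\<Sum>w\<in>dual_code n D. rey u w)" for u
  proof -
    have "(\<Sum>v\<in>D. rey u v)
        = const_poly (kappa ^ n) * (\<Sum>v\<in>D. \<Sum>w\<in>words n. const_poly (bit_sign (wdot n v w)) * rey u w)"
      unfolding sum_distrib_left[of "const_poly (kappa ^ n)" _ D] by (intro sum.cong refl rey_H2)
    also have "(\<Sum>v\<in>D. \<Sum>w\<in>words n. const_poly (bit_sign (wdot n v w)) * rey u w)
        = (\<Sum>w\<in>words n. const_poly (\<Sum>v\<in>D. bit_sign (wdot n v w)) * rey u w)"
      by (subst sum.swap) (simp add: const_poly_sum sum_distrib_right)
    also have "\<dots> = (\<Sum>w\<in>words n. if w \<in> dual_code n D then const_poly (of_nat (card D)) * rey u w else 0)"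
      by (intro sum.cong refl) (simp add: sum_character[OF D])
    also have "\<dots> = const_poly (of_nat (card D)) * (\<Sum>w\<in>dual_code n D. rey u w)"
      using sub finite_words by (simp add: sum.If_cases Int_absorb1 sum_distrib_left)
    finally show ?thesis by (simp add: const_poly_mult mult.assoc)
  qed
  then show ?thesis by (simp add: code_rey_def sum_distrib_left)
qed

lemma inj_wadd: "inj (wadd v)"
  by (rule inj_on_inverseI[where g = "wadd v"]) simp

text \<open>The pairs of an extension \<open>D + \<langle>v\<rangle>\<close> that do not lie in \<open>D\<close> form three orbits under the
  elementary operations, each contributing the same amount.\<close>
lemma code_rey_adjoin:
  assumes D: "binary_linear_code n D" and v: "v \<notin> D"
  shows "code_rey (adjoin D v) = code_rey D + 3 * (\<Sum>u\<in>D. \<Sum>w\<in>D. rey u (wadd v w))"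
proof -
  have fin: "finite D" using D by (rule finite_code)
  have closed: "wadd u w \<in> D" if "u \<in> D" "w \<in> D" for u w
    using D that unfolding linear_code_iff by blast
  have disj: "D \<inter> wadd v ` D = {}"
  proof -
    have "wadd v w \<notin> D" if "w \<in> D" for w
      using closed[of "wadd v w" w] that v by auto
    then show ?thesis by blast
  qed
  have split: "(\<Sum>u\<in>adjoin D v. f u) = (\<Sum>u\<in>D. f u) + (\<Sum>u\<in>D. f (wadd v u))" for f :: "_ \<Rightarrow> cpoly"
    unfolding adjoin_def using fin disj
    by (subst sum.union_disjoint) (auto simp: sum.reindex inj_on_subset[OF inj_wadd])
  let ?S = "\<Sum>u\<in>D. \<Sum>w\<in>D. rey u (wadd v w)"
  have S2: "(\<Sum>u\<in>D. \<Sum>w\<in>D. rey (wadd v u) w) = ?S"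
    by (subst sum.swap) (simp add: rey_swap[of "wadd v _"])
  have S3: "(\<Sum>u\<in>D. \<Sum>w\<in>D. rey (wadd v u) (wadd v w)) = ?S"
  proof -
    \<comment> \<open>Adding the second word to the first takes (v + u, v + w) to (w + u, v + w),
      whose first word lies in D again.\<close>
    have "rey (wadd v u) (wadd v w) = rey (wadd w u) (wadd v w)" for u w
    proof -
      have "wadd (wadd w u) (wadd v w) = wadd v u"
        by (metis wadd_assoc wadd_cancel(2) wadd_commute)
      then show ?thesis using rey_shear[of "wadd w u" "wadd v w"] by simp
    qed
    then have "(\<Sum>u\<in>D. \<Sum>w\<in>D. rey (wadd v u) (wadd v w)) = (\<Sum>w\<in>D. \<Sum>u\<in>D. rey (wadd w u) (wadd v w))"
      by (subst sum.swap) simp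
    also have "\<dots> = (\<Sum>w\<in>D. \<Sum>u\<in>D. rey u (wadd v w))"
      by (intro sum.cong refl sum.reindex_bij_betw bij_betw_wadd[OF D])
    also have "\<dots> = ?S" by (rule sum.swap)
    finally show ?thesis .
  qed
  show ?thesis
    unfolding code_rey_def split by (simp add: sum.distrib S2 S3)
qed

text \<open>The transform and the extension formula give two relations between \<Lambda>(D), the
  sums \<Lambda>(D + <v>) and the mixed sum \<open>S\<close> over pairs from D and A. Eliminating
  \<open>S\<close> leaves \<Lambda>(D) with a positive coefficient.\<close>

lemma code_rey_mem:
  assumes "8 dvd n" "T \<subseteq> {1..n}" "doubly_even n D"
  shows "code_rey D \<in> jacobi_algebra"
  using assms(3)
proof (induction "card (words n) - card D" arbitrary: D rule: less_induct)
  case less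
  have D: "binary_linear_code n D" "\<And>u. u \<in> D \<Longrightarrow> 4 dvd weight n u"
    using less.prems unfolding doubly_even_def by blast+
  have fin: "finite D" using D(1) by (rule finite_code)
  have sub: "D \<subseteq> dual_code n D" using less.prems by (rule doubly_even_subset_dual)
  have dual: "dual_code n D \<subseteq> words n" by (auto simp: dual_code_iff)
  have fin_dual: "finite (dual_code n D)" using dual finite_words finite_subset by blast
  show ?case
  proof (cases "D = dual_code n D")
    case True
    then have "type_II n D" unfolding type_II_def using D by blast
    then have "jacobi_poly n D T \<in> jacobi_algebra" "G2.reynolds (jacobi_poly n D T) = jacobi_poly n D T"
      using assms(2) jacobi_poly_invariant G2.reynolds_invariant
      unfolding jacobi_algebra_def by (blast intro: generated_algebra.incl)+
    moreover have "code_rey D = G2.reynolds (jacobi_poly n D T)"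
      by (simp add: code_rey_def rey_def jacobi_poly_sum[OF assms(2)] G2.reynolds_sum)
    ultimately show ?thesis by simp
  next
    case False
    then have card_less: "card D < card (dual_code n D)"
      using sub fin_dual by (intro psubset_card_mono) auto
    obtain k where k: "n = 8 * k" using assms(1) by blast
    define A where "A = {v \<in> dual_code n D - D. 4 dvd weight n v}"
    have finA: "finite A" using fin_dual by (simp add: A_def)
    let ?c = "kappa ^ n * of_nat (card D)"
    \<comment> \<open>The words of the dual outside D whose weight is not divisible by 4 drop out by
      \<open>rey_weight\<close>; the others form A.\<close>
    have dual_sum: "(\<Sum>w\<in>dual_code n D. rey u w) = (\<Sum>w\<in>D. rey u w) + (\<Sum>w\<in>A. rey u w)" for u
    proof -
      have "(\<Sum>w\<in>dual_code n D. rey u w) = (\<Sum>w\<in>D \<union> A. rey u w)"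
        using sub fin_dual rey_weight by (intro sum.mono_neutral_right) (auto simp: A_def)
      also have "\<dots> = (\<Sum>w\<in>D. rey u w) + (\<Sum>w\<in>A. rey u w)"
        using fin finA by (intro sum.union_disjoint) (auto simp: A_def)
      finally show ?thesis .
    qed
    define S where "S = (\<Sum>u\<in>D. \<Sum>w\<in>A. rey u w)"
    have eq1: "code_rey D = const_poly ?c * (code_rey D + S)"
      by (subst code_rey_H2[OF D(1)]) (simp add: dual_sum sum.distrib S_def code_rey_def)
    \<comment> \<open>A is a union of cosets of D, so translation by a word of D permutes it.
      Summing over v in A and w in D thus counts every term of \<open>S\<close> exactly
      \<open>card D\<close> times.\<close>
    have shift: "(\<Sum>v\<in>A. f (wadd v w)) = (\<Sum>v\<in>A. f v)" if w: "w \<in> D" for w and f :: "_ \<Rightarrow> cpoly"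
    proof (rule sum.reindex_bij_betw)
      have "wadd v w \<in> A" if v: "v \<in> A" for v
      proof -
        have v': "v \<in> words n" "\<forall>u\<in>D. wdot n u v = 0" "v \<notin> D" "4 dvd weight n v"
          using v by (auto simp: A_def dual_code_iff)
        have w': "w \<in> words n" "\<forall>u\<in>D. wdot n u w = 0"
          using w sub unfolding dual_code_iff subset_iff by auto
        have "wadd v w \<notin> D"
        proof
          assume "wadd v w \<in> D"
          then have "wadd (wadd v w) w \<in> D" using w D(1) unfolding linear_code_iff by blast
          then show False using v'(3) by simp
        qed
        moreover have "\<forall>u\<in>D. wdot n u (wadd v w) = 0"
        proof
          fix u assume u: "u \<in> D"
          have "wdot n u (wadd v w) = wdot n u v + wdot n u w"
            by (simp only: wdot_commute[of n u] wdot_wadd)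
          then show "wdot n u (wadd v w) = 0" using v'(2) w'(2) u by simp
        qed
        moreover have "4 dvd weight n (wadd v w)"
          using v'(2,4) D(2)[OF w] w by (intro doubly_even_wadd) (simp_all add: wdot_commute[of n v])
        ultimately show ?thesis
          using words_wadd[OF v'(1) w'(1)] by (simp add: A_def dual_code_iff)
      qed
      then show "bij_betw (\<lambda>v. wadd v w) A A"
        by (intro bij_betw_byWitness[where f' = "\<lambda>v. wadd v w"]) auto
    qed
    have eq2: "(\<Sum>v\<in>A. code_rey (adjoin D v) - code_rey D) = 3 * (of_nat (card D) * S)"
    proof -
      have "(\<Sum>v\<in>A. code_rey (adjoin D v) - code_rey D) = (\<Sum>v\<in>A. 3 * (\<Sum>u\<in>D. \<Sum>w\<in>D. rey u (wadd v w)))"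
        by (intro sum.cong refl) (simp add: code_rey_adjoin[OF D(1)] A_def)
      also have "\<dots> = 3 * (\<Sum>v\<in>A. \<Sum>u\<in>D. \<Sum>w\<in>D. rey u (wadd v w))"
        by (simp add: sum_distrib_left)
      also have "(\<Sum>v\<in>A. \<Sum>u\<in>D. \<Sum>w\<in>D. rey u (wadd v w)) = (\<Sum>u\<in>D. \<Sum>w\<in>D. \<Sum>v\<in>A. rey u (wadd v w))"
        by (subst sum.swap) (intro sum.cong refl sum.swap)
      also have "\<dots> = (\<Sum>u\<in>D. \<Sum>w\<in>D. \<Sum>v\<in>A. rey u v)"
        by (intro sum.cong refl shift)
      also have "\<dots> = of_nat (card D) * S"
        by (simp add: S_def sum_distrib_left)
      finally show ?thesis .
    qed
    have IH: "code_rey (adjoin D v) \<in> jacobi_algebra" if v: "v \<in> A" for v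
    proof (rule less.hyps)
      have v': "v \<in> dual_code n D" "v \<notin> D" "4 dvd weight n v" using v unfolding A_def by blast+
      show de: "doubly_even n (adjoin D v)" by (rule doubly_even_adjoin[OF less.prems v'(1,3)])
      have "binary_linear_code n (adjoin D v)" using de unfolding doubly_even_def by blast
      then have sub': "adjoin D v \<subseteq> words n" unfolding linear_code_iff by blast
      have "(\<lambda>_. 0) \<in> D" using D(1) unfolding linear_code_iff by blast
      then have "v \<in> adjoin D v" using mem_adjoin(2)[of "\<lambda>_. 0" D v] by simp
      then have "D \<subset> adjoin D v" using v'(2) by (auto simp: mem_adjoin)
      then have "card D < card (adjoin D v)"
        using finite_subset[OF sub' finite_words] by (rule psubset_card_mono[rotated])
      moreover have "card (adjoin D v) \<le> card (words n)"
        using sub' finite_words by (rule card_mono[rotated])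
      ultimately show "card (words n) - card (adjoin D v) < card (words n) - card D" by simp
    qed
    define a :: complex where "a = of_nat (card A)"
    define d :: complex where "d = of_nat (card D)"
    define E where "E = (\<Sum>v\<in>A. code_rey (adjoin D v))"
    have E: "E \<in> jacobi_algebra" unfolding E_def by (intro jacobi_algebra_sum IH)
    have dS: "const_poly d * S = const_poly (1 / 3) * (E - const_poly a * code_rey D)"
    proof -
      have 3: "3 = const_poly 3" using const_poly_of_nat[of 3] by simp
      have "E - const_poly a * code_rey D = const_poly 3 * (const_poly d * S)"
        using eq2 by (simp add: E_def a_def d_def const_poly_of_nat sum_subtractf 3)
      then show ?thesis by (simp flip: mult.assoc const_poly_mult)
    qed
    have "code_rey D = const_poly (kappa ^ n * d) * code_rey D + const_poly (kappa ^ n) * (const_poly d * S)"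
      using eq1 by (simp add: d_def distrib_left const_poly_mult mult.assoc)
    then have "const_poly (1 - kappa ^ n * d + kappa ^ n * a / 3) * code_rey D = const_poly (kappa ^ n / 3) * E"
    proof -
      assume *: "code_rey D = const_poly (kappa ^ n * d) * code_rey D + const_poly (kappa ^ n) * (const_poly d * S)"
      have c: "const_poly (x - y) = const_poly x - const_poly y" for x y
        by (simp add: const_poly_def single_diff)
      have "const_poly (1 - kappa ^ n * d + kappa ^ n * a / 3) * code_rey D
          = (code_rey D - const_poly (kappa ^ n * d) * code_rey D) + const_poly (kappa ^ n * a / 3) * code_rey D"
        by (simp add: const_poly_add c left_diff_distrib distrib_right)
      also have "code_rey D - const_poly (kappa ^ n * d) * code_rey D = const_poly (kappa ^ n) * (const_poly d * S)"
        using * by (simp add: diff_eq_eq add.commute)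
      also have "\<dots> = const_poly (kappa ^ n / 3) * E - const_poly (kappa ^ n * a / 3) * code_rey D"
        unfolding dS by (simp add: right_diff_distrib flip: mult.assoc const_poly_mult)
      finally show ?thesis by simp
    qed
    then have mem: "const_poly (1 - kappa ^ n * d + kappa ^ n * a / 3) * code_rey D \<in> jacobi_algebra"
      using jacobi_algebra_const_mult[OF E] by simp
    show ?thesis
    proof (rule jacobi_algebra_of_mult[OF mem])
      have "card D * card D < (16 ^ k) * 16 ^ k"
      proof -
        have "card D * card D < card D * card (dual_code n D)"
        proof -
          have "card D \<noteq> 0" using card_dual_code[OF D(1)] by (cases "card D = 0") simp_all
          then show ?thesis using card_less by simp
        qed
        also have "\<dots> = 2 ^ n" by (rule card_dual_code[OF D(1)])
        also have "\<dots> = (16 ^ k) * 16 ^ k"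
          by (simp add: k power_mult flip: power_mult_distrib)
        finally show ?thesis .
      qed
      then have "card D < 16 ^ k" by (metis linorder_not_less mult_le_mono)
      then have less1: "real (card D) / 16 ^ k < 1"
        by (metis divide_less_eq_1_pos of_nat_less_iff of_nat_numeral of_nat_power zero_less_numeral zero_less_power)
      have "1 - kappa ^ n * d + kappa ^ n * a / 3
          = of_real (1 - real (card D) / 16 ^ k + real (card A) / 16 ^ k / 3)"
        by (simp add: kappa_power[OF k] d_def a_def)
      moreover have "1 - real (card D) / 16 ^ k + real (card A) / 16 ^ k / 3 > 0"
        using less1 by (simp add: add_pos_nonneg)
      ultimately show "1 - kappa ^ n * d + kappa ^ n * a / 3 \<noteq> 0" by (metis less_irrefl of_real_eq_0_iff)
    qed
  qed
qed

end

lemma doubly_even_zero: "doubly_even n {\<lambda>_. 0}"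
  by (simp add: doubly_even_def linear_code_iff words_0 weight_def)

lemma adjoin_zero: "adjoin {\<lambda>_. 0} u = {\<lambda>_. 0, u}"
  by (auto simp: adjoin_def)

lemma three_cancel:
  assumes "3 * f \<in> jacobi_algebra"
  shows "f \<in> jacobi_algebra"
  using jacobi_algebra_of_mult[of 3 f] assms const_poly_of_nat[of 3] by simp

text \<open>Codes of dimension at most 2 isolate single pairs: subtracting \<Lambda>({0}) from
  \<Lambda>(<w>) gives the average for (0, w), and subtracting \<Lambda>(<u>) from \<Lambda>(<u, v>)
  leads to the one for (u, v). Pairs violating a length or weight condition average to 0.\<close>

lemma rey_mem:
  assumes T: "T \<subseteq> {1..n}" and uv: "u \<in> words n" "v \<in> words n"
  shows "rey n T u v \<in> jacobi_algebra"
proof (cases "8 dvd n \<and> 4 dvd weight n u \<and> 4 dvd weight n v \<and> 4 dvd weight n (wadd u v)")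
  case False
  \<comment> \<open>This brings u + v into second position, where \<open>rey_weight\<close> applies
    to it.\<close>
  have "rey n T u v = rey n T v (wadd u v)"
    using rey_shear[of n T u v] rey_swap[of n T "wadd u v" v] by simp
  then have "rey n T u v = 0"
    using False rey_length[of n T u v] rey_weight[of n v T u] rey_weight[of n u T v]
      rey_weight[of n "wadd u v" T v] rey_swap[of n T u v] by auto
  then show ?thesis by (simp add: jacobi_algebra_0)
next
  case True
  let ?o = "(\<lambda>_. 0) :: nat \<Rightarrow> bit"
  have code: "code_rey n T D \<in> jacobi_algebra" if "doubly_even n D" for D
    using code_rey_mem[OF _ T that] True by blast
  have lin0: "binary_linear_code n {?o}" using doubly_even_zero by (simp add: doubly_even_def)
  have dual0: "dual_code n {?o} = words n" by (auto simp: dual_code_iff)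
  have one: "rey n T ?o w \<in> jacobi_algebra" if w: "w \<in> words n" "4 dvd weight n w" for w
  proof (cases "w = ?o")
    case True
    then show ?thesis using code[OF doubly_even_zero] by (simp add: code_rey_def)
  next
    case False
    have "doubly_even n (adjoin {?o} w)"
      by (rule doubly_even_adjoin[OF doubly_even_zero]) (simp_all add: dual0 w)
    then have "code_rey n T (adjoin {?o} w) - code_rey n T {?o} \<in> jacobi_algebra"
      by (intro jacobi_algebra_diff code doubly_even_zero)
    then have "3 * rey n T ?o w \<in> jacobi_algebra"
      using code_rey_adjoin[OF lin0, of w T] False by simp
    then show ?thesis by (rule three_cancel)
  qed
  show ?thesis
  proof (cases "u = ?o \<or> v = ?o \<or> v = u")
    case True
    have "rey n T u u = rey n T ?o u" using rey_shear[of n T ?o u] by simp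
    then show ?thesis
      using True one[OF uv(1)] one[OF uv(2)] \<open>8 dvd n \<and> _\<close> rey_swap[of n T u ?o] by auto
  next
    case False
    let ?D = "adjoin {?o} u"
    have D: "doubly_even n ?D"
      by (rule doubly_even_adjoin[OF doubly_even_zero]) (use uv True in \<open>simp_all add: dual0\<close>)
    then have linD: "binary_linear_code n ?D" by (simp add: doubly_even_def)
    have "wdot n u v = 0"
      using True by (intro doubly_even_orthogonal) simp_all
    then have "v \<in> dual_code n ?D"
      using uv by (simp add: dual_code_iff adjoin_zero)
    then have D': "doubly_even n (adjoin ?D v)"
      using True by (intro doubly_even_adjoin[OF D]) simp_all
    have "code_rey n T (adjoin ?D v) - code_rey n T ?D \<in> jacobi_algebra"
      by (intro jacobi_algebra_diff code D D')
    moreover have "code_rey n T (adjoin ?D v) - code_rey n T ?D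
        = 3 * (\<Sum>x\<in>?D. \<Sum>w\<in>?D. rey n T x (wadd v w))"
      using code_rey_adjoin[OF linD, of v T] False by (simp add: adjoin_zero)
    ultimately have "(\<Sum>x\<in>?D. \<Sum>w\<in>?D. rey n T x (wadd v w)) \<in> jacobi_algebra"
      using three_cancel by simp
    \<comment> \<open>Two of the four pairs have first word 0 and are already settled; the other two
      have equal averages by a shear, leaving twice the wanted one.\<close>
    moreover have "(\<Sum>x\<in>?D. \<Sum>w\<in>?D. rey n T x (wadd v w))
        = rey n T ?o v + rey n T ?o (wadd v u) + (rey n T u v + rey n T u (wadd v u))"
    proof -
      have "?o \<noteq> u" using False by blast
      then show ?thesis by (simp add: adjoin_zero)
    qed
    moreover have "rey n T u (wadd v u) = rey n T u v"
      using rey_swap[of n T u "wadd v u"] rey_shear[of n T v u] rey_swap[of n T v u] by simp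
    ultimately have sum: "rey n T ?o v + rey n T ?o (wadd v u) + (rey n T u v + rey n T u v) \<in> jacobi_algebra"
      by simp
    have "rey n T ?o v \<in> jacobi_algebra" "rey n T ?o (wadd v u) \<in> jacobi_algebra"
      using one uv True words_wadd[OF uv(2,1)] by (simp_all add: wadd_commute[of v u])
    from jacobi_algebra_diff[OF sum jacobi_algebra_add[OF this]]
    have "rey n T u v + rey n T u v \<in> jacobi_algebra" by simp
    then have "const_poly 2 * rey n T u v \<in> jacobi_algebra"
      using const_poly_of_nat[of 2] by simp
    then show ?thesis by (rule jacobi_algebra_of_mult) simp
  qed
qed

lemma pmono_eq_prod_var: "\<exists>z. pmono m = (\<Prod>i=1..mdeg m. var_poly (z i))"
proof (induction "mdeg m" arbitrary: m)
  case 0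
  then have "expo m z = 0" for z by (simp add: mdeg_def)
  then have "m = 0" by (metis lookup_zero poly_mapping_eqI)
  then show ?case using 0 by simp
next
  case (Suc n)
  then obtain z where z: "expo m z \<noteq> 0"
    by (metis mdeg_def nat.distinct(1) sum.neutral)
  define m' where "m' = m - Poly_Mapping.single z 1"
  have m: "m = m' + Poly_Mapping.single z 1"
    using z by (intro poly_mapping_eqI) (auto simp: m'_def lookup_add lookup_minus lookup_single when_def)
  have "mdeg (Poly_Mapping.single z 1) = 1"
    by (simp add: mdeg_def lookup_single when_def)
  then have deg: "mdeg m = Suc (mdeg m')" by (simp add: m mdeg_add)
  then obtain y where y: "pmono m' = (\<Prod>i=1..mdeg m'. var_poly (y i))"
    using Suc by (metis nat.inject)
  let ?x = "\<lambda>i. if i = mdeg m then z else y i"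
  have "(\<Prod>i=1..mdeg m. var_poly (?x i)) = (\<Prod>i=1..mdeg m'. var_poly (?x i)) * var_poly z"
    by (simp add: deg)
  also have "(\<Prod>i=1..mdeg m'. var_poly (?x i)) = pmono m'"
    unfolding y by (intro prod.cong) (auto simp: deg)
  also have "pmono m' * var_poly z = pmono m"
    by (subst m) (simp add: pmono_add, simp add: pmono_def var_poly_def)
  finally show ?case by (intro exI[of _ ?x]) simp
qed

text \<open>The factors, listed in any order, serve as coordinates: T collects those that are y
  variables, and their indices supply the bits of the two words. Hence Jacobi polynomials for all T
  are needed to reach every monomial.\<close>

lemma pmono_eq_word_monom:
  assumes "mdeg m = n"
  obtains T u v where "T \<subseteq> {1..n}" "u \<in> words n" "v \<in> words n" "pmono m = word_monom n T u v"
proof -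
  obtain z where z: "pmono m = (\<Prod>i=1..n. var_poly (z i))"
    using pmono_eq_prod_var[of m] assms by blast
  define T where "T = {i \<in> {1..n}. z i \<in> range Inr}"
  define a where "a i = (case z i of Inl a \<Rightarrow> a | Inr a \<Rightarrow> a)" for i
  define w where "w k i = (if i \<in> {1..n} then a i $ k else 0)" for k :: 2 and i
  have "z i = side T i (bvec (w 1 i) (w 2 i))" if "i \<in> {1..n}" for i
  proof -
    have "bvec (w 1 i) (w 2 i) = a i" using that by (simp add: w_def bvec_surj)
    then show ?thesis
      using that by (cases "z i") (auto simp: side_def T_def a_def)
  qed
  then have "pmono m = word_monom n T (w 1) (w 2)"
    unfolding z word_monom_def by (intro prod.cong refl) simp
  moreover have "w k \<in> words n" for k by (simp add: w_def words_def)
  ultimately show thesis by (intro that[of T "w 1" "w 2"]) (auto simp: T_def)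
qed

lemma invariant_mem_jacobi_algebra:
  assumes "G2.invariant f" "homogeneous n f"
  shows "f \<in> jacobi_algebra"
proof -
  have "f = G2.reynolds f" using G2.reynolds_invariant[OF assms(1)] by simp
  also have "\<dots> = G2.reynolds (\<Sum>m\<in>monoms n. const_poly (coef f m) * pmono m)"
    by (rule arg_cong[OF homogeneous_sum_monoms[OF assms(2)]])
  also have "\<dots> = (\<Sum>m\<in>monoms n. const_poly (coef f m) * G2.reynolds (pmono m))"
    by (simp add: G2.reynolds_sum G2.reynolds_const_mult)
  also have "\<dots> \<in> jacobi_algebra"
  proof (intro jacobi_algebra_sum jacobi_algebra_const_mult)
    fix m assume "m \<in> monoms n"
    then have "mdeg m = n" by (simp add: monoms_def)
    then obtain T u v where "T \<subseteq> {1..n}" "u \<in> words n" "v \<in> words n" "pmono m = word_monom n T u v"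
      by (rule pmono_eq_word_monom)
    then show "G2.reynolds (pmono m) \<in> jacobi_algebra"
      using rey_mem by (simp add: rey_def)
  qed
  finally show ?thesis .
qed

lemma jacobi_algebra_invariant: "f \<in> jacobi_algebra \<Longrightarrow> G2.invariant f"
  unfolding jacobi_algebra_def
proof (induction rule: generated_algebra.induct)
  case (incl f)
  then show ?case using jacobi_poly_invariant by blast
qed (auto simp: G2.invariant_def act_add act_mult)

lemma jacobi_algebra_part_eq: "jacobi_algebra_part n = {f. G2.invariant f \<and> homogeneous n f}"
  unfolding jacobi_algebra_part_def using invariant_mem_jacobi_algebra jacobi_algebra_invariant by blast

text \<open>\<open>jacobi_dim_series\<close> sets these coefficients to 0 by definition, while the
  Molien series counts invariants in all degrees; here the scalar \<open>eta8\<close> rules them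
  out.\<close>

lemma jacobi_algebra_part_trivial:
  assumes "\<not> 8 dvd n"
  shows "jacobi_algebra_part n = {0}"
proof -
  have "f = 0" if f: "G2.invariant f" "homogeneous n f" for f
  proof -
    have "f = G2.reynolds f" using G2.reynolds_invariant[OF f(1)] by simp
    also have "\<dots> = G2.reynolds (\<Sum>m\<in>monoms n. const_poly (coef f m) * pmono m)"
      by (rule arg_cong[OF homogeneous_sum_monoms[OF f(2)]])
    also have "\<dots> = (\<Sum>m\<in>monoms n. const_poly (coef f m) * G2.reynolds (pmono m))"
      by (simp add: G2.reynolds_sum G2.reynolds_const_mult)
    also have "\<dots> = 0"
    proof (intro sum.neutral ballI)
      fix m assume "m \<in> monoms n"
      then have "mdeg m = n" by (simp add: monoms_def)
      then obtain T u v where "pmono m = word_monom n T u v"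
        by (rule pmono_eq_word_monom)
      then show "const_poly (coef f m) * G2.reynolds (pmono m) = 0"
        using rey_length[OF assms, of T u v] by (simp add: rey_def)
    qed
    finally show ?thesis .
  qed
  moreover have "G2.invariant 0" by (simp add: G2.invariant_def)
  ultimately show ?thesis unfolding jacobi_algebra_part_eq by auto
qed

theorem molien_series_eq: "molien_series G2 = jacobi_dim_series"
proof (rule fps_ext)
  fix n
  have "cpoly_dim {0} = 0"
    by (rule cpoly.dim_unique[of "{}"]) (simp_all add: cpoly.independent_empty)
  then show "fps_nth (molien_series G2) n = fps_nth jacobi_dim_series n"
    unfolding G2.molien jacobi_dim_series_def jacobi_algebra_part_eq[symmetric]
    using jacobi_algebra_part_trivial[of n] by (simp add: dvd_eq_mod_eq_0)
qed

section \<open>Characteristic polynomials\<close>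

lemma det_4:
  fixes A :: "'a::comm_ring_1 ^ (bit ^ 2) ^ (bit ^ 2)"
  defines "m \<equiv> \<lambda>i j. A $ pt i $ pt j"
  shows "det A =
      m 0 0 * (m 1 1 * (m 2 2 * m 3 3 - m 2 3 * m 3 2) - m 1 2 * (m 2 1 * m 3 3 - m 2 3 * m 3 1)
        + m 1 3 * (m 2 1 * m 3 2 - m 2 2 * m 3 1))
    - m 0 1 * (m 1 0 * (m 2 2 * m 3 3 - m 2 3 * m 3 2) - m 1 2 * (m 2 0 * m 3 3 - m 2 3 * m 3 0)
        + m 1 3 * (m 2 0 * m 3 2 - m 2 2 * m 3 0))
    + m 0 2 * (m 1 0 * (m 2 1 * m 3 3 - m 2 3 * m 3 1) - m 1 1 * (m 2 0 * m 3 3 - m 2 3 * m 3 0)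
        + m 1 3 * (m 2 0 * m 3 1 - m 2 1 * m 3 0))
    - m 0 3 * (m 1 0 * (m 2 1 * m 3 2 - m 2 2 * m 3 1) - m 1 1 * (m 2 0 * m 3 2 - m 2 2 * m 3 0)
        + m 1 2 * (m 2 0 * m 3 1 - m 2 1 * m 3 0))"
proof -
  have f1: "finite {pt 1, pt 2, pt 3}" "pt 0 \<notin> {pt 1, pt 2, pt 3}" by simp_all
  have f2: "finite {pt 2, pt 3}" "pt 1 \<notin> {pt 2, pt 3}" by simp_all
  have f3: "finite {pt 3}" "pt 2 \<notin> {pt 3}" by simp_all
  show ?thesis
    unfolding det_def UNIV_pt
    unfolding sum_over_permutations_insert[OF f1]
    unfolding sum_over_permutations_insert[OF f2]
    unfolding sum_over_permutations_insert[OF f3]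
    unfolding permutes_sing m_def
    by (simp add: sign_swap_id permutation_swap_id permutation_compose sign_compose sign_id
        swap_id_eq Transposition.transpose_def algebra_simps)
qed

section \<open>Coefficients of the characteristic polynomial from principal minors\<close>

fun det2 :: "gint \<Rightarrow> gint \<Rightarrow> gint \<Rightarrow> gint \<Rightarrow> gint" where
  "det2 a b c d = gsub (gmul a d) (gmul b c)"

fun det3 :: "gint \<Rightarrow> gint \<Rightarrow> gint \<Rightarrow> gint \<Rightarrow> gint \<Rightarrow> gint \<Rightarrow> gint \<Rightarrow> gint \<Rightarrow> gint \<Rightarrow> gint" where
  "det3 a b c d e f g h i =
     gadd (gsub (gmul a (det2 e f h i)) (gmul b (det2 d f g i))) (gmul c (det2 d e g h))"

type_synonym minors = "gint \<times> gint \<times> gint \<times> gint \<times> gint \<times> gint \<times> gint \<times> gint \<times> gint \<times> gint \<times>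
  gint \<times> gint \<times> gint \<times> gint \<times> gint"

type_synonym coeffs = "gint \<times> gint \<times> gint \<times> gint"

text \<open>The 15 principal minors, ordered by size. One evaluation serves all 32 diagonal factors
  of \<open>diags\<close>.\<close>

fun minors :: "gmat \<Rightarrow> minors" where
  "minors [[a00,a01,a02,a03],[a10,a11,a12,a13],[a20,a21,a22,a23],[a30,a31,a32,a33]] =
    (a00, a11, a22, a33,
     det2 a00 a01 a10 a11, det2 a00 a02 a20 a22, det2 a00 a03 a30 a33,
     det2 a11 a12 a21 a22, det2 a11 a13 a31 a33, det2 a22 a23 a32 a33,
     det3 a00 a01 a02 a10 a11 a12 a20 a21 a22, det3 a00 a01 a03 a10 a11 a13 a30 a31 a33,
     det3 a00 a02 a03 a20 a22 a23 a30 a32 a33, det3 a11 a12 a13 a21 a22 a23 a31 a32 a33,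
     gsub (gadd (gsub (gmul a00 (det3 a11 a12 a13 a21 a22 a23 a31 a32 a33))
       (gmul a01 (det3 a10 a12 a13 a20 a22 a23 a30 a32 a33)))
       (gmul a02 (det3 a10 a11 a13 a20 a21 a23 a30 a31 a33)))
       (gmul a03 (det3 a10 a11 a12 a20 a21 a22 a30 a31 a32)))"

text \<open>The principal minors of \<open>D M\<close>, for \<open>D = diag(1, d\<^sub>1, d\<^sub>2, d\<^sub>3)\<close>, are those of \<open>M\<close> times
  products of the \<open>d\<^sub>i\<close>.\<close>
fun char_coeffs :: "minors \<Rightarrow> gint \<times> gint \<times> gint \<Rightarrow> coeffs" where
  "char_coeffs (m0,m1,m2,m3,m01,m02,m03,m12,m13,m23,m012,m013,m023,m123,m) (d1,d2,d3) =
    (let d12 = gmul d1 d2; d13 = gmul d1 d3; d23 = gmul d2 d3; d123 = gmul d12 d3 in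
    (gadd m0 (gadd (gmul d1 m1) (gadd (gmul d2 m2) (gmul d3 m3))),
     gadd (gmul d1 m01) (gadd (gmul d2 m02) (gadd (gmul d3 m03)
       (gadd (gmul d12 m12) (gadd (gmul d13 m13) (gmul d23 m23))))),
     gadd (gmul d12 m012) (gadd (gmul d13 m013) (gadd (gmul d23 m023) (gmul d123 m123))),
     gmul d123 m))"

definition char_fps :: "complex \<Rightarrow> complex \<Rightarrow> complex \<Rightarrow> complex \<Rightarrow> complex fps" where
  "char_fps e1 e2 e3 e4 = 1 - fps_const e1 * fps_X + fps_const e2 * fps_X ^ 2
     - fps_const e3 * fps_X ^ 3 + fps_const e4 * fps_X ^ 4"

text \<open>The tables hold twice the matrix, so minors of size k carry the factor 2^k.\<close>

fun coeffs_fps :: "coeffs \<Rightarrow> complex fps" where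
  "coeffs_fps (e1, e2, e3, e4) = char_fps (gi e1 / 2) (gi e2 / 4) (gi e3 / 8) (gi e4 / 16)"

section \<open>Replacing t by ct, and the part of a series in degrees divisible by 8\<close>

definition scale_fps :: "complex \<Rightarrow> complex fps \<Rightarrow> complex fps" where
  "scale_fps c f = Abs_fps (\<lambda>n. c ^ n * fps_nth f n)"

lemma scale_fps_mult: "scale_fps c (f * g) = scale_fps c f * scale_fps c g"
proof (rule fps_ext)
  fix n
  have *: "c ^ n * (fps_nth f i * fps_nth g (n - i)) = c ^ i * fps_nth f i * (c ^ (n - i) * fps_nth g (n - i))"
    if "i \<in> {0..n}" for i
    using that power_add[of c i "n - i"] by (simp add: mult_ac)
  show "fps_nth (scale_fps c (f * g)) n = fps_nth (scale_fps c f * scale_fps c g) n"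
    unfolding scale_fps_def fps_mult_nth fps_nth_Abs_fps sum_distrib_left
    by (intro sum.cong refl *)
qed

lemma scale_fps_1: "scale_fps c 1 = 1"
  by (rule fps_ext) (simp add: scale_fps_def)

lemma scale_char_fps:
  "scale_fps c (char_fps e1 e2 e3 e4) = char_fps (c * e1) (c ^ 2 * e2) (c ^ 3 * e3) (c ^ 4 * e4)"
  by (rule fps_ext)
    (auto simp: scale_fps_def char_fps_def fps_X_power_iff algebra_simps)

lemma char_fps_nth_0: "fps_nth (char_fps e1 e2 e3 e4) 0 = 1"
  by (simp add: char_fps_def)

lemma fps_divide_eqI:
  assumes "f * g = (1 :: complex fps)"
  shows "1 / f = g"
  using assms by (metis mult_zero_left nonzero_mult_div_cancel_left zero_neq_one)

lemma fps_inverse_mult: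
  assumes "fps_nth (f :: complex fps) 0 \<noteq> 0"
  shows "f * (1 / f) = 1"
  using assms by (simp add: fps_divide_unit inverse_mult_eq_1')

definition octal :: "complex fps \<Rightarrow> complex fps" where
  "octal f = Abs_fps (\<lambda>n. if 8 dvd n then fps_nth f n else 0)"

lemma octal_scale:
  assumes "c ^ 8 = 1"
  shows "octal (scale_fps c f) = octal f"
proof (rule fps_ext)
  fix n
  have "c ^ n = 1" if "8 dvd n"
    using that assms by (auto simp: power_mult)
  then show "fps_nth (octal (scale_fps c f)) n = fps_nth (octal f) n"
    by (simp add: octal_def scale_fps_def)
qed

text \<open>Replacing t by ct multiplies the coefficient of t^n by c^n, which is 1 whenever 8
  divides n; inversion and squaring commute with this substitution.\<close>

lemma octal_inverse_square_scale:
  assumes "c ^ 8 = 1" "fps_nth f 0 \<noteq> 0"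
  shows "octal (1 / (scale_fps c f)\<^sup>2) = octal (1 / f\<^sup>2)"
proof -
  have "f\<^sup>2 * (1 / f\<^sup>2) = 1"
    by (rule fps_inverse_mult) (use assms(2) in \<open>simp add: power2_eq_square\<close>)
  then have "scale_fps c (f\<^sup>2) * scale_fps c (1 / f\<^sup>2) = 1"
    using scale_fps_mult[of c "f\<^sup>2" "1 / f\<^sup>2"] by (simp only: scale_fps_1)
  then have "1 / scale_fps c (f\<^sup>2) = scale_fps c (1 / f\<^sup>2)"
    by (rule fps_divide_eqI)
  moreover have "scale_fps c (f\<^sup>2) = (scale_fps c f)\<^sup>2"
    by (simp add: power2_eq_square scale_fps_mult)
  ultimately show ?thesis
    using octal_scale[OF assms(1), of "1 / f\<^sup>2"] by simp
qed

text \<open>The left side is the expansion of det(1 - xN) in the form produced by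
  \<open>det_4\<close>, with N generic; the right side collects the principal minors of each
  size.\<close>

lemma det_1_minus_identity:
  fixes x :: "'a::comm_ring_1"
  shows "(1 - x*n00) * ((1 - x*n11) * ((1 - x*n22) * (1 - x*n33) - (- (x*n23)) * (- (x*n32))) - (- (x*n12)) * ((- (x*n21)) * (1 - x*n33) - (- (x*n23)) * (- (x*n31)))
        + (- (x*n13)) * ((- (x*n21)) * (- (x*n32)) - (1 - x*n22) * (- (x*n31))))
    - (- (x*n01)) * ((- (x*n10)) * ((1 - x*n22) * (1 - x*n33) - (- (x*n23)) * (- (x*n32))) - (- (x*n12)) * ((- (x*n20)) * (1 - x*n33) - (- (x*n23)) * (- (x*n30)))
        + (- (x*n13)) * ((- (x*n20)) * (- (x*n32)) - (1 - x*n22) * (- (x*n30))))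
    + (- (x*n02)) * ((- (x*n10)) * ((- (x*n21)) * (1 - x*n33) - (- (x*n23)) * (- (x*n31))) - (1 - x*n11) * ((- (x*n20)) * (1 - x*n33) - (- (x*n23)) * (- (x*n30)))
        + (- (x*n13)) * ((- (x*n20)) * (- (x*n31)) - (- (x*n21)) * (- (x*n30))))
    - (- (x*n03)) * ((- (x*n10)) * ((- (x*n21)) * (- (x*n32)) - (1 - x*n22) * (- (x*n31))) - (1 - x*n11) * ((- (x*n20)) * (- (x*n32)) - (1 - x*n22) * (- (x*n30)))
        + (- (x*n12)) * ((- (x*n20)) * (- (x*n31)) - (- (x*n21)) * (- (x*n30))))
   = 1 - (n00 + n11 + n22 + n33) * x
     + ((n00*n11-n01*n10) + (n00*n22-n02*n20) + (n00*n33-n03*n30)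
        + (n11*n22-n12*n21) + (n11*n33-n13*n31) + (n22*n33-n23*n32)) * x^2
     - ((n00*(n11*n22-n12*n21) - n01*(n10*n22-n12*n20) + n02*(n10*n21-n11*n20))
        + (n00*(n11*n33-n13*n31) - n01*(n10*n33-n13*n30) + n03*(n10*n31-n11*n30))
        + (n00*(n22*n33-n23*n32) - n02*(n20*n33-n23*n30) + n03*(n20*n32-n22*n30))
        + (n11*(n22*n33-n23*n32) - n12*(n21*n33-n23*n31) + n13*(n21*n32-n22*n31))) * x^3
     + (n00*(n11*(n22*n33-n23*n32) - n12*(n21*n33-n23*n31) + n13*(n21*n32-n22*n31))
        - n01*(n10*(n22*n33-n23*n32) - n12*(n20*n33-n23*n30) + n13*(n20*n32-n22*n30))
        + n02*(n10*(n21*n33-n23*n31) - n11*(n20*n33-n23*n30) + n13*(n20*n31-n21*n30))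
        - n03*(n10*(n21*n32-n22*n31) - n11*(n20*n32-n22*n30) + n12*(n20*n31-n21*n30))) * x^4"
  by (simp add: algebra_simps power2_eq_square power3_eq_cube power4_eq_xxxx)

lemma det_pencil:
  fixes A :: cmat4
  defines "n \<equiv> \<lambda>i j. A $ pt i $ pt j"
  shows "det (pencil A) = char_fps (n 0 0 + n 1 1 + n 2 2 + n 3 3)
    ((n 0 0 * n 1 1 - n 0 1 * n 1 0) + (n 0 0 * n 2 2 - n 0 2 * n 2 0) + (n 0 0 * n 3 3 - n 0 3 * n 3 0)
     + (n 1 1 * n 2 2 - n 1 2 * n 2 1) + (n 1 1 * n 3 3 - n 1 3 * n 3 1) + (n 2 2 * n 3 3 - n 2 3 * n 3 2))
    ((n 0 0 * (n 1 1 * n 2 2 - n 1 2 * n 2 1) - n 0 1 * (n 1 0 * n 2 2 - n 1 2 * n 2 0) + n 0 2 * (n 1 0 * n 2 1 - n 1 1 * n 2 0))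
     + (n 0 0 * (n 1 1 * n 3 3 - n 1 3 * n 3 1) - n 0 1 * (n 1 0 * n 3 3 - n 1 3 * n 3 0) + n 0 3 * (n 1 0 * n 3 1 - n 1 1 * n 3 0))
     + (n 0 0 * (n 2 2 * n 3 3 - n 2 3 * n 3 2) - n 0 2 * (n 2 0 * n 3 3 - n 2 3 * n 3 0) + n 0 3 * (n 2 0 * n 3 2 - n 2 2 * n 3 0))
     + (n 1 1 * (n 2 2 * n 3 3 - n 2 3 * n 3 2) - n 1 2 * (n 2 1 * n 3 3 - n 2 3 * n 3 1) + n 1 3 * (n 2 1 * n 3 2 - n 2 2 * n 3 1)))
    (n 0 0 * (n 1 1 * (n 2 2 * n 3 3 - n 2 3 * n 3 2) - n 1 2 * (n 2 1 * n 3 3 - n 2 3 * n 3 1) + n 1 3 * (n 2 1 * n 3 2 - n 2 2 * n 3 1))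
     - n 0 1 * (n 1 0 * (n 2 2 * n 3 3 - n 2 3 * n 3 2) - n 1 2 * (n 2 0 * n 3 3 - n 2 3 * n 3 0) + n 1 3 * (n 2 0 * n 3 2 - n 2 2 * n 3 0))
     + n 0 2 * (n 1 0 * (n 2 1 * n 3 3 - n 2 3 * n 3 1) - n 1 1 * (n 2 0 * n 3 3 - n 2 3 * n 3 0) + n 1 3 * (n 2 0 * n 3 1 - n 2 1 * n 3 0))
     - n 0 3 * (n 1 0 * (n 2 1 * n 3 2 - n 2 2 * n 3 1) - n 1 1 * (n 2 0 * n 3 2 - n 2 2 * n 3 0) + n 1 2 * (n 2 0 * n 3 1 - n 2 1 * n 3 0)))"
proof -
  define N where "N i j = fps_const (n i j)" for i j
  have diag: "pencil A $ pt i $ pt i = 1 - fps_X * N i i" for i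
    by (simp add: pencil_def mat_def N_def n_def)
  have off: "pencil A $ pt i $ pt j = - (fps_X * N i j)" if "pt i \<noteq> pt j" for i j
    using that by (simp add: pencil_def mat_def N_def n_def)
  show ?thesis
    by (simp only: det_4 diag off pt_neq One_nat_def not_False_eq_True det_1_minus_identity)
      (simp add: N_def char_fps_def)
qed

lemma arg_cong4: "a = a' \<Longrightarrow> b = b' \<Longrightarrow> c = c' \<Longrightarrow> d = d' \<Longrightarrow> f a b c d = f a' b' c' d'"
  by simp

lemma gint_matrix_shape:
  fixes M :: gmat
  assumes "length M = 4" "\<forall>r\<in>set M. length r = 4"
  obtains a00 a01 a02 a03 a10 a11 a12 a13 a20 a21 a22 a23 a30 a31 a32 a33 where
    "M = [[a00,a01,a02,a03],[a10,a11,a12,a13],[a20,a21,a22,a23],[a30,a31,a32,a33]]"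
proof -
  obtain r0 r1 r2 r3 where M: "M = [r0, r1, r2, r3]"
    using assms(1) by (auto simp: numeral_eq_Suc length_Suc_conv)
  have row: "\<exists>a b c d. r = [a, b, c, d]" if "length r = 4" for r :: "gint list"
    using that by (auto simp: numeral_eq_Suc length_Suc_conv)
  have len: "length r0 = 4" "length r1 = 4" "length r2 = 4" "length r3 = 4"
    using assms(2) by (simp_all add: M)
  obtain a00 a01 a02 a03 where 0: "r0 = [a00,a01,a02,a03]" using row[OF len(1)] by blast
  obtain a10 a11 a12 a13 where 1: "r1 = [a10,a11,a12,a13]" using row[OF len(2)] by blast
  obtain a20 a21 a22 a23 where 2: "r2 = [a20,a21,a22,a23]" using row[OF len(3)] by blast
  obtain a30 a31 a32 a33 where 3: "r3 = [a30,a31,a32,a33]" using row[OF len(4)] by blast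
  show thesis by (rule that[OF M[unfolded 0 1 2 3]])
qed

lemma det_pencil_coeffs:
  assumes "length M = 4" "\<forall>r\<in>set M. length r = 4"
  shows "det (pencil (\<chi> a b. diag_fun d a * (gi (M ! idx a ! idx b) / 2))) = coeffs_fps (char_coeffs (minors M) d)"
proof -
  obtain a00 a01 a02 a03 a10 a11 a12 a13 a20 a21 a22 a23 a30 a31 a32 a33 where
    M: "M = [[a00,a01,a02,a03],[a10,a11,a12,a13],[a20,a21,a22,a23],[a30,a31,a32,a33]]"
    by (rule gint_matrix_shape[OF assms])
  obtain d1 d2 d3 where d: "d = (d1, d2, d3)" by (cases d)
  let ?A = "\<chi> a b. diag_fun d a * (gi (M ! idx a ! idx b) / 2)"
  have row: "?A $ pt 0 $ b = gi (M ! 0 ! idx b) / 2" "?A $ pt (Suc 0) $ b = gi d1 * (gi (M ! Suc 0 ! idx b) / 2)"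
    "?A $ pt 2 $ b = gi d2 * (gi (M ! 2 ! idx b) / 2)" "?A $ pt 3 $ b = gi d3 * (gi (M ! 3 ! idx b) / 2)" for b
    unfolding d by (simp_all add: gi_1)
  have nth: "[a, b, c, e] ! 0 = a" "[a, b, c, e] ! Suc 0 = b" "[a, b, c, e] ! 2 = c" "[a, b, c, e] ! 3 = e"
    for a b c e :: 'a
    by simp_all
  show ?thesis
    unfolding det_pencil One_nat_def row idx_pt(1,3,4) idx_pt(2)[unfolded One_nat_def]
    unfolding M nth d
    unfolding minors.simps char_coeffs.simps Let_def coeffs_fps.simps det2.simps det3.simps
      gi_gadd gi_gsub gi_gmul
    by (intro arg_cong4[where f = char_fps]) (simp_all add: field_simps)
qed

section \<open>Summation over the group\<close>

fun rotate_coeffs :: "gint \<Rightarrow> coeffs \<Rightarrow> coeffs" where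
  "rotate_coeffs u (e1, e2, e3, e4) =
    (gmul u e1, gmul (gmul u u) e2, gmul (gmul u (gmul u u)) e3, gmul (gmul (gmul u u) (gmul u u)) e4)"

text \<open>Of the four rotations of a coefficient vector we choose the one that moves the first nonzero
  entry to a fixed sector.\<close>

fun sector :: "gint \<Rightarrow> gint" where
  "sector (a, b) = (if 0 < a then (if 0 \<le> b then (1,0) else (0,1))
     else if 0 < b then (0,-1) else if 0 \<le> a then (0,1) else (-1,0))"

text \<open>A unit multiplies the second coefficient by its own square, which is 1 or -1, so only 1
  and i need to be distinguished.\<close>

fun half_plane :: "gint \<Rightarrow> gint" where
  "half_plane (a, b) = (if 0 < a then (1,0) else if 0 < b then (1,0) else (0,1))"

fun canonical :: "coeffs \<Rightarrow> coeffs" where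
  "canonical (e1, e2, e3, e4) = (if e1 \<noteq> (0,0) then rotate_coeffs (sector e1) (e1, e2, e3, e4)
     else if e2 \<noteq> (0,0) then rotate_coeffs (half_plane e2) (e1, e2, e3, e4) else (e1, e2, e3, e4))"

text \<open>The contribution of one matrix of size 4: the determinant is squared because the same
  block acts on the x and on the y variables.\<close>

definition term_fps :: "coeffs \<Rightarrow> complex fps" where
  "term_fps e = octal (1 / (coeffs_fps e)\<^sup>2)"

fun eq_coeffs :: "coeffs \<Rightarrow> coeffs \<Rightarrow> bool" where
  "eq_coeffs (e1, e2, e3, e4) (f1, f2, f3, f4) \<longleftrightarrow>
     (if e1 = f1 then if e2 = f2 then if e3 = f3 then e4 = f4 else False else False else False)"

fun bump :: "coeffs \<Rightarrow> (coeffs \<times> int) list \<Rightarrow> (coeffs \<times> int) list" where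
  "bump e [] = [(e, 1)]"
| "bump e ((f, k) # t) = (if eq_coeffs e f then (f, k + 1) # t else (f, k) # bump e t)"

definition tally_diags :: "minors \<Rightarrow> (coeffs \<times> int) list \<Rightarrow> (coeffs \<times> int) list" where
  "tally_diags m t = fold (\<lambda>d. bump (canonical (char_coeffs m d))) diags t"

definition tally_perms :: "gmat \<Rightarrow> (coeffs \<times> int) list \<Rightarrow> (coeffs \<times> int) list" where
  "tally_perms M t = fold (\<lambda>p. tally_diags (minors (map (\<lambda>i. M ! i) p))) perms t"

text \<open>The multiset of rotated coefficient vectors of the 15 * 24 * 32 = 11520 matrices without
  scalar factor.\<close>

definition tally :: "(coeffs \<times> int) list" where
  "tally = fold tally_perms frames []"

definition tally_sum :: "(coeffs \<times> int) list \<Rightarrow> complex fps" where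
  "tally_sum t = (\<Sum>(e, k)\<leftarrow>t. of_int k * term_fps e)"

lemma coeffs_fps_rotate: "coeffs_fps (rotate_coeffs u e) = scale_fps (gi u) (coeffs_fps e)"
  by (cases e) (simp add: scale_char_fps gi_gmul power2_eq_square power3_eq_cube power4_eq_xxxx mult.assoc)

lemma term_fps_rotate:
  assumes "u \<in> set units"
  shows "term_fps (rotate_coeffs u e) = term_fps e"
proof -
  have "gi u ^ 4 = 1" using assms gi_units unfolding power4_eq_1_iff by blast
  then have "(gi u ^ 4)\<^sup>2 = 1" by simp
  then have "gi u ^ 8 = 1" by (simp flip: power_mult)
  then show ?thesis
    unfolding term_fps_def coeffs_fps_rotate
    by (rule octal_inverse_square_scale) (cases e, simp add: char_fps_nth_0)
qed

lemma eq_coeffs_iff: "eq_coeffs e f \<longleftrightarrow> e = f"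
  by (cases e; cases f) auto

lemma tally_sum_bump: "tally_sum (bump e t) = tally_sum t + term_fps e"
  by (induction t) (auto simp: tally_sum_def eq_coeffs_iff distrib_right add_ac)

text \<open>All that matters is that \<open>sector\<close> and \<open>half_plane\<close> return
  units; how well the rotations are chosen only affects the number of entries in the tally.\<close>

lemma term_fps_canonical: "term_fps (canonical e) = term_fps e"
proof -
  have "sector z \<in> set units" "half_plane z \<in> set units" for z
    by (cases z; simp add: units_def)+
  then show ?thesis
    by (cases e) (simp add: term_fps_rotate del: rotate_coeffs.simps)
qed

lemma tally_sum_fold:
  assumes "\<And>x t. tally_sum (f x t) = tally_sum t + g x"
  shows "tally_sum (fold f xs t) = tally_sum t + (\<Sum>x\<leftarrow>xs. g x)"
  by (induction xs arbitrary: t) (simp_all add: assms add.assoc)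

lemma tally_sum_tally:
  "tally_sum tally = (\<Sum>M\<leftarrow>frames. \<Sum>p\<leftarrow>perms. \<Sum>d\<leftarrow>diags. term_fps (char_coeffs (minors (map (\<lambda>i. M ! i) p)) d))"
proof -
  have "tally_sum (tally_diags m t) = tally_sum t + (\<Sum>d\<leftarrow>diags. term_fps (char_coeffs m d))" for m t
    unfolding tally_diags_def by (rule tally_sum_fold) (simp only: tally_sum_bump term_fps_canonical)
  then have "tally_sum (tally_perms M t) = tally_sum t
      + (\<Sum>p\<leftarrow>perms. \<Sum>d\<leftarrow>diags. term_fps (char_coeffs (minors (map (\<lambda>i. M ! i) p)) d))" for M t
    unfolding tally_perms_def by (rule tally_sum_fold)
  then have "tally_sum tally = tally_sum []
      + (\<Sum>M\<leftarrow>frames. \<Sum>p\<leftarrow>perms. \<Sum>d\<leftarrow>diags. term_fps (char_coeffs (minors (map (\<lambda>i. M ! i) p)) d))"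
    unfolding tally_def by (rule tally_sum_fold)
  then show ?thesis by (simp add: tally_sum_def)
qed

lemma det_pencil_scale:
  fixes A :: cmat4
  shows "det (pencil (\<chi> a b. c * A $ a $ b)) = scale_fps c (det (pencil A))"
  unfolding det_pencil scale_char_fps vec_lambda_beta
  by (intro arg_cong4[where f = char_fps])
    (simp_all add: algebra_simps power2_eq_square power3_eq_cube power4_eq_xxxx)

lemma octal_det_G2_elt:
  assumes "(k, j, p, d) \<in> G2_index"
  shows "octal (1 / (det (pencil (G2_elt (k, j, p, d))))\<^sup>2)
    = term_fps (char_coeffs (minors (map (\<lambda>i. frames ! j ! i) p)) d)"
proof -
  have jp: "j < 15" "p \<in> set perms" using assms by (auto simp: G2_index_def)
  let ?M = "map (\<lambda>i. frames ! j ! i) p"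
  let ?A = "\<chi> a b. diag_fun d a * (gi (?M ! idx a ! idx b) / 2)"
  have p: "length p = 4" "\<And>i. i < 4 \<Longrightarrow> p ! i < 4"
    using jp(2) nth_mem[of _ p] unfolding perms_iff by (auto simp del: nth_mem)
  have frames: "length (frames ! j) = 4" "\<forall>r\<in>set (frames ! j). length r = 4"
  proof -
    have "frames ! j \<in> set frames" using jp(1) frames_shape(1) by simp
    then show "length (frames ! j) = 4" "\<forall>r\<in>set (frames ! j). length r = 4"
      using frames_shape(2) by (simp_all add: list_all_iff)
  qed
  have shape: "length ?M = 4" "\<forall>r\<in>set ?M. length r = 4"
  proof -
    show "length ?M = 4" using p(1) by simp
    have "set p \<subseteq> {..<4}" using jp(2) by (simp add: perms_iff)
    then show "\<forall>r\<in>set ?M. length r = 4" using frames by auto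
  qed
  have elt: "G2_elt (k, j, p, d) = (\<chi> a b. eta8 ^ k * ?A $ a $ b)"
  proof -
    have fr: "frame j $ perm_fun p a $ b = gi (?M ! idx a ! idx b) / 2" for a b
      using p by (simp add: frame_def of_gmat_def perm_fun_def idx_pt_less)
    show ?thesis unfolding G2_elt.simps elt_def fr vec_lambda_beta mult.assoc ..
  qed
  have "(eta8 ^ k) ^ 8 = 1" by (metis eta8_power_8 mult.commute power_mult power_one)
  moreover have "fps_nth (det (pencil ?A)) 0 \<noteq> 0"
    by (simp add: det_pencil char_fps_nth_0)
  ultimately show ?thesis
    unfolding elt det_pencil_scale term_fps_def det_pencil_coeffs[OF shape, symmetric]
    by (rule octal_inverse_square_scale)
qed

lemma octal_add: "octal (f + g) = octal f + octal g"
  by (rule fps_ext) (simp add: octal_def)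

lemma octal_0 [simp]: "octal 0 = 0"
  by (rule fps_ext) (simp add: octal_def)

lemma octal_sum: "octal (sum f S) = (\<Sum>x\<in>S. octal (f x))"
  by (induction S rule: infinite_finite_induct) (simp_all add: octal_add)

lemma octal_const_mult: "octal (fps_const c * f) = fps_const c * octal f"
  by (rule fps_ext) (simp add: octal_def)

text \<open>The 8 scalars contribute equally in degrees divisible by 8, so the average over 92160
  elements is the tally divided by 11520.\<close>

lemma jacobi_dim_series_eq_tally: "fps_const 11520 * jacobi_dim_series = tally_sum tally"
proof -
  have oct: "octal jacobi_dim_series = jacobi_dim_series"
    by (rule fps_ext) (simp add: octal_def jacobi_dim_series_def dvd_eq_mod_eq_0)
  have frames_sum: "(\<Sum>M\<leftarrow>frames. g M) = (\<Sum>j<15. g (frames ! j))" for g :: "gmat \<Rightarrow> complex fps"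
    by (simp add: sum_list_sum_nth frames_shape(1) lessThan_atLeast0)
  have det: "octal (1 / det (id_minus_t (diag2 A))) = octal (1 / (det (pencil A))\<^sup>2)" if "A \<in> elts" for A
  proof -
    have mem: "diag2 A \<in> G2" using that by (simp add: G2_eq)
    obtain k where k: "k > 0" "\<And>v. ((*v) (diag2 A) ^^ k) v = v"
      using G2.finite_order[OF mem] by blast
    show ?thesis by (simp add: det_id_minus_t_diag2[OF k])
  qed
  have "octal (\<Sum>A\<in>G2. 1 / det (id_minus_t A)) = (\<Sum>A\<in>elts. octal (1 / det (id_minus_t (diag2 A))))"
    unfolding octal_sum G2_eq by (rule sum.reindex_cong[OF inj_on_subset[OF inj_diag2]]) auto
  also have "\<dots> = (\<Sum>A\<in>elts. octal (1 / (det (pencil A))\<^sup>2))"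
    by (intro sum.cong refl det)
  also have "\<dots> = (\<Sum>u\<in>G2_index. octal (1 / (det (pencil (G2_elt u)))\<^sup>2))"
    unfolding elts_eq_image by (rule sum.reindex_cong[OF inj_G2_elt]) auto
  also have "\<dots> = (\<Sum>(k, j, p, d)\<in>G2_index. term_fps (char_coeffs (minors (map (\<lambda>i. frames ! j ! i) p)) d))"
    by (intro sum.cong refl) (auto intro: octal_det_G2_elt simp del: G2_elt.simps)
  also have "\<dots> = (\<Sum>k<8::nat. \<Sum>j<15::nat. \<Sum>p\<in>set perms. \<Sum>d\<in>set diags.
      term_fps (char_coeffs (minors (map (\<lambda>i. frames ! j ! i) p)) d))"
    unfolding G2_index_def lessThan_atLeast0 by (simp add: sum.cartesian_product del: sum_constant)
  also have "\<dots> = (\<Sum>k<8::nat. tally_sum tally)"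
    unfolding tally_sum_tally frames_sum
    by (simp add: sum_list_distinct_conv_sum_set distinct_perms distinct_diags del: sum_constant)
  also have "\<dots> = 8 * tally_sum tally" by simp
  finally have sum: "octal (\<Sum>A\<in>G2. 1 / det (id_minus_t A)) = 8 * tally_sum tally" .
  have "jacobi_dim_series = octal (molien_series G2)" by (simp add: molien_series_eq oct)
  also have "\<dots> = fps_const (1 / 92160) * (8 * tally_sum tally)"
    unfolding molien_series_def octal_const_mult sum card_G2 by simp
  finally have "fps_const 11520 * jacobi_dim_series = fps_const 11520 * (fps_const (1 / 92160) * (fps_const 8 * tally_sum tally))"
    by (simp add: numeral_fps_const)
  also have "\<dots> = tally_sum tally"
    by (simp flip: mult.assoc)
  finally show ?thesis .
qed


section \<open>Polynomials as coefficient lists\<close>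

text \<open>Polynomials with Gaussian integer coefficients, lowest degree first; \<open>y\<close> is either the
  variable \<open>t\<close> or its power \<open>t\<^sup>8\<close>.\<close>

type_synonym gpoly = "gint list"

fun gpoly_eval :: "complex fps \<Rightarrow> gpoly \<Rightarrow> complex fps" where
  "gpoly_eval y [] = 0"
| "gpoly_eval y (a # p) = fps_const (gi a) + y * gpoly_eval y p"

fun gpoly_add :: "gpoly \<Rightarrow> gpoly \<Rightarrow> gpoly" where
  "gpoly_add [] q = q"
| "gpoly_add (a # p) [] = a # p"
| "gpoly_add (a # p) (b # q) = gadd a b # gpoly_add p q"

definition gpoly_smult :: "gint \<Rightarrow> gpoly \<Rightarrow> gpoly" where
  "gpoly_smult c p = map (gmul c) p"

fun gpoly_mult :: "gpoly \<Rightarrow> gpoly \<Rightarrow> gpoly" where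
  "gpoly_mult [] q = []"
| "gpoly_mult (a # p) q = gpoly_add (gpoly_smult a q) ((0,0) # gpoly_mult p q)"

text \<open>Equality up to trailing zeros, which lists obtained from products and padding may
  carry.\<close>

definition gpoly_eq :: "gpoly \<Rightarrow> gpoly \<Rightarrow> bool" where
  "gpoly_eq p q \<longleftrightarrow> list_all (\<lambda>a. a = (0,0)) (gpoly_add p (gpoly_smult (-1,0) q))"

fun sub_truncated :: "gpoly \<Rightarrow> gpoly \<Rightarrow> gpoly" where
  "sub_truncated [] q = []"
| "sub_truncated (a # p) [] = a # p"
| "sub_truncated (a # p) (b # q) = gsub a b # sub_truncated p q"

lemma length_sub_truncated [simp]: "length (sub_truncated p q) = length p"
  by (induction p q rule: sub_truncated.induct) auto

text \<open>The quotient as a truncated power series, for a divisor with constant term \<open>1\<close>.\<close>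
function series_div :: "gpoly \<Rightarrow> gpoly \<Rightarrow> gpoly" where
  "series_div [] q = []"
| "series_div (a # p) q = a # series_div (sub_truncated p (gpoly_smult a (tl q))) q"
  by pat_completeness auto
termination by (relation "Wellfounded.measure (length \<circ> fst)") auto

function every8 :: "gpoly \<Rightarrow> gpoly" where
  "every8 [] = []"
| "every8 (a # p) = a # every8 (drop 7 p)"
  by pat_completeness auto
termination by (relation "Wellfounded.measure length") auto

fun expand8 :: "gpoly \<Rightarrow> gpoly" where
  "expand8 [] = []"
| "expand8 (a # p) = a # replicate 7 (0,0) @ expand8 p"

lemma gpoly_eval_add: "gpoly_eval y (gpoly_add p q) = gpoly_eval y p + gpoly_eval y q"
  by (induction p q rule: gpoly_add.induct)
    (simp_all add: gi_gadd algebra_simps flip: fps_const_add)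

lemma gpoly_eval_smult: "gpoly_eval y (gpoly_smult c p) = fps_const (gi c) * gpoly_eval y p"
  by (induction p) (simp_all add: gpoly_smult_def gi_gmul distrib_left mult.left_commute flip: fps_const_mult)

lemma gpoly_eval_mult: "gpoly_eval y (gpoly_mult p q) = gpoly_eval y p * gpoly_eval y q"
  by (induction p) (simp_all add: gpoly_eval_add gpoly_eval_smult gi_0 distrib_right mult.assoc)

lemma gpoly_eval_eq:
  assumes "gpoly_eq p q"
  shows "gpoly_eval y p = gpoly_eval y q"
proof -
  have "list_all (\<lambda>a. a = (0,0)) r \<Longrightarrow> gpoly_eval y r = 0" for r
    by (induction r) (simp_all add: gi_0)
  then have "gpoly_eval y (gpoly_add p (gpoly_smult (-1,0) q)) = 0"
    using assms by (simp add: gpoly_eq_def)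
  then show ?thesis
    by (simp add: gpoly_eval_add gpoly_eval_smult gi_minus_1 flip: fps_const_neg)
qed

lemma gpoly_eval_append: "gpoly_eval y (p @ q) = gpoly_eval y p + y ^ length p * gpoly_eval y q"
  by (induction p) (simp_all add: algebra_simps)

lemma gpoly_eval_expand8: "gpoly_eval fps_X (expand8 p) = gpoly_eval (fps_X ^ 8) p"
proof -
  have zero: "gpoly_eval y (replicate n (0,0)) = 0" for y n
    by (induction n) (simp_all add: gi_0)
  have X: "fps_X * (fps_X ^ 7 * f) = fps_X ^ 8 * f" for f :: "complex fps"
    by (simp add: mult.assoc[symmetric] flip: power_Suc)
  show ?thesis
    by (induction p) (simp_all only: expand8.simps gpoly_eval.simps gpoly_eval_append zero length_replicate add_0_left X)
qed

lemma octal_const: "octal (fps_const c) = fps_const c"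
  by (rule fps_ext) (simp add: octal_def)

lemma octal_X_power_8_mult: "octal (fps_X ^ 8 * f) = fps_X ^ 8 * octal f"
proof (rule fps_ext)
  fix n
  have "8 dvd n \<longleftrightarrow> 8 dvd (n - 8)" if "\<not> n < 8" for n :: nat
    using that by presburger
  then show "fps_nth (octal (fps_X ^ 8 * f)) n = fps_nth (fps_X ^ 8 * octal f) n"
    by (auto simp: octal_def fps_X_power_mult_nth)
qed

lemma gpoly_eval_nth: "fps_nth (gpoly_eval fps_X p) n = (if n < length p then gi (p ! n) else 0)"
proof (induction p arbitrary: n)
  case (Cons a p)
  then show ?case by (cases n) simp_all
qed simp

lemma octal_gpoly_eval: "octal (gpoly_eval fps_X p) = gpoly_eval (fps_X ^ 8) (every8 p)"
proof (induction p rule: every8.induct)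
  case (2 a p)
  have "gpoly_eval fps_X (a # p) = gpoly_eval fps_X ((a # take 7 p) @ drop 7 p)" by simp
  also have "\<dots> = gpoly_eval fps_X (a # take 7 p) + fps_X ^ 8 * gpoly_eval fps_X (drop 7 p)"
  proof (cases "length p < 7")
    case True
    then show ?thesis by simp
  next
    case False
    then have "length (a # take 7 p) = 8" by simp
    then show ?thesis unfolding gpoly_eval_append by (simp only:)
  qed
  finally have split: "gpoly_eval fps_X (a # p) = \<dots>" .
  have "octal (gpoly_eval fps_X (a # take 7 p)) = fps_const (gi a)"
  proof (rule fps_ext)
    fix n
    have "n = 0" if "8 dvd n" "n < Suc (min (length p) 7)" using that by (auto elim!: dvdE)
    then show "fps_nth (octal (gpoly_eval fps_X (a # take 7 p))) n = fps_nth (fps_const (gi a)) n"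
      unfolding octal_def fps_nth_Abs_fps gpoly_eval_nth by auto
  qed
  then show ?case
    unfolding split octal_add octal_X_power_8_mult using 2 by simp
qed simp

lemma octal_gpoly_eval_8: "octal (gpoly_eval (fps_X ^ 8) p) = gpoly_eval (fps_X ^ 8) p"
  by (induction p) (simp_all add: octal_add octal_const octal_X_power_8_mult)

text \<open>Multiplication by a series in t^8 shifts exponents only by multiples of 8. A denominator
  in t^8 can therefore be cleared before the extraction.\<close>

lemma octal_mult:
  assumes "octal g = g"
  shows "octal (f * g) = octal f * g"
proof (rule fps_ext)
  fix n
  have g: "fps_nth g m = 0" if "\<not> 8 dvd m" for m
  proof -
    have "fps_nth (octal g) m = 0" using that by (simp add: octal_def)
    then show ?thesis by (simp only: assms)
  qed
  have "fps_nth (octal (f * g)) n = (\<Sum>i=0..n. if 8 dvd n then fps_nth f i * fps_nth g (n - i) else 0)"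
    by (simp add: octal_def fps_mult_nth)
  also have "\<dots> = (\<Sum>i=0..n. fps_nth (octal f) i * fps_nth g (n - i))"
  proof (intro sum.cong refl)
    fix i assume "i \<in> {0..n}"
    then have "8 dvd (n - i) \<Longrightarrow> 8 dvd n \<longleftrightarrow> 8 dvd i"
      by (simp add: dvd_diff_nat) presburger
    then show "(if 8 dvd n then fps_nth f i * fps_nth g (n - i) else 0) = fps_nth (octal f) i * fps_nth g (n - i)"
      using g[of "n - i"] by (cases "8 dvd (n - i)") (simp_all add: octal_def)
  qed
  finally show "fps_nth (octal (f * g)) n = fps_nth (octal f * g) n"
    by (simp add: fps_mult_nth)
qed

section \<open>The rational generating function\<close>

text \<open>The rounding division is certified as exact by the first clause of
  \<open>class_ok\<close>: the vectors in the tally belong to polynomials with Gaussian integer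
  coefficients.\<close>

fun unscale_coeffs :: "coeffs \<Rightarrow> coeffs" where
  "unscale_coeffs ((a1,b1), (a2,b2), (a3,b3), (a4,b4)) =
    ((a1 div 2, b1 div 2), (a2 div 4, b2 div 4), (a3 div 8, b3 div 8), (a4 div 16, b4 div 16))"

fun scale_coeffs :: "coeffs \<Rightarrow> coeffs" where
  "scale_coeffs (e1, e2, e3, e4) = (gmul (2,0) e1, gmul (4,0) e2, gmul (8,0) e3, gmul (16,0) e4)"

fun char_gpoly :: "coeffs \<Rightarrow> gpoly" where
  "char_gpoly (e1, e2, e3, e4) = [(1,0), gmul (-1,0) e1, e2, gmul (-1,0) e3, e4]"

definition one_minus_power :: "nat \<Rightarrow> gpoly" where
  "one_minus_power k = (1,0) # replicate (k - 1) (0,0) @ [(-1,0)]"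

fun gpoly_power :: "gpoly \<Rightarrow> nat \<Rightarrow> gpoly" where
  "gpoly_power p 0 = [(1,0)]"
| "gpoly_power p (Suc k) = gpoly_mult p (gpoly_power p k)"

text \<open>The denominator of the theorem as a polynomial in \<open>s = t\<^sup>8\<close>, and its multiple by
  \<open>(1 - s)\<^sup>6\<close>, which is divisible in \<open>t\<close> by the square of every characteristic polynomial that
  occurs.\<close>

definition denom :: gpoly where
  "denom = gpoly_mult (gpoly_power (one_minus_power 1) 2)
     (gpoly_mult (gpoly_power (one_minus_power 3) 4) (gpoly_power (one_minus_power 5) 2))"

definition common_denom :: gpoly where
  "common_denom = gpoly_mult (gpoly_power (one_minus_power 1) 6) denom"

definition numer :: gpoly where
  "numer = map (\<lambda>a. (a, 0)) [1, 8, 49, 325, 1240, 3421, 7987, 15287, 24892, 35648, 45097, 50365,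
     50365, 45097, 35648, 24892, 15287, 7987, 3421, 1240, 325, 49, 8, 1]"

definition initial_dims :: gpoly where
  "initial_dims = map (\<lambda>a. (a, 0)) [1, 10, 68, 455, 2114, 7392]"

fun square_gpoly :: "coeffs \<Rightarrow> gpoly" where
  "square_gpoly e = (let q = char_gpoly (unscale_coeffs e) in gpoly_mult q q)"

fun cofactor :: "coeffs \<Rightarrow> gpoly" where
  "cofactor e = series_div (expand8 common_denom) (square_gpoly e)"

text \<open>The quotient by \<open>series_div\<close> is not assumed to be exact; multiplying it
  back certifies that the squared characteristic polynomial divides the common denominator.\<close>

definition class_ok :: "coeffs \<Rightarrow> bool" where
  "class_ok e \<longleftrightarrow> scale_coeffs (unscale_coeffs e) = e \<and>
     gpoly_eq (gpoly_mult (square_gpoly e) (cofactor e)) (expand8 common_denom)"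

fun weighted_sum :: "(coeffs \<times> int) list \<Rightarrow> gpoly" where
  "weighted_sum [] = []"
| "weighted_sum ((e, k) # t) = gpoly_add (gpoly_smult (k, 0) (every8 (cofactor e))) (weighted_sum t)"

definition summation_ok :: "(coeffs \<times> int) list \<Rightarrow> bool" where
  "summation_ok t \<longleftrightarrow> list_all (\<lambda>(e, k). class_ok e) t \<and>
     gpoly_eq (weighted_sum t) (gpoly_smult (11520, 0) (gpoly_mult (gpoly_power (one_minus_power 1) 6) numer))"

text \<open>One evaluation checks exact divisibility for each class and the polynomial identity in s
  = t^8 that remains after all denominators are cleared.\<close>

lemma summation_ok_tally: "summation_ok tally"
  by code_simp

text \<open>The numerator is compared with the product of the initial terms and the denominator
  modulo s^6, so that no quotient of series has to be expanded.\<close>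

definition first_terms_ok :: bool where
  "first_terms_ok \<longleftrightarrow> list_all (\<lambda>a. a = (0,0))
     (take 6 (gpoly_add numer (gpoly_smult (-1,0) (gpoly_mult initial_dims denom))))"

lemma first_terms_ok: first_terms_ok
  by code_simp

lemma gpoly_eval_power: "gpoly_eval y (gpoly_power p k) = gpoly_eval y p ^ k"
  by (induction k) (simp_all add: gpoly_eval_mult gi_1)

lemma gpoly_eval_one_minus_power:
  assumes "k > 0"
  shows "gpoly_eval y (one_minus_power k) = 1 - y ^ k"
proof -
  have zero: "gpoly_eval y (replicate n (0,0)) = 0" for n
    by (induction n) (simp_all add: gi_0)
  obtain m where "k = Suc m" using assms by (cases k) auto
  then show ?thesis
    by (simp add: one_minus_power_def gpoly_eval_append zero gi_1 gi_minus_1 flip: fps_const_neg)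
qed

lemma coeffs_fps_scale: "coeffs_fps (scale_coeffs e) = gpoly_eval fps_X (char_gpoly e)"
proof -
  obtain e1 e2 e3 e4 where e: "e = (e1, e2, e3, e4)" by (cases e)
  have gi: "gi (4, 0) = 4" "gi (8, 0) = 8" "gi (16, 0) = 16"
    by (simp_all add: gi_def complex_eq_iff)
  show ?thesis
    unfolding e by (rule fps_ext)
      (simp add: char_fps_def gi gi_2 gi_gmul gi_1 gi_minus_1 algebra_simps power2_eq_square power3_eq_cube power4_eq_xxxx
        flip: fps_const_neg)
qed

lemma gpoly_eval_denom:
  "gpoly_eval (fps_X ^ 8) denom = (1 - fps_X ^ 8)\<^sup>2 * ((1 - fps_X ^ 24) ^ 4 * (1 - fps_X ^ 40)\<^sup>2)"
  by (simp add: denom_def gpoly_eval_mult gpoly_eval_power gpoly_eval_one_minus_power flip: power_mult)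

lemma gpoly_eval_common_denom:
  "gpoly_eval (fps_X ^ 8) common_denom = (1 - fps_X ^ 8) ^ 6 * gpoly_eval (fps_X ^ 8) denom"
  by (simp add: common_denom_def gpoly_eval_mult gpoly_eval_power gpoly_eval_one_minus_power)

lemma term_fps_class:
  assumes "class_ok e"
  shows "term_fps e * gpoly_eval (fps_X ^ 8) common_denom = gpoly_eval (fps_X ^ 8) (every8 (cofactor e))"
proof -
  let ?q = "gpoly_eval fps_X (char_gpoly (unscale_coeffs e))" and ?D = "gpoly_eval (fps_X ^ 8) common_denom"
  have e: "coeffs_fps e = ?q"
    using assms coeffs_fps_scale[of "unscale_coeffs e"] by (simp add: class_ok_def)
  have "gpoly_eval fps_X (gpoly_mult (square_gpoly e) (cofactor e)) = gpoly_eval fps_X (expand8 common_denom)"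
    using assms unfolding class_ok_def by (intro gpoly_eval_eq) blast
  then have eq: "?q\<^sup>2 * gpoly_eval fps_X (cofactor e) = ?D"
    by (simp add: gpoly_eval_mult gpoly_eval_expand8 power2_eq_square Let_def del: cofactor.simps)
  have "fps_nth (?q\<^sup>2) 0 \<noteq> 0"
    by (cases "unscale_coeffs e") (simp add: power2_eq_square gi_1)
  then have "?q\<^sup>2 * (1 / ?q\<^sup>2) = 1" by (rule fps_inverse_mult)
  then have "1 / ?q\<^sup>2 * ?D = gpoly_eval fps_X (cofactor e)"
    unfolding eq[symmetric] by (simp add: mult_ac flip: mult.assoc)
  then have "octal (1 / ?q\<^sup>2 * ?D) = octal (gpoly_eval fps_X (cofactor e))" by (rule arg_cong)
  then show ?thesis
    unfolding octal_gpoly_eval octal_mult[OF octal_gpoly_eval_8] term_fps_def e .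
qed

lemma fps_const_gi: "fps_const (gi (k, 0)) = (of_int k :: complex fps)"
  by (simp add: gi_def fps_of_int[symmetric] complex_eq_iff)

lemma weighted_sum:
  assumes "list_all (\<lambda>(e, k). class_ok e) t"
  shows "tally_sum t * gpoly_eval (fps_X ^ 8) common_denom = gpoly_eval (fps_X ^ 8) (weighted_sum t)"
  using assms
proof (induction t)
  case (Cons x t)
  obtain e k where x: "x = (e, k)" by (cases x)
  show ?case
    using Cons term_fps_class[of e]
    by (simp add: x fps_const_gi tally_sum_def gpoly_eval_add gpoly_eval_smult distrib_right mult.assoc del: cofactor.simps)
qed (simp add: tally_sum_def)

lemma jacobi_dim_series_mult_denom:
  "jacobi_dim_series * gpoly_eval (fps_X ^ 8) denom = gpoly_eval (fps_X ^ 8) numer"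
proof -
  let ?y = "fps_X ^ 8 :: complex fps"
  have "list_all (\<lambda>(e, k). class_ok e) tally"
    and eq: "gpoly_eq (weighted_sum tally) (gpoly_smult (11520, 0) (gpoly_mult (gpoly_power (one_minus_power 1) 6) numer))"
    using summation_ok_tally unfolding summation_ok_def by blast+
  then have "tally_sum tally * gpoly_eval ?y common_denom = gpoly_eval ?y (weighted_sum tally)"
    by (intro weighted_sum)
  also have "\<dots> = fps_const 11520 * ((1 - ?y) ^ 6 * gpoly_eval ?y numer)"
  proof -
    have "gi (11520, 0) = 11520" by (simp add: gi_def complex_eq_iff)
    then show ?thesis
      unfolding gpoly_eval_eq[OF eq] by (simp add: gpoly_eval_smult gpoly_eval_mult gpoly_eval_power gpoly_eval_one_minus_power)
  qed
  finally have "fps_const 11520 * jacobi_dim_series * ((1 - ?y) ^ 6 * gpoly_eval ?y denom)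
      = fps_const 11520 * ((1 - ?y) ^ 6 * gpoly_eval ?y numer)"
    unfolding jacobi_dim_series_eq_tally gpoly_eval_common_denom .
  then have "(fps_const 11520 * (1 - ?y) ^ 6) * (jacobi_dim_series * gpoly_eval ?y denom)
      = (fps_const 11520 * (1 - ?y) ^ 6) * gpoly_eval ?y numer"
    by (simp only: mult_ac)
  \<comment> \<open>The constant term is 11520, so this factor can be cancelled.\<close>
  moreover have "fps_const 11520 * (1 - ?y) ^ 6 \<noteq> 0"
  proof -
    have "fps_nth (fps_const 11520 * (1 - ?y) ^ 6) 0 \<noteq> 0" by (simp add: fps_power_zeroth)
    then show ?thesis by (metis fps_zero_nth)
  qed
  ultimately show ?thesis by (rule mult_left_cancel[THEN iffD1, rotated])
qed

theorem theorem5p6: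
  shows "let t = (fps_X :: complex fps);
             N = t^184 + 8*t^176 + 49*t^168 + 325*t^160 + 1240*t^152 + 3421*t^144
               + 7987*t^136 + 15287*t^128 + 24892*t^120 + 35648*t^112 + 45097*t^104
               + 50365*t^96 + 50365*t^88 + 45097*t^80 + 35648*t^72 + 24892*t^64
               + 15287*t^56 + 7987*t^48 + 3421*t^40 + 1240*t^32 + 325*t^24
               + 49*t^16 + 8*t^8 + 1
         in molien_series G2 = jacobi_dim_series
            \<and> jacobi_dim_series = N / ((1 - t^8)^2 * (1 - t^24)^4 * (1 - t^40)^2)
            \<and> fps_cutoff 48 jacobi_dim_series
                = 1 + 10*t^8 + 68*t^16 + 455*t^24 + 2114*t^32 + 7392*t^40"
proof -
  let ?y = "fps_X ^ 8 :: complex fps" and ?D = "gpoly_eval (fps_X ^ 8) denom"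
  have numer: "gpoly_eval ?y numer = fps_X^184 + 8*fps_X^176 + 49*fps_X^168 + 325*fps_X^160 + 1240*fps_X^152 + 3421*fps_X^144
               + 7987*fps_X^136 + 15287*fps_X^128 + 24892*fps_X^120 + 35648*fps_X^112 + 45097*fps_X^104
               + 50365*fps_X^96 + 50365*fps_X^88 + 45097*fps_X^80 + 35648*fps_X^72 + 24892*fps_X^64
               + 15287*fps_X^56 + 7987*fps_X^48 + 3421*fps_X^40 + 1240*fps_X^32 + 325*fps_X^24
               + 49*fps_X^16 + 8*fps_X^8 + 1"
    by (simp add: numer_def fps_const_gi distrib_left mult.left_commute[of "fps_X ^ _" "numeral _"] flip: power_add)
  have initial: "gpoly_eval ?y initial_dims = 1 + 10*fps_X^8 + 68*fps_X^16 + 455*fps_X^24 + 2114*fps_X^32 + 7392*fps_X^40"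
    by (simp add: initial_dims_def fps_const_gi distrib_left mult.left_commute[of "fps_X ^ _" "numeral _"] flip: power_add)
  have D0: "fps_nth ?D 0 = 1"
    by (simp add: gpoly_eval_denom fps_power_zeroth)
  have D: "?D * (1 / ?D) = 1" by (rule fps_inverse_mult) (simp add: D0)
  have D_nz: "?D \<noteq> 0" using D0 by auto
  have div: "jacobi_dim_series = gpoly_eval ?y numer / ?D"
    using jacobi_dim_series_mult_denom D_nz by (metis nonzero_mult_div_cancel_right)
  \<comment> \<open>The difference between the series and its listed terms, times the denominator.
    Its coefficients below s^6 vanish and the denominator is a unit, so the difference itself is
    divisible by t^48.\<close>
  let ?r = "gpoly_add numer (gpoly_smult (-1,0) (gpoly_mult initial_dims denom))"
  have "(jacobi_dim_series - gpoly_eval ?y initial_dims) * ?D = gpoly_eval ?y ?r"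
    by (simp add: gpoly_eval_add gpoly_eval_smult gpoly_eval_mult left_diff_distrib
        jacobi_dim_series_mult_denom gi_minus_1 flip: fps_const_neg)
  also have "\<dots> = gpoly_eval ?y (take 6 ?r @ drop 6 ?r)" by simp
  also have "\<dots> = fps_X ^ 48 * gpoly_eval ?y (drop 6 ?r)"
  proof -
    have zero: "list_all (\<lambda>a. a = (0,0)) p \<Longrightarrow> gpoly_eval ?y p = 0" for p
      by (induction p) (simp_all add: gi_0)
    have "length (take 6 ?r) = 6" by code_simp
    then show ?thesis
      unfolding gpoly_eval_append zero[OF first_terms_ok[unfolded first_terms_ok_def]]
      by (simp flip: power_mult)
  qed
  finally have "(jacobi_dim_series - gpoly_eval ?y initial_dims) * ?D * (1 / ?D)
      = fps_X ^ 48 * gpoly_eval ?y (drop 6 ?r) * (1 / ?D)" by simp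
  then have diff: "jacobi_dim_series - gpoly_eval ?y initial_dims = fps_X ^ 48 * (gpoly_eval ?y (drop 6 ?r) * (1 / ?D))"
    by (simp only: mult.assoc D mult_1_right)
  have cutoff: "fps_cutoff 48 jacobi_dim_series = gpoly_eval ?y initial_dims"
  proof (rule fps_ext)
    fix n
    show "fps_nth (fps_cutoff 48 jacobi_dim_series) n = fps_nth (gpoly_eval ?y initial_dims) n"
    proof (cases "n < 48")
      case True
      then have "fps_nth (jacobi_dim_series - gpoly_eval ?y initial_dims) n = 0"
        unfolding diff by (simp add: fps_X_power_mult_nth)
      then show ?thesis using True by simp
    next
      case False
      then show ?thesis
        unfolding initial by (simp add: fps_X_power_nth numeral_fps_const)
    qed
  qed
  show ?thesis
    unfolding Let_def using molien_series_eq div cutoff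
    by (simp only: numer initial gpoly_eval_denom mult.assoc)
qed

end
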